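(* Let $\boldsymbol{X}=(X_t)_{t\in\mathbb{Z}}$ be a strictly stationary time series taking values in a complete, separable metric space $S$, endowed with an origin $0$, a scalar multiplication, and a modulus $\rho$, and let $\alpha\in(0,\infty)$. For an index set $\mathbb{T}\in\{\mathbb{Z},\mathbb{Z}_+,\mathbb{Z}_-\}$, where $\mathbb{Z}_+=\{0,1,2,\ldots\}$ and $\mathbb{Z}_-=\{0,-1,-2,\ldots\}$, consider the statements: (ii$_{\mathbb{T}}$) The function $u\mapsto\Pr[\rho(X_0)>u]$ belongs to $\mathcal{R}_{-\alpha}$ and there exists a random element $(\Theta_t)_{t\in\mathbb{T}}\in S^{\mathbb{T}}$ such that, as $u\to\infty$, $\mathcal{L}((X_t/\rho(X_0))_{t\in\mathbb{T}}\mid\rho(X_0)>u)\rightsquigarrow(\Theta_t)_{t\in\mathbb{T}}$. (iii$_{\mathbb{T}}$) There exist a $\operatorname{Pareto}(\alpha)$ random variable $Y$ and a random element $(\Theta_t)_{t\in\mathbb{T}}\in S^{\mathbb{T}}$, independent of each other, such that, as $u\to\infty$, $\mathcal{L}(\rho(X_0)/u,(X_t/\rho(X_0))_{t\in\mathbb{T}}\mid\rho(X_0)>u)\rightsquigarrow(Y,(\Theta_t)_{t\in\mathbb{T}})$. Then the statements (ii$_{\mathbb{Z}}$) and (iii$_{\mathbb{Z}}$) are equivalent to the statements with $\mathbb{Z}$ replaced by $\mathbb{Z}_+$ or $\mathbb{Z}_-$, that is, the six statements (ii$_{\mathbb{T}}$), (iii$_{\mathbb{T}}$), $\mathbb{T}\in\{\mathbb{Z},\mathbb{Z}_+,\mathbb{Z}_-\}$,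 are equivalent. In that case, with $(\Theta_t)_{t\in\mathbb{Z}}$ the limit in (ii$_{\mathbb{Z}}$), $$\operatorname{E}[f(\Theta_{-s},\ldots,\Theta_t)]=\operatorname{E}\Big[f\Big(\frac{\Theta_0}{\rho(\Theta_s)},\ldots,\frac{\Theta_{t+s}}{\rho(\Theta_s)}\Big)\,\rho(\Theta_s)^\alpha\Big]$$ for all nonnegative integers $s$ and $t$ and for all integrable functions $f:S^{t+s+1}\to\mathbb{R}$ with the property that $f(\theta_{-s},\ldots,\theta_t)=0$ whenever $\theta_{-s}=0$.
   Context: Scalar multiplication: $(S,d)$ has a distinguished point $0$ (the origin), $S\neq\{0\}$, and a scalar multiplication on $S$ is a map $[0,\infty)\times S\to S:(\lambda,x)\mapsto\lambda x$ such that (i) $\lambda_1(\lambda_2x)=(\lambda_1\lambda_2)x$; (ii) $1x=x$; (iii) the map is continuous with respect to the product topology; (iv) if $x\neq0$ and $0\le\lambda_1<\lambda_2$, then $d(\lambda_1x,0)<d(\lambda_2x,0)$. We write $x/\lambda=\lambda^{-1}x$ for $\lambda>0$. Modulus: a function $\rho:S\to[0,\infty)$ is a modulus if (i) $\rho$ is continuous; (ii) $\rho(\lambda x)=\lambda\rho(x)$ for $\lambda\in[0,\infty)$, $x\in S$; (iii) for every $\varepsilon>0$, $\inf\{\rho(x):d(x,0)>\varepsilon\}>0$. In particular $\rho(x)=0$ iff $x=0$. Notation: for $\tau\in\mathbb{R}$, $\mathcal{R}_\tau$ is the class of positive measurable functions $g$ defined in a neighbourhood of infinity with $\lim_{u\to\infty}g(\lambda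 u)/g(u)=\lambda^\tau$ for every $\lambda>0$. $S^{\mathbb{T}}$ carries the product topology; $\rightsquigarrow$ is convergence in distribution; $\mathcal{L}(Y\mid A)$ is the law of $Y$ conditionally on the event $A$; $\operatorname{Pareto}(\alpha)$ is the law of $Y$ with $\Pr(Y>y)=y^{-\alpha}$, $y\ge1$. Conventions: "integrable functions" means real-valued, Borel-measurable functions such that one of the two expectations in the formula, and hence the other one, exists. On the right-hand side of the formula the integrand is interpreted as zero when $\rho(\Theta_s)$ is zero. *)

theory Defs
  imports "HOL-Probability.Probability"
begin

text \<open>
  The complete separable metric space is a type of class \<^class>\<open>polish_space\<close>; its origin,
  scalar multiplication and modulus are explicit parameters. Only the values of \<open>smul\<close> at
  nonnegative scalars matter.
\<close>

definition scalar_multiplication :: "'s::metric_space \<Rightarrow> (real \<Rightarrow> 's \<Rightarrow> 's) \<Rightarrow> bool" where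
  "scalar_multiplication orig smul \<longleftrightarrow>
     (UNIV :: 's set) \<noteq> {orig} \<and>
     (\<forall>a\<ge>0. \<forall>b\<ge>0. \<forall>x. smul a (smul b x) = smul (a * b) x) \<and>
     (\<forall>x. smul 1 x = x) \<and>
     continuous_on ({0..} \<times> UNIV) (\<lambda>(a, x). smul a x) \<and>
     (\<forall>x a b. x \<noteq> orig \<and> 0 \<le> a \<and> a < b \<longrightarrow> dist (smul a x) orig < dist (smul b x) orig)"

text \<open>
  The infimum is taken in \<^typ>\<open>ereal\<close>, because in a bounded space the set can be empty, and
  then its infimum is \<open>\<infinity>\<close>.
\<close>

definition modulus :: "'s::metric_space \<Rightarrow> (real \<Rightarrow> 's \<Rightarrow> 's) \<Rightarrow> ('s \<Rightarrow> real) \<Rightarrow> bool" where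
  "modulus orig smul \<rho> \<longleftrightarrow>
     (\<forall>x. 0 \<le> \<rho> x) \<and>
     continuous_on UNIV \<rho> \<and>
     (\<forall>a\<ge>0. \<forall>x. \<rho> (smul a x) = a * \<rho> x) \<and>
     (\<forall>\<epsilon>>0. 0 < (INF x\<in>{x. dist x orig > \<epsilon>}. ereal (\<rho> x)))"

definition regularly_varying :: "real \<Rightarrow> (real \<Rightarrow> real) \<Rightarrow> bool" where
  "regularly_varying \<tau> g \<longleftrightarrow>
     (\<exists>u\<^sub>0. (\<forall>u>u\<^sub>0. 0 < g u) \<and> g \<in> borel_measurable (restrict_space borel {u\<^sub>0<..})) \<and>
     (\<forall>c>0. ((\<lambda>u. g (c * u) / g u) \<longlongrightarrow> c powr \<tau>) at_top)"

definition strictly_stationary :: "'w measure \<Rightarrow> (int \<Rightarrow> 'w \<Rightarrow> 's::topological_space) \<Rightarrow> bool" where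
  "strictly_stationary M X \<longleftrightarrow>
     (\<forall>J h. finite J \<longrightarrow>
        distr M (PiM J (\<lambda>_. borel)) (\<lambda>\<omega>. \<lambda>t\<in>J. X (t + h) \<omega>) =
        distr M (PiM J (\<lambda>_. borel)) (\<lambda>\<omega>. \<lambda>t\<in>J. X t \<omega>))"

definition converges_weakly_in ::
    "'a topology \<Rightarrow> ('i \<Rightarrow> 'a measure) \<Rightarrow> 'a measure \<Rightarrow> 'i filter \<Rightarrow> bool" where
  "converges_weakly_in \<X> \<mu> \<nu> F \<longleftrightarrow>
     (\<forall>f. continuous_map \<X> euclideanreal f \<and> bounded (f ` topspace \<X>) \<longrightarrow>
        ((\<lambda>i. \<integral>x. f x \<partial>\<mu> i) \<longlongrightarrow> (\<integral>x. f x \<partial>\<nu>)) F)"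

text \<open>
  If \<open>A\<close> is a null event, \<open>cond_law M A N f\<close> is the null measure. Weak convergence of conditional
  laws to a probability measure therefore forces the conditioning events to be
  eventually of positive probability.
\<close>

definition cond_law :: "'w measure \<Rightarrow> 'w set \<Rightarrow> 'a measure \<Rightarrow> ('w \<Rightarrow> 'a) \<Rightarrow> 'a measure" where
  "cond_law M A N f = distr (uniform_measure M A) N f"

definition pareto_distributed :: "'b measure \<Rightarrow> real \<Rightarrow> ('b \<Rightarrow> real) \<Rightarrow> bool" where
  "pareto_distributed N \<alpha> Y \<longleftrightarrow>
     Y \<in> borel_measurable N \<and> (\<forall>y\<ge>1. measure N {\<omega>\<in>space N. Y \<omega> > y} = y powr (- \<alpha>))"

text \<open>
  Independence of the generated \<open>\<sigma>\<close>-algebras; \<^const>\<open>prob_space.indep_var\<close> cannot be used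
  here because it forces both random elements to have the same value type.
\<close>

definition independent_elements ::
    "'b measure \<Rightarrow> 'c measure \<Rightarrow> ('b \<Rightarrow> 'c) \<Rightarrow> 'd measure \<Rightarrow> ('b \<Rightarrow> 'd) \<Rightarrow> bool" where
  "independent_elements N K Y L Z \<longleftrightarrow>
     prob_space.indep_set N {Y -` A \<inter> space N | A. A \<in> sets K} {Z -` B \<inter> space N | B. B \<in> sets L}"

text \<open>
  \<open>S\<^sup>T\<close> is the set of extensional functions on \<open>T\<close>, with the product topology and the product
  \<open>\<sigma>\<close>-algebra; the latter is the Borel \<open>\<sigma>\<close>-algebra of the former, since \<open>T\<close> is countable and
  \<open>S\<close> is separable.
\<close>

definition spectral_limit ::
    "'w measure \<Rightarrow> (int \<Rightarrow> 'w \<Rightarrow> 's::polish_space) \<Rightarrow> (real \<Rightarrow> 's \<Rightarrow> 's) \<Rightarrow> ('s \<Rightarrow> real) \<Rightarrow> int set \<Rightarrow>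
     'b measure \<Rightarrow> (int \<Rightarrow> 'b \<Rightarrow> 's) \<Rightarrow> bool" where
  "spectral_limit M X smul \<rho> T N \<Theta> \<longleftrightarrow>
     prob_space N \<and> (\<forall>t\<in>T. \<Theta> t \<in> borel_measurable N) \<and>
     converges_weakly_in (product_topology (\<lambda>_. euclidean) T)
       (\<lambda>u. cond_law M {\<omega>\<in>space M. \<rho> (X 0 \<omega>) > u} (PiM T (\<lambda>_. borel))
              (\<lambda>\<omega>. \<lambda>t\<in>T. smul (1 / \<rho> (X 0 \<omega>)) (X t \<omega>)))
       (distr N (PiM T (\<lambda>_. borel)) (\<lambda>\<omega>. \<lambda>t\<in>T. \<Theta> t \<omega>))
       at_top"

definition polar_limit ::
    "'w measure \<Rightarrow> (int \<Rightarrow> 'w \<Rightarrow> 's::polish_space) \<Rightarrow> (real \<Rightarrow> 's \<Rightarrow> 's) \<Rightarrow> ('s \<Rightarrow> real) \<Rightarrow> int set \<Rightarrow>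
     'b measure \<Rightarrow> ('b \<Rightarrow> real) \<Rightarrow> (int \<Rightarrow> 'b \<Rightarrow> 's) \<Rightarrow> bool" where
  "polar_limit M X smul \<rho> T N Y \<Theta> \<longleftrightarrow>
     prob_space N \<and> Y \<in> borel_measurable N \<and> (\<forall>t\<in>T. \<Theta> t \<in> borel_measurable N) \<and>
     converges_weakly_in (prod_topology euclideanreal (product_topology (\<lambda>_. euclidean) T))
       (\<lambda>u. cond_law M {\<omega>\<in>space M. \<rho> (X 0 \<omega>) > u} (borel \<Otimes>\<^sub>M PiM T (\<lambda>_. borel))
              (\<lambda>\<omega>. (\<rho> (X 0 \<omega>) / u, \<lambda>t\<in>T. smul (1 / \<rho> (X 0 \<omega>)) (X t \<omega>))))
       (distr N (borel \<Otimes>\<^sub>M PiM T (\<lambda>_. borel)) (\<lambda>\<omega>. (Y \<omega>, \<lambda>t\<in>T. \<Theta> t \<omega>)))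
       at_top"

text \<open>
  A definition cannot quantify existentially over the type of the sample space. In the two
  definitions below the limiting random elements live on \<open>S\<^sup>\<int>\<close> and \<open>\<real> \<times> S\<^sup>\<int>\<close>, respectively; by
  passing to the canonical coordinate process, every law of the required kind is realised there.
\<close>

definition has_spectral_limit ::
    "'w measure \<Rightarrow> (int \<Rightarrow> 'w \<Rightarrow> 's::polish_space) \<Rightarrow> (real \<Rightarrow> 's \<Rightarrow> 's) \<Rightarrow> ('s \<Rightarrow> real) \<Rightarrow> real \<Rightarrow>
     int set \<Rightarrow> bool" where
  "has_spectral_limit M X smul \<rho> \<alpha> T \<longleftrightarrow>
     regularly_varying (- \<alpha>) (\<lambda>u. measure M {\<omega>\<in>space M. \<rho> (X 0 \<omega>) > u}) \<and>
     (\<exists>(N :: (int \<Rightarrow> 's) measure) \<Theta>. spectral_limit M X smul \<rho> T N \<Theta>)"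

definition has_polar_limit ::
    "'w measure \<Rightarrow> (int \<Rightarrow> 'w \<Rightarrow> 's::polish_space) \<Rightarrow> (real \<Rightarrow> 's \<Rightarrow> 's) \<Rightarrow> ('s \<Rightarrow> real) \<Rightarrow> real \<Rightarrow>
     int set \<Rightarrow> bool" where
  "has_polar_limit M X smul \<rho> \<alpha> T \<longleftrightarrow>
     (\<exists>(N :: (real \<times> (int \<Rightarrow> 's)) measure) Y \<Theta>.
        polar_limit M X smul \<rho> T N Y \<Theta> \<and>
        pareto_distributed N \<alpha> Y \<and>
        independent_elements N borel Y (PiM T (\<lambda>_. borel)) (\<lambda>\<omega>. \<lambda>t\<in>T. \<Theta> t \<omega>))"

end

theory Submission
  imports Defs
begin

text \<open>
  Conditionally on an exceedance, \<open>\<rho> (X 0) / u\<close> and the angular process decouple because the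
  tail probability scales like a power, so regular variation upgrades the spectral limit to the polar one.
  By stationarity, the angular process seen from an exceedance at time \<open>- s\<close> is the one seen from time \<open>0\<close>,
  shifted and rescaled; where the coordinate at \<open>- s\<close> is not the origin this expresses the limit with
  past coordinates through the forward limit and yields the time change formula. The mass on which
  that coordinate is the origin is inherited from the limit with one past coordinate less, so all
  windows \<open>{- s..}\<close> have a limit law, and Kolmogorov's theorem glues these laws together. The backward
  statement is the forward one for the time-reversed series.

  The space \<open>int \<Rightarrow> 's\<close> is itself Polish, with the product \<open>\<sigma>\<close>-algebra as its Borel sets; laws on
  \<open>S\<^sup>T\<close> are represented on it by setting the coordinates outside \<open>T\<close> to the origin.
\<close>

subsection \<open>Weak convergence on metric spaces\<close>

text \<open>Shifting and rescaling a path is discontinuous where the coordinate that is divided by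
  is the origin, so the continuous mapping theorem cannot produce the time change limit directly.
  Test functions are therefore multiplied by a cutoff that vanishes where the coordinate at
  \<open>- s\<close> has modulus at most \<delta>, and \<delta> tends to 0 only after the level u
  has tended to infinity. The weight with exponent \<alpha> is not known in advance to have a finite
  mean; Fatou's lemma along the cutoffs bounds this mean by 1. It may be smaller than 1, because it
  is the probability that the coordinate at \<open>- s\<close> is not the origin. The law with one
  more past coordinate is thus a sum of a tilted forward law and a difference of two measures, and
  an inequality between measures has to be shown before that law exists. All convergence statements
  are reduced to Lipschitz test functions, because these change only by a uniformly small amount
  when a coordinate of small modulus is replaced by the origin, when far coordinates are dropped, or
  when the radial part is discretised.\<close>

lemma tendsto_sandwich_approx:
  fixes f :: "'i \<Rightarrow> real"
  assumes "\<And>e. e > 0 \<Longrightarrow> \<exists>lo hi a b. (lo \<longlongrightarrow> a) F \<and> (hi \<longlongrightarrow> b) F \<and>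
      (\<forall>\<^sub>F i in F. lo i \<le> f i \<and> f i \<le> hi i) \<and> c - e \<le> a \<and> b \<le> c + e"
  shows "(f \<longlongrightarrow> c) F"
proof (rule tendstoI)
  fix e :: real assume "e > 0"
  then obtain lo hi a b where *: "(lo \<longlongrightarrow> a) F" "(hi \<longlongrightarrow> b) F"
      "\<forall>\<^sub>F i in F. lo i \<le> f i \<and> f i \<le> hi i" "c - e/2 \<le> a" "b \<le> c + e/2"
    using assms[of "e/2"] by (auto simp: field_simps)
  have "\<forall>\<^sub>F i in F. c - e < lo i"
    using order_tendstoD(1)[OF *(1), of "c - e"] *(4) \<open>e > 0\<close> by linarith
  moreover have "\<forall>\<^sub>F i in F. hi i < c + e"
    using order_tendstoD(2)[OF *(2), of "c + e"] *(5) \<open>e > 0\<close> by linarith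
  ultimately show "\<forall>\<^sub>F i in F. dist (f i) c < e"
    using *(3) by eventually_elim (auto simp: dist_real_def)
qed

text \<open>The three-epsilon argument for interchanging limits: the comparison function and its
  limit may both depend on \<open>e\<close>, and the error has to be small only eventually.\<close>

lemma tendsto_uniform_approx:
  fixes f :: "'i \<Rightarrow> real"
  assumes "\<And>e. e > 0 \<Longrightarrow>
    \<exists>g l. (g \<longlongrightarrow> l) F \<and> (\<forall>\<^sub>F i in F. \<bar>f i - g i\<bar> \<le> e) \<and> \<bar>l - c\<bar> \<le> e"
  shows "(f \<longlongrightarrow> c) F"
proof (rule tendsto_sandwich_approx)
  fix e :: real assume "e > 0"
  then obtain g l where *: "(g \<longlongrightarrow> l) F" "\<forall>\<^sub>F i in F. \<bar>f i - g i\<bar> \<le> e/2" "\<bar>l - c\<bar> \<le> e/2"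
    using assms[of "e/2"] by (auto simp: field_simps)
  have "((\<lambda>i. g i - e/2) \<longlongrightarrow> l - e/2) F" "((\<lambda>i. g i + e/2) \<longlongrightarrow> l + e/2) F"
    by (intro tendsto_intros *(1))+
  moreover have "\<forall>\<^sub>F i in F. g i - e/2 \<le> f i \<and> f i \<le> g i + e/2"
    using *(2) by eventually_elim linarith
  moreover have "c - e \<le> l - e/2" "l + e/2 \<le> c + e"
    using *(3) by linarith+
  ultimately show "\<exists>lo hi a b. (lo \<longlongrightarrow> a) F \<and> (hi \<longlongrightarrow> b) F \<and>
      (\<forall>\<^sub>F i in F. lo i \<le> f i \<and> f i \<le> hi i) \<and> c - e \<le> a \<and> b \<le> c + e"
    by blast
qed

text \<open>This is the Pasch-Hausdorff envelope, an inf-convolution with a multiple of the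
  distance; for nonnegative \<open>f\<close> and \<open>L\<close> it is the largest
  \<open>L\<close>-Lipschitz function below \<open>f\<close>.\<close>

definition lipschitz_regularization :: "real \<Rightarrow> ('a::metric_space \<Rightarrow> real) \<Rightarrow> 'a \<Rightarrow> real" where
  "lipschitz_regularization L f x = (INF y. f y + L * dist x y)"

context
  fixes f :: "'a::metric_space \<Rightarrow> real" and L :: real
  assumes f_nonneg: "\<And>x. 0 \<le> f x" and L_nonneg: "0 \<le> L"
begin

lemma bdd_below_lipschitz_regularization: "bdd_below (range (\<lambda>y. f y + L * dist x y))"
  by (rule bdd_belowI[of _ 0]) (auto simp: f_nonneg L_nonneg)

lemma lipschitz_regularization_le: "lipschitz_regularization L f x \<le> f x"
  unfolding lipschitz_regularization_def
  using cINF_lower[OF bdd_below_lipschitz_regularization, of x x] by simp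

lemma lipschitz_regularization_nonneg: "0 \<le> lipschitz_regularization L f x"
  unfolding lipschitz_regularization_def by (rule cINF_greatest) (auto simp: f_nonneg L_nonneg)

text \<open>Each function under the infimum is \<open>L\<close>-Lipschitz in \<open>x\<close>, and
  infima inherit the constant.\<close>

lemma lipschitz_on_lipschitz_regularization: "L-lipschitz_on UNIV (lipschitz_regularization L f)"
proof -
  have *: "lipschitz_regularization L f x \<le> lipschitz_regularization L f z + L * dist x z" for x z
  proof -
    have "lipschitz_regularization L f x - L * dist x z \<le> f y + L * dist z y" for y
    proof -
      have "lipschitz_regularization L f x \<le> f y + L * dist x y"
        unfolding lipschitz_regularization_def
        using cINF_lower[OF bdd_below_lipschitz_regularization, of y x] by simp
      also have "\<dots> \<le> f y + L * (dist x z + dist z y)"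
        using L_nonneg dist_triangle[of x y z] by (intro add_left_mono mult_left_mono) auto
      finally show ?thesis by (simp add: algebra_simps)
    qed
    then have "lipschitz_regularization L f x - L * dist x z \<le> lipschitz_regularization L f z"
      unfolding lipschitz_regularization_def[of L f z] by (intro cINF_greatest) auto
    then show ?thesis by simp
  qed
  show ?thesis
  proof (rule lipschitz_onI)
    fix x y show "dist (lipschitz_regularization L f x) (lipschitz_regularization L f y) \<le> L * dist x y"
      using *[of x y] *[of y x] by (auto simp: dist_real_def dist_commute)
  qed (rule L_nonneg)
qed

end

text \<open>Points near \<open>x\<close> contribute almost \<open>f x\<close> by continuity; points
  at distance at least \<open>d\<close> contribute at least \<open>n * d\<close>, as
  \<open>f\<close> is nonnegative, and this reaches \<open>f x\<close> for large
  \<open>n\<close>.\<close>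

lemma lipschitz_regularization_tendsto:
  fixes f :: "'a::metric_space \<Rightarrow> real"
  assumes "continuous_on UNIV f" and nonneg: "\<And>x. 0 \<le> f x"
  shows "(\<lambda>n. lipschitz_regularization (real n) f x) \<longlonglongrightarrow> f x"
proof (rule tendstoI)
  fix e :: real assume "e > 0"
  then obtain d where "d > 0" and d: "\<And>y. dist y x < d \<Longrightarrow> dist (f y) (f x) < e/2"
    using \<open>continuous_on UNIV f\<close> unfolding continuous_on_iff by (metis UNIV_I half_gt_zero)
  obtain N :: nat where N: "f x / d \<le> real N" using real_arch_simple by blast
  have "dist (lipschitz_regularization (real n) f x) (f x) < e" if "n \<ge> N" for n
  proof -
    have "f x - e/2 \<le> f y + real n * dist x y" for y
    proof (cases "dist y x < d")
      case True
      have "0 \<le> real n * dist x y" by simp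
      then show ?thesis using d[OF True] unfolding dist_real_def by linarith
    next
      case False
      have "f x \<le> real n * d" using N that \<open>d > 0\<close>
        by (meson le_divide_eq mult_right_mono of_nat_le_iff order_trans pos_divide_le_eq less_imp_le)
      also have "\<dots> \<le> real n * dist x y" using False by (intro mult_left_mono) (auto simp: dist_commute)
      finally show ?thesis using nonneg[of y] \<open>e > 0\<close> by linarith
    qed
    then have "f x - e/2 \<le> lipschitz_regularization (real n) f x"
      unfolding lipschitz_regularization_def by (intro cINF_greatest) auto
    moreover have "lipschitz_regularization (real n) f x \<le> f x"
      by (rule lipschitz_regularization_le) (auto simp: nonneg)
    ultimately show ?thesis using \<open>e > 0\<close> by (auto simp: dist_real_def)
  qed
  then show "\<forall>\<^sub>F n in sequentially. dist (lipschitz_regularization (real n) f x) (f x) < e"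
    using eventually_sequentially by blast
qed

lemma finite_measure_integrable_bounded:
  fixes h :: "'a::topological_space \<Rightarrow> real"
  assumes "finite_measure \<mu>" "sets \<mu> = sets borel" "h \<in> borel_measurable borel" "\<And>x. \<bar>h x\<bar> \<le> C"
  shows "integrable \<mu> h"
proof -
  interpret finite_measure \<mu> by fact
  show ?thesis
    using assms(2,3,4) by (intro integrable_const_bound[of _ C]) (auto cong: measurable_cong_sets)
qed

text \<open>Dominated convergence along the envelopes of slope \<open>n\<close>. Envelopes are
  minorants, so the approximation is one-sided; upper bounds are obtained by passing to the negative
  of a function.\<close>

lemma integral_lipschitz_approx_below:
  fixes f :: "'a::metric_space \<Rightarrow> real"
  assumes "finite_measure \<nu>" "sets \<nu> = sets borel"
    and f: "continuous_on UNIV f" "\<And>x. 0 \<le> f x" "\<And>x. f x \<le> C" and "e > 0"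
  obtains L h where "L-lipschitz_on UNIV h" "\<And>x. 0 \<le> h x" "\<And>x. h x \<le> f x"
    "(\<integral>x. f x \<partial>\<nu>) - e \<le> (\<integral>x. h x \<partial>\<nu>)"
proof -
  interpret finite_measure \<nu> by fact
  define h where "h n = lipschitz_regularization (real n) f" for n :: nat
  have h: "(real n)-lipschitz_on UNIV (h n)" "0 \<le> h n x" "h n x \<le> f x" for n x
    unfolding h_def using f(2)
    by (auto intro: lipschitz_on_lipschitz_regularization lipschitz_regularization_nonneg
        lipschitz_regularization_le)
  have [measurable]: "f \<in> borel_measurable \<nu>"
    using f(1) assms(2) borel_measurable_continuous_onI measurable_cong_sets by blast
  have [measurable]: "h n \<in> borel_measurable \<nu>" for n
    using h(1)[of n] assms(2)
    by (metis borel_measurable_continuous_onI lipschitz_on_continuous_on measurable_cong_sets of_nat_0_le_iff)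
  have "(\<lambda>n. \<integral>x. h n x \<partial>\<nu>) \<longlonglongrightarrow> (\<integral>x. f x \<partial>\<nu>)"
  proof (rule integral_dominated_convergence[where w="\<lambda>_. C"])
    show "AE x in \<nu>. (\<lambda>n. h n x) \<longlonglongrightarrow> f x"
      unfolding h_def using lipschitz_regularization_tendsto[OF f(1,2)] by auto
    show "AE x in \<nu>. norm (h n x) \<le> C" for n
      using h(2)[of n] order_trans[OF h(3)[of n] f(3)] by auto
  qed (auto)
  then have "\<forall>\<^sub>F n in sequentially. (\<integral>x. f x \<partial>\<nu>) - e < (\<integral>x. h n x \<partial>\<nu>)"
    using order_tendstoD(1) \<open>e > 0\<close> by fastforce
  then obtain n where "(\<integral>x. f x \<partial>\<nu>) - e < (\<integral>x. h n x \<partial>\<nu>)"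
    by (auto simp: eventually_sequentially)
  then show thesis
    using h[of n] by (intro that[of "real n" "h n"]) auto
qed

lemma converges_weakly_in_euclidean_iff:
  "converges_weakly_in euclidean \<mu> \<nu> F \<longleftrightarrow>
    (\<forall>f::'a::topological_space \<Rightarrow> real. continuous_on UNIV f \<and> bounded (range f) \<longrightarrow>
        ((\<lambda>i. \<integral>x. f x \<partial>\<mu> i) \<longlongrightarrow> (\<integral>x. f x \<partial>\<nu>)) F)"
  by (simp add: converges_weakly_in_def)

text \<open>A bounded continuous function, made nonnegative by adding its bound \<open>C\<close>,
  has Lipschitz minorants with almost the same integral under \<open>\<nu>\<close>. This bounds the
  integrals asymptotically from below, and the same argument for \<open>- f\<close> bounds them from
  above.\<close>

lemma converges_weakly_lipschitzI:
  fixes \<mu> :: "'i \<Rightarrow> 'a::metric_space measure"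
  assumes \<mu>: "\<And>i. finite_measure (\<mu> i)" "\<And>i. sets (\<mu> i) = sets borel"
    and \<nu>: "finite_measure \<nu>" "sets \<nu> = sets borel"
    and conv: "\<And>(h :: 'a \<Rightarrow> real) L C. L-lipschitz_on UNIV h \<Longrightarrow> (\<And>x. 0 \<le> h x) \<Longrightarrow> (\<And>x. h x \<le> C) \<Longrightarrow>
      ((\<lambda>i. \<integral>x. h x \<partial>\<mu> i) \<longlongrightarrow> (\<integral>x. h x \<partial>\<nu>)) F"
  shows "converges_weakly_in euclidean \<mu> \<nu> F"
  unfolding converges_weakly_in_euclidean_iff
proof (intro allI impI, elim conjE)
  fix f :: "'a \<Rightarrow> real" assume f: "continuous_on UNIV f" "bounded (range f)"
  then obtain C where C: "\<And>x. \<bar>f x\<bar> \<le> C" by (auto simp: bounded_iff)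
  note int = finite_measure_integrable_bounded[OF \<mu>] finite_measure_integrable_bounded[OF \<nu>]
  note cm = borel_measurable_continuous_onI[where 'b = real]
  have lip: "h \<in> borel_measurable borel" if "L-lipschitz_on UNIV h" for L and h :: "'a \<Rightarrow> real"
    using that by (intro cm) (rule lipschitz_on_continuous_on)
  have low: "\<exists>lo a. (lo \<longlongrightarrow> a) F \<and> (\<forall>i. lo i \<le> (\<integral>x. g x \<partial>\<mu> i)) \<and> (\<integral>x. g x \<partial>\<nu>) - e \<le> a"
    if g: "continuous_on UNIV g" "\<And>x. \<bar>g x\<bar> \<le> C" and "e > 0" for g :: "'a \<Rightarrow> real" and e
  proof -
    have g1: "continuous_on UNIV (\<lambda>x. g x + C)" by (intro continuous_intros g)
    have g2: "0 \<le> g x + C" "g x + C \<le> 2 * C" for x using g(2)[of x] by auto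
    obtain L h where h: "L-lipschitz_on UNIV h" "\<And>x. 0 \<le> h x" "\<And>x. h x \<le> g x + C"
      "(\<integral>x. g x + C \<partial>\<nu>) - e \<le> (\<integral>x. h x \<partial>\<nu>)"
      using integral_lipschitz_approx_below[OF \<nu> g1 g2 \<open>e > 0\<close>] by metis
    have hC: "h x \<le> 2 * C" for x using h(3)[of x] g2(2)[of x] by linarith
    have hC': "\<bar>h x\<bar> \<le> 2 * C" for x using h(2)[of x] hC[of x] by linarith
    \<comment> \<open>Constants are Lipschitz, so the hypothesis also yields the convergence of the
      total masses; the \<open>\<mu> i\<close> are finite measures whose mass may vary with
      \<open>i\<close>.\<close>
    have ci: "0-lipschitz_on UNIV (\<lambda>x::'a. C)" by (simp add: lipschitz_on_def)
    have C0: "0 \<le> C" using C[of undefined] by linarith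
    have 1: "((\<lambda>i. (\<integral>x. h x \<partial>\<mu> i) - (\<integral>x. C \<partial>\<mu> i)) \<longlongrightarrow> (\<integral>x. h x \<partial>\<nu>) - (\<integral>x. C \<partial>\<nu>)) F"
      by (intro tendsto_diff conv[OF h(1,2) hC] conv[OF ci C0, of C]) auto
    have gi: "integrable (\<mu> i) g" "integrable \<nu> g" for i
      using g by (auto intro!: int[where C=C] cm)
    have Ci: "integrable (\<mu> i) (\<lambda>x. C)" "integrable \<nu> (\<lambda>x. C)" for i
      using C0 by (auto intro!: int[where C=C])
    have hi: "integrable (\<mu> i) h" "integrable \<nu> h" for i
      using lip[OF h(1)] hC' by (auto intro!: int[where C="2 * C"])
    have 2: "(\<integral>x. h x \<partial>\<mu> i) - (\<integral>x. C \<partial>\<mu> i) \<le> (\<integral>x. g x \<partial>\<mu> i)" for i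
    proof -
      have "(\<integral>x. h x \<partial>\<mu> i) \<le> (\<integral>x. g x + C \<partial>\<mu> i)"
        using h(3) hi gi Ci by (intro integral_mono) auto
      then show ?thesis using gi Ci by simp
    qed
    have 3: "(\<integral>x. g x \<partial>\<nu>) - e \<le> (\<integral>x. h x \<partial>\<nu>) - (\<integral>x. C \<partial>\<nu>)"
      using h(4) gi Ci by simp
    show ?thesis using 1 2 3 by blast
  qed
  show "((\<lambda>i. \<integral>x. f x \<partial>\<mu> i) \<longlongrightarrow> (\<integral>x. f x \<partial>\<nu>)) F"
  proof (rule tendsto_sandwich_approx)
    fix e :: real assume "e > 0"
    obtain lo a where lo: "(lo \<longlongrightarrow> a) F" "\<And>i. lo i \<le> (\<integral>x. f x \<partial>\<mu> i)" "(\<integral>x. f x \<partial>\<nu>) - e \<le> a"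
      using low[OF f(1) C \<open>e > 0\<close>] by blast
    have "continuous_on UNIV (\<lambda>x. - f x)" "\<And>x. \<bar>- f x\<bar> \<le> C" using f C by (auto intro: continuous_intros)
    from low[OF this \<open>e > 0\<close>] obtain lo' a' where lo': "(lo' \<longlongrightarrow> a') F" "\<And>i. lo' i \<le> - (\<integral>x. f x \<partial>\<mu> i)"
      "- (\<integral>x. f x \<partial>\<nu>) - e \<le> a'"
      by auto
    show "\<exists>lo hi a b. (lo \<longlongrightarrow> a) F \<and> (hi \<longlongrightarrow> b) F \<and>
      (\<forall>\<^sub>F i in F. lo i \<le> (\<integral>x. f x \<partial>\<mu> i) \<and> (\<integral>x. f x \<partial>\<mu> i) \<le> hi i) \<and>
      (\<integral>x. f x \<partial>\<nu>) - e \<le> a \<and> b \<le> (\<integral>x. f x \<partial>\<nu>) + e"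
      using lo lo' 
      by (intro exI[of _ lo] exI[of _ "\<lambda>i. - lo' i"] exI[of _ a] exI[of _ "- a'"])
        (auto intro!: tendsto_intros always_eventually simp: le_minus_iff algebra_simps)
  qed
qed

text \<open>Indicators of open sets are limits of the continuous functions
  \<open>min 1 (n * infdist x (- U))\<close>, and finite Borel measures on a Polish space are outer
  regular, which extends the inequality from open sets to all Borel sets.\<close>

lemma emeasure_le_of_integral_le:
  fixes \<kappa> \<nu> :: "'a::{metric_space, second_countable_topology, complete_space} measure"
  assumes \<kappa>: "finite_measure \<kappa>" "sets \<kappa> = sets borel"
    and \<nu>: "finite_measure \<nu>" "sets \<nu> = sets borel"
    and le: "\<And>h :: 'a \<Rightarrow> real. continuous_on UNIV h \<Longrightarrow> (\<And>x. 0 \<le> h x) \<Longrightarrow> (\<And>x. h x \<le> 1) \<Longrightarrow>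
      (\<integral>x. h x \<partial>\<kappa>) \<le> (\<integral>x. h x \<partial>\<nu>)"
    and A: "A \<in> sets borel"
  shows "emeasure \<kappa> A \<le> emeasure \<nu> A"
proof -
  interpret k: finite_measure \<kappa> by fact
  interpret n: finite_measure \<nu> by fact
  have op: "emeasure \<kappa> U \<le> emeasure \<nu> U" if U: "open U" for U
  proof (cases "U = UNIV")
    \<comment> \<open>The distance \<open>infdist\<close> to the empty set is 0 by convention, so
      the functions \<open>h\<close> used below would vanish identically for
      \<open>U = UNIV\<close>; here the constant 1 is the test function.\<close>
    case True
    have "measure \<kappa> UNIV \<le> measure \<nu> UNIV"
      using le[of "\<lambda>_. 1"] sets_eq_imp_space_eq[OF \<kappa>(2)] sets_eq_imp_space_eq[OF \<nu>(2)] by simp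
    then show ?thesis by (simp add: True k.emeasure_eq_measure n.emeasure_eq_measure ennreal_leI)
  next
    case False
    then have ne: "- U \<noteq> {}" by auto
    define h where "h n x = min 1 (real n * infdist x (- U))" for n x
    have hc: "continuous_on UNIV (h n)" for n unfolding h_def by (intro continuous_intros)
    have h01: "0 \<le> h n x" "h n x \<le> 1" for n x by (auto simp: h_def infdist_nonneg)
    have lim: "(\<lambda>n. h n x) \<longlonglongrightarrow> indicator U x" for x
    proof (cases "x \<in> U")
      case True
      then have "infdist x (- U) > 0"
        using ne U by (metis ComplD closed_Compl in_closed_iff_infdist_zero infdist_nonneg order_le_less)
      then obtain N :: nat where "1 < real N * infdist x (- U)" using reals_Archimedean3 by blast
      then have "h n x = 1" if "n \<ge> N" for n
        using that \<open>infdist x (- U) > 0\<close> unfolding h_def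
        by (smt (verit) mult_right_mono of_nat_mono)
      then show ?thesis using True
        by (auto intro!: tendsto_eventually eventually_sequentiallyI[of N])
    qed (auto simp: h_def)
    have int: "(\<lambda>n. \<integral>x. h n x \<partial>\<mu>) \<longlonglongrightarrow> measure \<mu> U"
      if \<mu>: "finite_measure \<mu>" "sets \<mu> = sets borel" for \<mu> :: "'a measure"
    proof -
      interpret finite_measure \<mu> by fact
      have "(\<lambda>n. \<integral>x. h n x \<partial>\<mu>) \<longlonglongrightarrow> (\<integral>x. indicator U x \<partial>\<mu>)"
      proof (rule integral_dominated_convergence[where w="\<lambda>_. 1"])
        show "h n \<in> borel_measurable \<mu>" for n
          using hc \<mu>(2) borel_measurable_continuous_onI measurable_cong_sets by blast
        show "indicat_real U \<in> borel_measurable \<mu>" using U \<mu>(2) by (intro borel_measurable_indicator) auto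
      qed (use lim h01 in auto)
      then show ?thesis using U \<mu> by simp
    qed
    have "measure \<kappa> U \<le> measure \<nu> U"
      by (rule LIMSEQ_le[OF int[OF \<kappa>] int[OF \<nu>]]) (auto intro!: le hc h01)
    then show ?thesis by (simp add: k.emeasure_eq_measure n.emeasure_eq_measure ennreal_leI)
  qed
  have "emeasure \<nu> A = (INF U\<in>{U. A \<subseteq> U \<and> open U}. emeasure \<nu> U)"
    using A \<nu>(2) by (intro outer_regular) auto
  moreover have "emeasure \<kappa> A \<le> (INF U\<in>{U. A \<subseteq> U \<and> open U}. emeasure \<nu> U)"
    using \<kappa>(2) by (intro INF_greatest) (auto intro!: order_trans[OF emeasure_mono op])
  ultimately show ?thesis by simp
qed

lemma measure_eq_of_integral_eq:
  fixes \<kappa> \<nu> :: "'a::{metric_space, second_countable_topology, complete_space} measure"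
  assumes "finite_measure \<kappa>" "sets \<kappa> = sets borel" "finite_measure \<nu>" "sets \<nu> = sets borel"
    and "\<And>h :: 'a \<Rightarrow> real. continuous_on UNIV h \<Longrightarrow> (\<And>x. 0 \<le> h x) \<Longrightarrow> (\<And>x. h x \<le> 1) \<Longrightarrow>
      (\<integral>x. h x \<partial>\<kappa>) = (\<integral>x. h x \<partial>\<nu>)"
  shows "\<kappa> = \<nu>"
proof (rule measure_eqI)
  fix A assume "A \<in> sets \<kappa>"
  then show "emeasure \<kappa> A = emeasure \<nu> A"
    using assms by (intro antisym emeasure_le_of_integral_le) auto
qed (use assms in simp)

text \<open>The relation between the measures is kept additive because subtraction in
  \<open>ennreal\<close> is truncated. In this form integrals against a spliced measure are
  computed.\<close>

lemma nn_integral_add_measures: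
  fixes m1 m2 m3 m4 :: "'a measure"
  assumes s: "sets m1 = sets N" "sets m2 = sets N" "sets m3 = sets N" "sets m4 = sets N"
    and eq: "\<And>A. A \<in> sets N \<Longrightarrow> emeasure m1 A + emeasure m2 A = emeasure m3 A + emeasure m4 A"
    and f: "f \<in> borel_measurable N"
  shows "(\<integral>\<^sup>+x. f x \<partial>m1) + (\<integral>\<^sup>+x. f x \<partial>m2) = (\<integral>\<^sup>+x. f x \<partial>m3) + (\<integral>\<^sup>+x. f x \<partial>m4)"
  using f
proof (induction rule: borel_measurable_induct)
  case (cong f g)
  have sp: "space m1 = space N" "space m2 = space N" "space m3 = space N" "space m4 = space N"
    using s by (auto dest: sets_eq_imp_space_eq)
  have "(\<integral>\<^sup>+x. f x \<partial>m) = (\<integral>\<^sup>+x. g x \<partial>m)" if "space m = space N" for m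
    using cong that by (intro nn_integral_cong) auto
  then show ?case using cong sp by simp
next
  case (set A)
  then show ?case using eq s by simp
next
  case (mult u c)
  then have "u \<in> borel_measurable m" if "sets m = sets N" for m using that measurable_cong_sets by blast
  then show ?case using mult s by (simp add: nn_integral_cmult distrib_left[symmetric])
next
  case (add u v)
  then have "u \<in> borel_measurable m" "v \<in> borel_measurable m" if "sets m = sets N" for m 
    using that measurable_cong_sets by blast+
  then show ?case using add s by (simp add: nn_integral_add) (metis add.assoc add.left_commute)
next
  case (seq U)
  have U: "U i \<in> borel_measurable m" if "sets m = sets N" for m i
    using seq that measurable_cong_sets by blast
  have *: "(\<integral>\<^sup>+x. (SUP i. U i) x \<partial>m) = (SUP i. \<integral>\<^sup>+x. U i x \<partial>m)" if "sets m = sets N" for m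
    unfolding SUP_apply using seq U[OF that] by (intro nn_integral_monotone_convergence_SUP) auto
  have **: "incseq (\<lambda>i. \<integral>\<^sup>+x. U i x \<partial>m)" for m
    using \<open>incseq U\<close> by (auto simp: incseq_def le_fun_def intro!: nn_integral_mono)
  show ?case
    unfolding *[OF s(1)] *[OF s(2)] *[OF s(3)] *[OF s(4)]
    by (simp add: ennreal_SUP_add[OF ** **, symmetric] seq)
qed

lemma integral_add_measures:
  fixes f :: "'a::topological_space \<Rightarrow> real"
  assumes s: "sets m1 = sets borel" "sets m2 = sets borel" "sets m3 = sets borel" "sets m4 = sets borel"
    and fin: "finite_measure m1" "finite_measure m2" "finite_measure m3" "finite_measure m4"
    and eq: "\<And>A. A \<in> sets borel \<Longrightarrow> emeasure m1 A + emeasure m2 A = emeasure m3 A + emeasure m4 A"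
    and f: "f \<in> borel_measurable borel" "\<And>x. 0 \<le> f x" "\<And>x. f x \<le> C"
  shows "(\<integral>x. f x \<partial>m1) + (\<integral>x. f x \<partial>m2) = (\<integral>x. f x \<partial>m3) + (\<integral>x. f x \<partial>m4)"
proof -
  have "\<bar>f x\<bar> \<le> C" for x using f by (simp add: abs_le_iff order_trans[of _ 0])
  then have *: "(\<integral>\<^sup>+x. ennreal (f x) \<partial>m) = ennreal (\<integral>x. f x \<partial>m)" if "finite_measure m" "sets m = sets borel" for m
    using f that by (intro nn_integral_eq_integral finite_measure_integrable_bounded[where C=C]) auto
  have "(\<integral>\<^sup>+x. f x \<partial>m1) + (\<integral>\<^sup>+x. f x \<partial>m2) = (\<integral>\<^sup>+x. f x \<partial>m3) + (\<integral>\<^sup>+x. f x \<partial>m4)"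
    using f by (intro nn_integral_add_measures[OF s eq]) auto
  then show ?thesis
    using s fin f by (simp add: * ennreal_plus[symmetric] integral_nonneg del: ennreal_plus)
qed

text \<open>The splice \<open>m3 + (m1 - m2)\<close> serves to add one past coordinate:
  \<open>m1\<close> is the law on the shorter window, \<open>m2\<close> the part of it that is to be
  replaced, and \<open>m3\<close> the replacement on the longer window. Domination and finiteness
  make the difference a measure.\<close>

lemma measure_splice_exists:
  fixes m1 m2 m3 :: "'a measure"
  assumes s: "sets m2 = sets m1" "sets m3 = sets m1" and fin: "finite_measure m1" "finite_measure m2"
    and le: "\<And>A. A \<in> sets m1 \<Longrightarrow> emeasure m2 A \<le> emeasure m1 A"
  obtains m where "sets m = sets m1"
    "\<And>A. A \<in> sets m1 \<Longrightarrow> emeasure m A = emeasure m3 A + (emeasure m1 A - emeasure m2 A)"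
proof -
  define d where "d = diff_measure m1 m2"
  have d: "sets d = sets m1" "\<And>A. A \<in> sets m1 \<Longrightarrow> emeasure d A = emeasure m1 A - emeasure m2 A"
    using emeasure_diff_measure[OF fin s(1)[symmetric] le] by (auto simp: d_def)
  define m where "m = measure_of (space m1) (sets m1) (\<lambda>A. emeasure m3 A + emeasure d A)"
  have "emeasure m A = emeasure m3 A + emeasure d A" if "A \<in> sets m1" for A
    unfolding m_def
  proof (rule emeasure_measure_of_sigma)
    show "sigma_algebra (space m1) (sets m1)" by (rule sets.sigma_algebra_axioms)
    show "positive (sets m1) (\<lambda>A. emeasure m3 A + emeasure d A)" by (simp add: positive_def)
    show "countably_additive (sets m1) (\<lambda>A. emeasure m3 A + emeasure d A)"
      unfolding countably_additive_def
    proof (intro allI impI)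
      fix A :: "nat \<Rightarrow> 'a set"
      assume A: "range A \<subseteq> sets m1" "disjoint_family A" "\<Union> (range A) \<in> sets m1"
      have "(\<Sum>i. emeasure m3 (A i) + emeasure d (A i)) = (\<Sum>i. emeasure m3 (A i)) + (\<Sum>i. emeasure d (A i))"
        by (rule suminf_add[symmetric]) auto
      also have "\<dots> = emeasure m3 (\<Union> (range A)) + emeasure d (\<Union> (range A))"
        using A s d(1) by (simp add: suminf_emeasure)
      finally show "(\<Sum>i. emeasure m3 (A i) + emeasure d (A i)) =
          emeasure m3 (\<Union> (range A)) + emeasure d (\<Union> (range A))" .
    qed
  qed (use that in auto)
  then show thesis using d by (intro that[of m]) (auto simp: m_def sets.sigma_sets_eq)
qed

subsection \<open>Star-shaped spaces and polar laws\<close>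

text \<open>The space \<open>\<Y>\<close> is a retract of the type \<open>'z\<close> through
  \<open>e\<close> and \<open>r\<close>: test functions pull back along \<open>e\<close> in one
  direction and along \<open>r\<close> in the other, and \<open>r (e y) = y\<close> makes the two
  translations match.\<close>

lemma converges_weakly_in_transfer:
  fixes \<mu> :: "'i \<Rightarrow> 'y measure" and e :: "'y \<Rightarrow> 'z::topological_space"
  assumes e: "continuous_map \<Y> euclidean e" "e \<in> K \<rightarrow>\<^sub>M borel"
    and r: "continuous_map euclidean \<Y> r" "\<And>y. y \<in> topspace \<Y> \<Longrightarrow> r (e y) = y"
    and K: "space K = topspace \<Y>" and s: "\<And>i. sets (\<mu> i) = sets K" "sets \<nu> = sets K"
  shows "converges_weakly_in \<Y> \<mu> \<nu> F \<longleftrightarrow>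
    converges_weakly_in euclidean (\<lambda>i. distr (\<mu> i) borel e) (distr \<nu> borel e) F"
proof -
  have *: "(\<integral>z. h z \<partial>distr m borel e) = (\<integral>y. h (e y) \<partial>m)"
    if "continuous_on UNIV h" "sets m = sets K" for h :: "'z \<Rightarrow> real" and m
    using that e(2) borel_measurable_continuous_onI[OF that(1)]
    by (intro integral_distr) (auto cong: measurable_cong_sets)
  show ?thesis
  proof
    assume L: "converges_weakly_in \<Y> \<mu> \<nu> F"
    show "converges_weakly_in euclidean (\<lambda>i. distr (\<mu> i) borel e) (distr \<nu> borel e) F"
      unfolding converges_weakly_in_euclidean_iff
    proof (intro allI impI, elim conjE)
      fix h :: "'z \<Rightarrow> real" assume h: "continuous_on UNIV h" "bounded (range h)"
      have "continuous_map \<Y> euclideanreal (h \<circ> e)"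
        using e(1) h(1) by (intro continuous_map_compose[of _ euclidean]) auto
      moreover have "bounded ((h \<circ> e) ` topspace \<Y>)" using h(2) by (rule bounded_subset) auto
      ultimately show "((\<lambda>i. \<integral>z. h z \<partial>distr (\<mu> i) borel e) \<longlongrightarrow> (\<integral>z. h z \<partial>distr \<nu> borel e)) F"
        using L h s by (auto simp: * converges_weakly_in_def comp_def)
    qed
  next
    assume R: "converges_weakly_in euclidean (\<lambda>i. distr (\<mu> i) borel e) (distr \<nu> borel e) F"
    show "converges_weakly_in \<Y> \<mu> \<nu> F"
      unfolding converges_weakly_in_def
    proof (intro allI impI, elim conjE)
      fix f :: "'y \<Rightarrow> real" assume f: "continuous_map \<Y> euclideanreal f" "bounded (f ` topspace \<Y>)"
      have fr: "continuous_on UNIV (f \<circ> r)"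
        using continuous_map_compose[OF r(1) f(1)] by simp
      have "range (f \<circ> r) \<subseteq> f ` topspace \<Y>"
        using continuous_map_image_subset_topspace[OF r(1)] by auto
      then have "bounded (range (f \<circ> r))" using f(2) bounded_subset by blast
      with R fr have "((\<lambda>i. \<integral>z. (f \<circ> r) z \<partial>distr (\<mu> i) borel e) \<longlongrightarrow> (\<integral>z. (f \<circ> r) z \<partial>distr \<nu> borel e)) F"
        unfolding converges_weakly_in_euclidean_iff by blast
      moreover have "(\<integral>z. (f \<circ> r) z \<partial>distr m borel e) = (\<integral>y. f y \<partial>m)" if "sets m = sets K" for m
      proof -
        have "(\<integral>z. (f \<circ> r) z \<partial>distr m borel e) = (\<integral>y. (f \<circ> r) (e y) \<partial>m)" by (rule *[OF fr that])
        also have "\<dots> = (\<integral>y. f y \<partial>m)"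
          using sets_eq_imp_space_eq[OF that] r(2) K by (intro Bochner_Integration.integral_cong) auto
        finally show ?thesis .
      qed
      ultimately show "((\<lambda>i. \<integral>y. f y \<partial>\<mu> i) \<longlongrightarrow> (\<integral>y. f y \<partial>\<nu>)) F"
        using s by simp
    qed
  qed
qed

lemma fst_borel_measurable [measurable]: "fst \<in> borel_measurable borel"
  by (intro borel_measurable_continuous_onI continuous_on_fst continuous_on_id)

lemma snd_borel_measurable [measurable]: "snd \<in> borel \<rightarrow>\<^sub>M borel"
  by (intro borel_measurable_continuous_onI continuous_on_snd continuous_on_id)

text \<open>A continuous stand-in for an indicator: for \<open>a < b\<close> it lies between
  \<open>indicator {b<..}\<close> and \<open>indicator {a<..}\<close>.\<close>

definition ramp :: "real \<Rightarrow> real \<Rightarrow> real \<Rightarrow> real" where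
  "ramp a b y = min 1 (max 0 ((y - a) / (b - a)))"

lemma continuous_on_ramp [continuous_intros]:
  "a < b \<Longrightarrow> continuous_on S f \<Longrightarrow> continuous_on S (\<lambda>x. ramp a b (f x))"
  unfolding ramp_def by (intro continuous_intros) auto

lemma ramp_range: "0 \<le> ramp a b y" "ramp a b y \<le> 1"
  by (auto simp: ramp_def)

lemma ramp_eq_0: "a < b \<Longrightarrow> y \<le> a \<Longrightarrow> ramp a b y = 0"
  using divide_nonpos_pos[of "y - a" "b - a"] by (auto simp: ramp_def)

lemma ramp_eq_1: "a < b \<Longrightarrow> b \<le> y \<Longrightarrow> ramp a b y = 1"
  by (auto simp: ramp_def max_def min_def field_simps)

section \<open>Elementary properties of scalar multiplication and modulus\<close>

locale star_space =
  fixes orig :: "'s::polish_space" and smul :: "real \<Rightarrow> 's \<Rightarrow> 's" and \<rho> :: "'s \<Rightarrow> real"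
  assumes scalar_multiplication: "scalar_multiplication orig smul"
    and modulus: "modulus orig smul \<rho>"
begin

lemma smul_smul: "0 \<le> a \<Longrightarrow> 0 \<le> b \<Longrightarrow> smul a (smul b x) = smul (a * b) x"
  using scalar_multiplication by (simp add: scalar_multiplication_def)

lemma modulus_nonneg: "0 \<le> \<rho> x"
  using modulus by (simp add: modulus_def)

lemma modulus_smul: "0 \<le> a \<Longrightarrow> \<rho> (smul a x) = a * \<rho> x"
  using modulus by (simp add: modulus_def)

lemma continuous_on_modulus [continuous_intros]:
  "continuous_on S f \<Longrightarrow> continuous_on S (\<lambda>x. \<rho> (f x))"
  using modulus continuous_on_compose2[of UNIV \<rho> S f] by (auto simp: modulus_def)

lemma modulus_measurable [measurable]: "\<rho> \<in> borel_measurable borel"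
  by (intro borel_measurable_continuous_onI continuous_intros)

text \<open>A value strictly between 0 and the infimum is finite even when the infimum is infinite,
  which is the case if no point lies further than \<open>\<epsilon>\<close> from the origin.\<close>

lemma modulus_bounded_below:
  assumes "\<epsilon> > 0" obtains \<delta> where "\<delta> > 0" "\<And>x. \<rho> x \<le> \<delta> \<Longrightarrow> dist x orig \<le> \<epsilon>"
proof -
  have "0 < (INF x\<in>{x. dist x orig > \<epsilon>}. ereal (\<rho> x))"
    using modulus assms by (simp add: modulus_def)
  then obtain d where d: "0 < d" "d < (INF x\<in>{x. dist x orig > \<epsilon>}. ereal (\<rho> x))"
    using dense by blast
  show thesis
  proof (cases d)
    case (real \<delta>)
    have "dist x orig \<le> \<epsilon>" if "\<rho> x \<le> \<delta>" for x
    proof (rule ccontr)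
      assume "\<not> dist x orig \<le> \<epsilon>"
      then have "d < ereal (\<rho> x)"
        by (intro less_le_trans[OF d(2)] INF_lower) auto
      then show False using that real by simp
    qed
    then show thesis using that[of \<delta>] d(1) real by simp
  qed (use d in auto)
qed

lemma eq_orig_if_modulus_0: "\<rho> x = 0 \<Longrightarrow> x = orig"
  by (rule ccontr) (metis dist_pos_lt half_gt_zero modulus_bounded_below less_imp_le not_less
      order_less_le_trans field_sum_of_halves less_add_same_cancel1)

text \<open>The value at the scalar 0 follows from the modulus: homogeneity gives it modulus 0, and
  only the origin has modulus 0.\<close>

lemma smul_0: "smul 0 x = orig"
  by (rule eq_orig_if_modulus_0) (simp add: modulus_smul)

lemma modulus_orig: "\<rho> orig = 0"
  using modulus_smul[of 0 orig] by (simp add: smul_0)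

lemma modulus_eq_0_iff: "\<rho> x = 0 \<longleftrightarrow> x = orig"
  using eq_orig_if_modulus_0 modulus_orig by blast

lemma continuous_on_smul [continuous_intros]:
  assumes "continuous_on S f" "continuous_on S g" "\<And>x. x \<in> S \<Longrightarrow> 0 \<le> f x"
  shows "continuous_on S (\<lambda>x. smul (f x) (g x))"
proof -
  have "continuous_on ({0..} \<times> UNIV) (\<lambda>(a, x). smul a x)"
    using scalar_multiplication by (simp add: scalar_multiplication_def)
  from continuous_on_compose2[OF this, of S "\<lambda>x. (f x, g x)"] show ?thesis
    using assms by (auto intro: continuous_intros)
qed

lemma smul_measurable [measurable (raw)]:
  assumes [measurable]: "f \<in> borel_measurable N" "g \<in> borel_measurable N" and "\<And>x. 0 \<le> f x"
  shows "(\<lambda>x. smul (f x) (g x)) \<in> borel_measurable N"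
proof -
  \<comment> \<open>The scalar multiplication is continuous on nonnegative scalars; truncating the
    scalar at 0 gives a map that is continuous on the whole product.\<close>
  have "continuous_on UNIV (\<lambda>p::real \<times> 's. smul (max 0 (fst p)) (snd p))"
    by (intro continuous_intros) auto
  from borel_measurable_continuous_on[OF this, of "\<lambda>x. (f x, g x)" N] show ?thesis
    using assms(3) by (simp add: max_absorb2)
qed

section \<open>Paths on a subset of the index set inside the full path space\<close>

definition mask :: "int set \<Rightarrow> (int \<Rightarrow> 's) \<Rightarrow> int \<Rightarrow> 's" where
  "mask T x = (\<lambda>t. if t \<in> T then x t else orig)"

lemma mask_apply: "t \<in> T \<Longrightarrow> mask T x t = x t"
  by (simp add: mask_def)

lemma mask_mask: "mask S (mask T x) = mask (S \<inter> T) x"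
  by (auto simp: mask_def)

lemma mask_UNIV: "mask UNIV = (\<lambda>x. x)"
  by (auto simp: mask_def)

lemma continuous_on_coordinate: "continuous_on S (\<lambda>x::int \<Rightarrow> 's. x t)"
  using continuous_on_product_then_coordinatewise[OF continuous_on_id, of S t] by simp

lemma coordinate_measurable [measurable]: "(\<lambda>x::int \<Rightarrow> 's. x t) \<in> borel_measurable borel"
  by (intro borel_measurable_continuous_onI continuous_on_coordinate)

lemma continuous_on_mask: "continuous_on S (mask T)"
  unfolding mask_def
proof (rule continuous_on_coordinatewise_then_product)
  fix i show "continuous_on S (\<lambda>x. if i \<in> T then x i else orig)"
    by (cases "i \<in> T") (auto intro: continuous_on_coordinate)
qed

lemma mask_measurable [measurable]: "mask T \<in> borel_measurable borel"
  by (intro borel_measurable_continuous_onI continuous_on_mask)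

lemma mask_measurable_PiM: "mask T \<in> PiM T (\<lambda>_. borel) \<rightarrow>\<^sub>M borel"
  unfolding mask_def
proof (rule measurable_coordinatewise_then_product)
  fix i show "(\<lambda>x. if i \<in> T then x i else orig) \<in> borel_measurable (PiM T (\<lambda>_. borel))"
    by (cases "i \<in> T") auto
qed

lemma continuous_map_mask: "continuous_map (product_topology (\<lambda>_. euclidean) T) euclidean (mask T)"
  unfolding euclidean_product_topology[symmetric] mask_def continuous_map_componentwise_UNIV
  by (auto intro: continuous_map_product_projection)

lemma continuous_map_restrict:
  "continuous_map euclidean (product_topology (\<lambda>_. euclidean) T) (\<lambda>x::int \<Rightarrow> 's. restrict x T)"
  by (auto simp: continuous_map_componentwise continuous_on_coordinate)

lemma restrict_mask: "restrict (mask T x) T = restrict x T"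
  by (auto simp: mask_def restrict_def)

lemma mask_restrict: "mask T (restrict x T) = mask T x"
  by (auto simp: mask_def restrict_def)

end

section \<open>Laws of a stationary series given an exceedance\<close>

locale stationary_series = star_space orig smul \<rho> + prob_space M
  for orig :: "'s::polish_space" and smul \<rho> and M :: "'w measure" +
  fixes X :: "int \<Rightarrow> 'w \<Rightarrow> 's" and \<alpha> :: real
  assumes X_measurable [measurable]: "\<And>t. X t \<in> borel_measurable M"
    and stationary: "strictly_stationary M X"
    and index_pos: "\<alpha> > 0"
begin

definition exceedance :: "real \<Rightarrow> 'w set" where
  "exceedance u = {\<omega> \<in> space M. \<rho> (X 0 \<omega>) > u}"

definition tail :: "real \<Rightarrow> real" where
  "tail u = measure M (exceedance u)"

definition angular :: "'w \<Rightarrow> int \<Rightarrow> 's" where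
  "angular \<omega> = (\<lambda>t. smul (1 / \<rho> (X 0 \<omega>)) (X t \<omega>))"

text \<open>One law over all of the integers serves every index set: the conditional law needed for
  \<open>T\<close> is its image under \<open>mask T\<close>. For a null exceedance it is the null
  measure, so in general its mass is only known to be at most 1.\<close>

definition polar_law :: "real \<Rightarrow> (real \<times> (int \<Rightarrow> 's)) measure" where
  "polar_law u = cond_law M (exceedance u) borel (\<lambda>\<omega>. (\<rho> (X 0 \<omega>) / u, angular \<omega>))"

lemma exceedance_sets [measurable]: "exceedance u \<in> sets M"
  unfolding exceedance_def by measurable

lemma angular_measurable [measurable]: "angular \<in> borel_measurable M"
  unfolding angular_def
  by (intro measurable_coordinatewise_then_product smul_measurable) (auto simp: modulus_nonneg)

lemma series_measurable [measurable]: "(\<lambda>\<omega> t. X (t + h) \<omega>) \<in> borel_measurable M"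
  by (intro measurable_coordinatewise_then_product) auto

text \<open>Finite-dimensional distributions determine the law on the path space, because cylinder
  sets generate its Borel sets and are stable under intersection.\<close>

lemma stationary_law:
  "distr M borel (\<lambda>\<omega> t. X (t + h) \<omega>) = distr M borel (\<lambda>\<omega> t. X t \<omega>)"
proof (rule measure_eqI_PiM_infinite[where I = UNIV and M = "\<lambda>_. borel"])
  show "finite_measure (distr M borel (\<lambda>\<omega> t. X (t + h) \<omega>))"
    by (intro prob_space.finite_measure prob_space_distr) measurable
  fix A :: "int \<Rightarrow> 's set" and J :: "int set" assume J: "finite J" and A: "\<And>i. i \<in> J \<Longrightarrow> A i \<in> sets borel"
  have P: "Pi\<^sub>E J A \<in> sets (PiM J (\<lambda>_. borel))" using J A by auto
  have E: "prod_emb UNIV (\<lambda>_. borel) J (Pi\<^sub>E J A) = (\<lambda>x. restrict x J) -` (Pi\<^sub>E J A)"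
    by (auto simp: prod_emb_def)
  have S: "(\<lambda>x. restrict x J) -` (Pi\<^sub>E J A) \<in> sets borel"
    using sets_PiM_I[of J UNIV A "\<lambda>_. borel"] J A unfolding E sets_PiM_equal_borel by auto
  \<comment> \<open>This is used for \<open>k = h\<close> and for \<open>k = 0\<close>, the two
    marginals that stationarity identifies.\<close>
  have "emeasure (distr M borel (\<lambda>\<omega> t. X (t + k) \<omega>)) (prod_emb UNIV (\<lambda>_. borel) J (Pi\<^sub>E J A)) =
      emeasure (distr M (PiM J (\<lambda>_. borel)) (\<lambda>\<omega>. \<lambda>t\<in>J. X (t + k) \<omega>)) (Pi\<^sub>E J A)" for k
    using P S unfolding E
    by (subst (1 2) emeasure_distr) (auto intro!: arg_cong2[where f=emeasure] simp: vimage_def)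
  from this[of h] this[of 0] show "emeasure (distr M borel (\<lambda>\<omega> t. X (t + h) \<omega>)) (prod_emb UNIV (\<lambda>_. borel) J (Pi\<^sub>E J A)) =
      emeasure (distr M borel (\<lambda>\<omega> t. X t \<omega>)) (prod_emb UNIV (\<lambda>_. borel) J (Pi\<^sub>E J A))"
    using stationary J unfolding strictly_stationary_def by simp
qed (simp_all add: sets_PiM_equal_borel)

text \<open>The total mass is a quotient \<open>x / x\<close> in \<open>ennreal\<close> with finite
  \<open>x\<close>; for a null exceedance it is \<open>0 / 0 = 0\<close>.\<close>

lemma finite_measure_uniform: "finite_measure (uniform_measure M (exceedance u))"
proof
  have "emeasure (uniform_measure M (exceedance u)) (space M) = emeasure M (exceedance u) / emeasure M (exceedance u)"
    by (simp add: sets.Int_space_eq2)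
  also have "\<dots> \<noteq> \<infinity>"
    using ennreal_divide_self[of "emeasure M (exceedance u)"] emeasure_finite[of "exceedance u"]
    by (cases "emeasure M (exceedance u) = 0") (auto simp: zero_less_iff_neq_zero less_top[symmetric])
  finally show "emeasure (uniform_measure M (exceedance u)) (space (uniform_measure M (exceedance u))) \<noteq> \<infinity>"
    by simp
qed

lemma polar_map_measurable [measurable]: "(\<lambda>\<omega>. (\<rho> (X 0 \<omega>) / u, angular \<omega>)) \<in> borel_measurable M"
  by measurable

lemma sets_polar_law [simp, measurable_cong]: "sets (polar_law u) = sets borel"
  by (simp add: polar_law_def cond_law_def)

lemma finite_measure_polar_law: "finite_measure (polar_law u)"
  unfolding polar_law_def cond_law_def
  by (rule finite_measure.finite_measure_distr[OF finite_measure_uniform]) simp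

text \<open>Conditional integrals at different levels, or of shifted series, are compared through
  these unconditional numerators. For \<open>tail u = 0\<close> the formula persists, since division
  by 0 yields 0 on the right and the conditional law is null on the left.\<close>

lemma integral_polar_law:
  assumes [measurable]: "F \<in> borel_measurable borel"
  shows "(\<integral>z. F z \<partial>polar_law u) =
    (\<integral>\<omega>. indicator (exceedance u) \<omega> * F (\<rho> (X 0 \<omega>) / u, angular \<omega>) \<partial>M) / tail u"
proof -
  have "(\<integral>z. F z \<partial>polar_law u) = (\<integral>\<omega>. F (\<rho> (X 0 \<omega>) / u, angular \<omega>) \<partial>uniform_measure M (exceedance u))"
    unfolding polar_law_def cond_law_def by (intro integral_distr) auto
  also have "\<dots> = (\<integral>\<omega>. indicator (exceedance u) \<omega> * F (\<rho> (X 0 \<omega>) / u, angular \<omega>) \<partial>M) / tail u"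
  proof (cases "tail u = 0")
    case True
    then have "emeasure M (exceedance u) = 0" by (simp add: tail_def emeasure_eq_measure)
    then have "AE \<omega> in uniform_measure M (exceedance u). False"
      by (intro AE_uniform_measureI) (auto intro!: AE_not_in null_setsI)
    then have "(\<integral>\<omega>. F (\<rho> (X 0 \<omega>) / u, angular \<omega>) \<partial>uniform_measure M (exceedance u)) = 0"
      by (intro integral_eq_zero_AE) auto
    then show ?thesis using True by simp
  next
    case False
    then have pos: "tail u > 0" using measure_nonneg[of M "exceedance u"] unfolding tail_def by linarith
    have "uniform_measure M (exceedance u) = density M (\<lambda>\<omega>. ennreal (indicator (exceedance u) \<omega> / tail u))"
      unfolding uniform_measure_def using pos
      by (intro arg_cong2[where f=density] ext)
        (auto simp: emeasure_eq_measure tail_def[symmetric] divide_ennreal[symmetric] ennreal_indicator split: split_indicator)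
    then show ?thesis using pos
      by (subst integral_density[of _ M "\<lambda>\<omega>. indicator (exceedance u) \<omega> / tail u", symmetric] | simp add: integral_density)+
  qed
  finally show ?thesis .
qed

text \<open>The maps \<open>mask T\<close> and \<open>restrict\<close> form the retraction pair
  between the paths on \<open>T\<close> and the full path space, so that weak convergence is tested
  on one fixed Polish space for all \<open>T\<close>.\<close>

lemma spectral_limit_iff:
  "spectral_limit M X smul \<rho> T N \<Theta> \<longleftrightarrow> prob_space N \<and> (\<forall>t\<in>T. \<Theta> t \<in> borel_measurable N) \<and>
     converges_weakly_in euclidean (\<lambda>u. distr (polar_law u) borel (\<lambda>z. mask T (snd z)))
       (distr N borel (\<lambda>\<omega>. mask T (\<lambda>t. \<Theta> t \<omega>))) at_top"
proof -
  let ?K = "PiM T (\<lambda>_. borel :: 's measure)"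
  have 1: "converges_weakly_in (product_topology (\<lambda>_. euclidean) T)
       (\<lambda>u. cond_law M (exceedance u) ?K (\<lambda>\<omega>. \<lambda>t\<in>T. angular \<omega> t))
       (distr N ?K (\<lambda>\<omega>. \<lambda>t\<in>T. \<Theta> t \<omega>)) at_top \<longleftrightarrow>
    converges_weakly_in euclidean (\<lambda>u. distr (polar_law u) borel (\<lambda>z. mask T (snd z)))
       (distr N borel (\<lambda>\<omega>. mask T (\<lambda>t. \<Theta> t \<omega>))) at_top"
    if \<Theta>: "\<forall>t\<in>T. \<Theta> t \<in> borel_measurable N"
  proof -
    have M1: "(\<lambda>\<omega>. \<lambda>t\<in>T. \<Theta> t \<omega>) \<in> N \<rightarrow>\<^sub>M ?K" using \<Theta> by (intro measurable_restrict) auto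
    have M2: "(\<lambda>\<omega>. \<lambda>t\<in>T. angular \<omega> t) \<in> uniform_measure M (exceedance u) \<rightarrow>\<^sub>M ?K" for u
    proof (intro measurable_restrict)
      fix t show "(\<lambda>\<omega>. angular \<omega> t) \<in> borel_measurable (uniform_measure M (exceedance u))"
        using measurable_compose[OF angular_measurable coordinate_measurable] by simp
    qed
    have "distr (distr N ?K (\<lambda>\<omega>. \<lambda>t\<in>T. \<Theta> t \<omega>)) borel (mask T) = distr N borel (\<lambda>\<omega>. mask T (\<lambda>t. \<Theta> t \<omega>))"
      by (subst distr_distr[OF mask_measurable_PiM M1]) (simp add: comp_def mask_restrict)
    moreover have "distr (cond_law M (exceedance u) ?K (\<lambda>\<omega>. \<lambda>t\<in>T. angular \<omega> t)) borel (mask T) =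
        distr (polar_law u) borel (\<lambda>z. mask T (snd z))" for u
    proof -
      have "(\<lambda>z::real \<times> (int \<Rightarrow> 's). mask T (snd z)) \<in> borel \<rightarrow>\<^sub>M borel" by measurable
      then show ?thesis unfolding cond_law_def polar_law_def
        by (subst distr_distr[OF mask_measurable_PiM M2], subst distr_distr) (auto simp: comp_def mask_restrict)
    qed
    ultimately show ?thesis
      by (subst converges_weakly_in_transfer[OF continuous_map_mask mask_measurable_PiM continuous_map_restrict])
        (auto simp: restrict_mask space_PiM PiE_def extensional_restrict cond_law_def)
  qed
  then show ?thesis unfolding spectral_limit_def exceedance_def angular_def by blast
qed

text \<open>The same transfer for pairs, with the radial coordinate left alone.\<close>

lemma polar_limit_iff:
  "polar_limit M X smul \<rho> T N Y \<Theta> \<longleftrightarrow> prob_space N \<and> Y \<in> borel_measurable N \<and> (\<forall>t\<in>T. \<Theta> t \<in> borel_measurable N) \<and>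
     converges_weakly_in euclidean (\<lambda>u. distr (polar_law u) borel (\<lambda>z. (fst z, mask T (snd z))))
       (distr N borel (\<lambda>\<omega>. (Y \<omega>, mask T (\<lambda>t. \<Theta> t \<omega>)))) at_top"
proof -
  let ?K = "PiM T (\<lambda>_. borel :: 's measure)"
  let ?B = "borel \<Otimes>\<^sub>M ?K :: (real \<times> (int \<Rightarrow> 's)) measure"
  let ?e = "\<lambda>z::real \<times> (int \<Rightarrow> 's). (fst z, mask T (snd z))"
  have 1: "converges_weakly_in (prod_topology euclideanreal (product_topology (\<lambda>_. euclidean) T))
       (\<lambda>u. cond_law M (exceedance u) ?B (\<lambda>\<omega>. (\<rho> (X 0 \<omega>) / u, \<lambda>t\<in>T. angular \<omega> t)))
       (distr N ?B (\<lambda>\<omega>. (Y \<omega>, \<lambda>t\<in>T. \<Theta> t \<omega>))) at_top \<longleftrightarrow>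
    converges_weakly_in euclidean (\<lambda>u. distr (polar_law u) borel ?e)
       (distr N borel (\<lambda>\<omega>. (Y \<omega>, mask T (\<lambda>t. \<Theta> t \<omega>)))) at_top"
    if Y[measurable]: "Y \<in> borel_measurable N" and \<Theta>: "\<forall>t\<in>T. \<Theta> t \<in> borel_measurable N"
  proof -
    have [measurable]: "(\<lambda>\<omega>. \<lambda>t\<in>T. \<Theta> t \<omega>) \<in> N \<rightarrow>\<^sub>M ?K" using \<Theta> by (intro measurable_restrict) auto
    have M1: "(\<lambda>\<omega>. (Y \<omega>, \<lambda>t\<in>T. \<Theta> t \<omega>)) \<in> N \<rightarrow>\<^sub>M ?B" by measurable
    have [measurable]: "(\<lambda>\<omega>. \<lambda>t\<in>T. angular \<omega> t) \<in> M \<rightarrow>\<^sub>M ?K"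
      by (intro measurable_restrict measurable_compose[OF angular_measurable coordinate_measurable])
    have M2: "(\<lambda>\<omega>. (\<rho> (X 0 \<omega>) / u, \<lambda>t\<in>T. angular \<omega> t)) \<in> uniform_measure M (exceedance u) \<rightarrow>\<^sub>M ?B" for u
      by (simp, measurable)
    have e: "?e \<in> ?B \<rightarrow>\<^sub>M borel"
      using mask_measurable_PiM[of T] by (intro borel_measurable_Pair) auto
    have ec: "continuous_map (prod_topology euclideanreal (product_topology (\<lambda>_. euclidean) T)) euclidean ?e"
      unfolding prod_topology_euclidean[symmetric] continuous_map_pairwise comp_def
      by (auto intro!: continuous_map_fst continuous_map_compose[OF continuous_map_snd continuous_map_mask, unfolded comp_def])
    have rc: "continuous_map euclidean (prod_topology euclideanreal (product_topology (\<lambda>_. euclidean) T))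
        (\<lambda>z::real \<times> (int \<Rightarrow> 's). (fst z, restrict (snd z) T))"
      unfolding continuous_map_pairwise comp_def
      by (auto simp: continuous_map_componentwise intro!: continuous_on_fst continuous_on_id
          continuous_on_product_then_coordinatewise[OF continuous_on_snd])
    have "distr (distr N ?B (\<lambda>\<omega>. (Y \<omega>, \<lambda>t\<in>T. \<Theta> t \<omega>))) borel ?e = distr N borel (\<lambda>\<omega>. (Y \<omega>, mask T (\<lambda>t. \<Theta> t \<omega>)))"
      by (subst distr_distr[OF e M1]) (simp add: comp_def mask_restrict)
    moreover have "distr (cond_law M (exceedance u) ?B (\<lambda>\<omega>. (\<rho> (X 0 \<omega>) / u, \<lambda>t\<in>T. angular \<omega> t))) borel ?e =
        distr (polar_law u) borel ?e" for u
    proof -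
      have "?e \<in> borel \<rightarrow>\<^sub>M borel" by (intro borel_measurable_Pair) measurable
      then show ?thesis unfolding cond_law_def polar_law_def
        by (subst distr_distr[OF e M2], subst distr_distr) (auto simp: comp_def mask_restrict)
    qed
    ultimately show ?thesis
      by (subst converges_weakly_in_transfer[OF ec e rc])
        (auto simp: restrict_mask space_PiM space_pair_measure PiE_def extensional_restrict cond_law_def)
  qed
  then show ?thesis unfolding polar_limit_def exceedance_def angular_def by blast
qed

end

subsection \<open>Regular variation and the radial part\<close>

text \<open>The exponential of an exponential variable with rate \<alpha> is Pareto distributed with
  index \<alpha>; its tail is thereby inherited from the exponential distribution.\<close>

definition pareto :: "real \<Rightarrow> real measure" where
  "pareto \<alpha> = distr (density lborel (exponential_density \<alpha>)) borel exp"

lemma sets_pareto [simp, measurable_cong]: "sets (pareto \<alpha>) = sets borel"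
  by (simp add: pareto_def)

lemma space_pareto [simp]: "space (pareto \<alpha>) = UNIV"
  by (simp add: pareto_def)

lemma prob_space_pareto: "\<alpha> > 0 \<Longrightarrow> prob_space (pareto \<alpha>)"
  unfolding pareto_def
  by (intro prob_space.prob_space_distr prob_space_exponential_density) simp_all

lemma measure_pareto_greaterThan:
  assumes "\<alpha> > 0" "y \<ge> 1"
  shows "measure (pareto \<alpha>) {y<..} = y powr (- \<alpha>)"
proof -
  let ?E = "density lborel (exponential_density \<alpha>)"
  interpret prob_space ?E by (rule prob_space_exponential_density) fact
  have "distributed ?E lborel (\<lambda>x. x) (exponential_density \<alpha>)"
    using assms by (auto simp: distributed_def distr_id2 exponential_density_nonneg)
  then have "measure ?E {x \<in> space ?E. ln y < x} = exp (- ln y * \<alpha>)"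
    using assms by (intro exponential_distributedD_gt) auto
  moreover have "ln y < x \<longleftrightarrow> y < exp x" for x
    using assms ln_less_cancel_iff[of y "exp x"] by simp
  then have "measure (pareto \<alpha>) {y<..} = measure ?E {x \<in> space ?E. ln y < x}"
    unfolding pareto_def using assms
    by (subst measure_distr) (auto intro!: arg_cong2[where f=measure] )
  ultimately show ?thesis using assms by (simp add: powr_def mult.commute)
qed

lemma AE_pareto: "\<alpha> > 0 \<Longrightarrow> AE y in pareto \<alpha>. 1 < y"
proof -
  assume "\<alpha> > 0"
  interpret prob_space "pareto \<alpha>" by (rule prob_space_pareto) fact
  have "prob {1<..} = 1" using measure_pareto_greaterThan[of \<alpha> 1] \<open>\<alpha> > 0\<close> by simp
  from AE_prob_1[OF this] show ?thesis by auto
qed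

text \<open>For \<open>y < 1\<close> the tail is at most 1 while the power is at least 1. Such
  thresholds occur when the radial variable is rescaled by an angular coordinate.\<close>

lemma measure_pareto_greaterThan_le:
  assumes "\<alpha> > 0" "y > 0"
  shows "measure (pareto \<alpha>) {y<..} \<le> y powr (- \<alpha>)"
proof (cases "y \<ge> 1")
  case False
  interpret prob_space "pareto \<alpha>" by (rule prob_space_pareto) fact
  have "1 \<le> y powr (- \<alpha>)" using powr_mono2'[of "- \<alpha>" y 1] assms False by simp
  then show ?thesis using prob_le_1 order_trans by blast
qed (use measure_pareto_greaterThan[OF assms(1)] in simp)

text \<open>For \<open>\<eta> > 0\<close> the radial coordinate is rounded down to the grid
  \<open>1 + k * \<eta>\<close>, and everything beyond the last cell is set to 0. The cells are
  written as differences of exceedance indicators because exceedances are the radial events on which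
  the polar laws factorise.\<close>

definition step_approx :: "real \<Rightarrow> nat \<Rightarrow> (real \<times> 'z \<Rightarrow> real) \<Rightarrow> real \<times> 'z \<Rightarrow> real" where
  "step_approx \<eta> n h z = (\<Sum>k<n. (indicator {1 + real k * \<eta><..} (fst z) -
      indicator {1 + real (Suc k) * \<eta><..} (fst z)) * h (1 + real k * \<eta>, snd z))"

lemma step_approx_bound:
  fixes h :: "real \<times> 'z::metric_space \<Rightarrow> real"
  assumes "L-lipschitz_on UNIV h" "\<And>z. \<bar>h z\<bar> \<le> C" "\<eta> > 0" "1 < fst z"
  shows "\<bar>h z - step_approx \<eta> n h z\<bar> \<le> L * \<eta> + C * indicator {1 + real n * \<eta><..} (fst z)"
proof -
  have L: "0 \<le> L" using assms(1) by (rule lipschitz_on_nonneg)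
  \<comment> \<open>Beyond the grid the approximation is exactly 0, so each induction step alters
    the value only on the newly added cell.\<close>
  have "(1 + real n * \<eta> < fst z \<longrightarrow> step_approx \<eta> n h z = 0) \<and>
        (fst z \<le> 1 + real n * \<eta> \<longrightarrow> \<bar>h z - step_approx \<eta> n h z\<bar> \<le> L * \<eta>)"
  proof (induction n)
    case 0
    then show ?case using assms(4) by (simp add: step_approx_def)
  next
    case (Suc n)
    have S: "step_approx \<eta> (Suc n) h z = step_approx \<eta> n h z +
        (indicator {1 + real n * \<eta><..} (fst z) - indicator {1 + real (Suc n) * \<eta><..} (fst z)) *
        h (1 + real n * \<eta>, snd z)"
      by (simp add: step_approx_def)
    have lt: "1 + real n * \<eta> < 1 + real (Suc n) * \<eta>" using assms(3) by simp
    consider "fst z \<le> 1 + real n * \<eta>" | "1 + real n * \<eta> < fst z" "fst z \<le> 1 + real (Suc n) * \<eta>"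
      | "1 + real (Suc n) * \<eta> < fst z" by linarith
    then show ?case
    proof cases
      case 1
      then show ?thesis using Suc lt unfolding S by (auto simp: indicator_def)
    next
      case 2
      have "step_approx \<eta> (Suc n) h z = h (1 + real n * \<eta>, snd z)"
        using 2 Suc unfolding S by (auto simp: indicator_def)
      moreover have "\<bar>h z - h (1 + real n * \<eta>, snd z)\<bar> \<le> L * dist z (1 + real n * \<eta>, snd z)"
        using lipschitz_onD[OF assms(1), of z "(1 + real n * \<eta>, snd z)"] by (simp add: dist_real_def)
      moreover have "dist z (1 + real n * \<eta>, snd z) \<le> \<eta>"
        using 2 by (simp add: dist_prod_def dist_real_def algebra_simps)
      ultimately show ?thesis using 2 L by (auto intro: order_trans mult_left_mono)
    next
      case 3
      then show ?thesis using Suc lt unfolding S by (auto simp: indicator_def)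
    qed
  qed
  then show ?thesis using assms(2)[of z] L \<open>\<eta> > 0\<close>
    by (cases "fst z \<le> 1 + real n * \<eta>") (auto simp: indicator_def intro: order_trans)
qed

lemma step_approx_measurable [measurable]:
  fixes h :: "real \<times> 'z::second_countable_topology \<Rightarrow> real"
  assumes [measurable]: "h \<in> borel_measurable borel"
  shows "step_approx \<eta> n h \<in> borel_measurable borel"
proof -
  have [measurable]: "(\<lambda>z::real \<times> 'z. h (c, snd z)) \<in> borel_measurable borel" for c
    by measurable
  show ?thesis unfolding step_approx_def by measurable
qed

text \<open>A mass of at most 1 is the form of the hypothesis that fits both the limit law and the
  prelimit, whose mass may be 0.\<close>

lemma integral_step_approx_bound:
  fixes h :: "real \<times> 'z::{metric_space, second_countable_topology} \<Rightarrow> real"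
  assumes m: "finite_measure m" "sets m = sets borel" "measure m UNIV \<le> 1" "AE z in m. 1 < fst z"
    and h: "L-lipschitz_on UNIV h" "\<And>z. \<bar>h z\<bar> \<le> C" and "\<eta> > 0"
  shows "\<bar>(\<integral>z. h z \<partial>m) - (\<integral>z. step_approx \<eta> n h z \<partial>m)\<bar> \<le>
      L * \<eta> + C * (\<integral>z. indicator {1 + real n * \<eta><..} (fst z) \<partial>m)"
proof -
  interpret finite_measure m by fact
  have L: "0 \<le> L" using h(1) by (rule lipschitz_on_nonneg)
  have hm[measurable]: "h \<in> borel_measurable borel"
    using h(1) by (intro borel_measurable_continuous_onI) (rule lipschitz_on_continuous_on)
  note [measurable_cong] = m(2)
  have C: "0 \<le> C" using h(2)[of undefined] by linarith
  have b: "\<bar>step_approx \<eta> n h z\<bar> \<le> real n * C" for z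
  proof -
    have "\<bar>step_approx \<eta> n h z\<bar> \<le> (\<Sum>k<n. C)"
      unfolding step_approx_def
    proof (rule order_trans[OF sum_abs sum_mono])
      fix k
      have "\<bar>indicat_real {1 + real k * \<eta><..} (fst z) - indicator {1 + real (Suc k) * \<eta><..} (fst z)\<bar> \<le> 1"
        by (auto simp: indicator_def)
      then show "\<bar>(indicat_real {1 + real k * \<eta><..} (fst z) - indicator {1 + real (Suc k) * \<eta><..} (fst z)) *
          h (1 + real k * \<eta>, snd z)\<bar> \<le> C"
        using mult_mono[OF _ h(2), of _ 1] by (simp add: abs_mult)
    qed
    then show ?thesis by simp
  qed
  have i: "integrable m h" "integrable m (step_approx \<eta> n h)"
    using h(2) b by (auto intro!: finite_measure_integrable_bounded[OF m(1,2)])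
  have j: "integrable m (\<lambda>z. indicat_real {1 + real n * \<eta><..} (fst z))"
    by (intro integrable_const_bound[of _ 1]) auto
  have "\<bar>(\<integral>z. h z \<partial>m) - (\<integral>z. step_approx \<eta> n h z \<partial>m)\<bar> = \<bar>\<integral>z. h z - step_approx \<eta> n h z \<partial>m\<bar>"
    using i by simp
  also have "\<dots> \<le> (\<integral>z. \<bar>h z - step_approx \<eta> n h z\<bar> \<partial>m)"
    by (rule integral_abs_bound)
  also have "\<dots> \<le> (\<integral>z. L * \<eta> + C * indicator {1 + real n * \<eta><..} (fst z) \<partial>m)"
    using m(4) i j step_approx_bound[OF h \<open>\<eta> > 0\<close>]
    by (intro integral_mono_AE) auto
  also have "\<dots> = L * \<eta> * measure m UNIV + C * (\<integral>z. indicator {1 + real n * \<eta><..} (fst z) \<partial>m)"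
    using j sets_eq_imp_space_eq[OF m(2)] by simp
  also have "\<dots> \<le> L * \<eta> + C * (\<integral>z. indicator {1 + real n * \<eta><..} (fst z) \<partial>m)"
    using L \<open>\<eta> > 0\<close> m(3) by (simp add: mult_left_le)
  finally show ?thesis .
qed

lemma integral_pareto_pair:
  fixes g :: "'z::second_countable_topology \<Rightarrow> real" and Q :: "'z measure"
  assumes Q: "prob_space Q" "sets Q = sets borel" and "\<alpha> > 0" "c \<ge> 1"
    and g: "g \<in> borel_measurable borel" "\<And>x. \<bar>g x\<bar> \<le> C"
  shows "(\<integral>z. indicator {c<..} (fst z) * g (snd z) \<partial>(pareto \<alpha> \<Otimes>\<^sub>M Q)) = c powr (- \<alpha>) * (\<integral>x. g x \<partial>Q)"
proof -
  interpret R: prob_space "pareto \<alpha>" by (rule prob_space_pareto) fact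
  interpret Q: prob_space Q by fact
  interpret pair_prob_space "pareto \<alpha>" Q ..
  note [measurable_cong] = Q(2)
  note [measurable] = g(1)
  have "integrable (pareto \<alpha> \<Otimes>\<^sub>M Q) (\<lambda>z. indicator {c<..} (fst z) * g (snd z))"
    using g(2) by (intro integrable_const_bound[of _ C]) (auto simp: indicator_def intro: order_trans[OF abs_ge_zero])
  from integral_fst'[OF this] show ?thesis
    using measure_pareto_greaterThan[OF assms(3,4)] by simp
qed

lemma sets_pareto_pair:
  fixes Q :: "'z::second_countable_topology measure"
  assumes "sets Q = sets borel"
  shows "sets (pareto \<alpha> \<Otimes>\<^sub>M Q) = sets borel"
  by (metis assms borel_prod sets_pair_measure_cong sets_pareto)

section \<open>Decoupling of the radial and the angular part\<close>

context stationary_series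
begin

lemma tail_nonneg: "0 \<le> tail u"
  by (simp add: tail_def)

lemma tail_antimono: "u \<le> v \<Longrightarrow> tail v \<le> tail u"
  unfolding tail_def by (rule finite_measure_mono) (auto simp: exceedance_def)

lemma measure_polar_law_le_1: "measure (polar_law u) UNIV \<le> 1"
proof -
  have "(\<integral>z. 1 \<partial>polar_law u) = tail u / tail u"
    by (subst integral_polar_law) (auto simp: tail_def sets.Int_space_eq1)
  then show ?thesis using sets_eq_imp_space_eq[OF sets_polar_law[of u]] by simp
qed

lemma AE_polar_law:
  assumes "u > 0"
  shows "AE z in polar_law u. 1 < fst z \<and> \<rho> (snd z 0) = 1"
proof -
  have [measurable]: "(\<lambda>z::real \<times> (int \<Rightarrow> 's). \<rho> (snd z 0)) \<in> borel_measurable borel"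
    by (rule measurable_compose[OF snd_borel_measurable]) measurable
  have *: "1 < \<rho> (X 0 \<omega>) / u \<and> \<rho> (angular \<omega> 0) = 1" if "\<omega> \<in> exceedance u" for \<omega>
    using that assms modulus_smul[of "1 / \<rho> (X 0 \<omega>)" "X 0 \<omega>"] modulus_nonneg
    by (auto simp: exceedance_def angular_def)
  have "AE \<omega> in uniform_measure M (exceedance u). 1 < \<rho> (X 0 \<omega>) / u \<and> \<rho> (angular \<omega> 0) = 1"
    using * by (intro AE_uniform_measureI) auto
  then show ?thesis
    unfolding polar_law_def cond_law_def by (subst AE_distr_iff) auto
qed

text \<open>For \<open>c \<ge> 1\<close>, exceeding \<open>c * u\<close> is a subevent of exceeding
  \<open>u\<close>, and the angular process does not depend on the level. Restricting to a radial
  part above \<open>c\<close> therefore only raises the level, at the price of a ratio of tails;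
  this is the source of independence in the limit.\<close>

lemma integral_polar_law_exceed:
  assumes "u > 0" "c \<ge> 1" and [measurable]: "g \<in> borel_measurable borel"
  shows "(\<integral>z. indicator {c<..} (fst z) * g (snd z) \<partial>polar_law u) =
    tail (c * u) / tail u * (\<integral>z. g (snd z) \<partial>polar_law (c * u))"
proof -
  let ?I = "\<integral>\<omega>. indicator (exceedance (c * u)) \<omega> * g (angular \<omega>) \<partial>M"
  have 1: "(\<integral>z. indicator {c<..} (fst z) * g (snd z) \<partial>polar_law u) = ?I / tail u"
  proof (subst integral_polar_law)
    have "indicator (exceedance u) \<omega> * (indicator {c<..} (\<rho> (X 0 \<omega>) / u) * g (angular \<omega>)) =
        indicator (exceedance (c * u)) \<omega> * g (angular \<omega>)" if "\<omega> \<in> space M" for \<omega>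
    proof -
      have "u \<le> c * u" using assms by simp
      then have "u < \<rho> (X 0 \<omega>)" if "c * u < \<rho> (X 0 \<omega>)" using that by linarith
      then show ?thesis using assms that by (auto simp: indicator_def exceedance_def pos_less_divide_eq)
    qed
    then show "(\<integral>\<omega>. indicator (exceedance u) \<omega> * (indicator {c<..} (fst (\<rho> (X 0 \<omega>) / u, angular \<omega>)) *
        g (snd (\<rho> (X 0 \<omega>) / u, angular \<omega>))) \<partial>M) / tail u = ?I / tail u"
      by (auto intro!: arg_cong2[where f="(/)"] Bochner_Integration.integral_cong)
  qed measurable
  have 2: "(\<integral>z. g (snd z) \<partial>polar_law (c * u)) = ?I / tail (c * u)"
    by (subst integral_polar_law) auto
  show ?thesis
  proof (cases "tail (c * u) = 0")
    case True
    then have "exceedance (c * u) \<in> null_sets M"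
      by (auto simp: tail_def emeasure_eq_measure)
    then have "?I = 0" by (intro integral_eq_zero_AE) (auto dest!: AE_not_in)
    then show ?thesis using 1 True by simp
  qed (use 1 2 in simp)
qed

text \<open>The tail ratio and the angular integral at level \<open>c * u\<close> converge
  separately, which gives the product limit for radial exceedance indicators times continuous
  angular functions. A Lipschitz function of both variables is approximated by
  \<open>step_approx\<close> up to \<open>L * \<eta>\<close> and a radial tail.\<close>

lemma polar_conv_of_spectral_conv:
  assumes rv: "regularly_varying (- \<alpha>) tail" and Q: "prob_space Q" "sets Q = sets borel"
    and conv: "converges_weakly_in euclidean (\<lambda>u. distr (polar_law u) borel (\<lambda>z. mask T (snd z))) Q at_top"
  shows "converges_weakly_in euclidean (\<lambda>u. distr (polar_law u) borel (\<lambda>z. (fst z, mask T (snd z))))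
    (pareto \<alpha> \<Otimes>\<^sub>M Q) at_top"
proof (rule converges_weakly_lipschitzI)
  interpret R: prob_space "pareto \<alpha>" by (rule prob_space_pareto) (rule index_pos)
  interpret Q: prob_space Q by fact
  interpret PQ: pair_prob_space "pareto \<alpha>" Q ..
  let ?N = "pareto \<alpha> \<Otimes>\<^sub>M Q"
  define \<mu> where "\<mu> u = distr (polar_law u) borel (\<lambda>z. (fst z, mask T (snd z)))" for u
  have [measurable]: "(\<lambda>z. (fst z, mask T (snd z))) \<in> borel \<rightarrow>\<^sub>M (borel :: (real \<times> (int \<Rightarrow> 's)) measure)"
    by (intro borel_measurable_Pair) measurable
  have e[measurable]: "(\<lambda>z. (fst z, mask T (snd z))) \<in> polar_law u \<rightarrow>\<^sub>M borel" for u by measurable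
  have s\<mu>: "sets (\<mu> u) = sets borel" for u by (simp add: \<mu>_def)
  have fin: "finite_measure (\<mu> u)" for u
    unfolding \<mu>_def by (intro finite_measure.finite_measure_distr finite_measure_polar_law e)
  show "finite_measure (distr (polar_law u) borel (\<lambda>z. (fst z, mask T (snd z))))" for u
    using fin by (simp add: \<mu>_def)
  show "finite_measure ?N" by (rule PQ.P.finite_measure_axioms)
  show sN: "sets ?N = sets borel" by (rule sets_pareto_pair) fact
  have spN: "space ?N = UNIV" using sets_eq_imp_space_eq[OF sN] by simp
  have exceed: "((\<lambda>u. \<integral>z. indicator {c<..} (fst z) * g (snd z) \<partial>\<mu> u) \<longlongrightarrow>
      (\<integral>z. indicator {c<..} (fst z) * g (snd z) \<partial>?N)) at_top"
    if c: "c \<ge> 1" and g: "continuous_on UNIV g" "\<And>x. \<bar>g x\<bar> \<le> C" for c C and g :: "(int \<Rightarrow> 's) \<Rightarrow> real"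
  proof -
    have [measurable]: "g \<in> borel_measurable borel" using g(1) by (rule borel_measurable_continuous_onI)
    have bd: "bounded (range g)" using g(2) by (auto simp: bounded_iff intro!: exI[of _ C])
    have "((\<lambda>u. \<integral>z. g z \<partial>distr (polar_law u) borel (\<lambda>z. mask T (snd z))) \<longlongrightarrow> (\<integral>x. g x \<partial>Q)) at_top"
      using conv g(1) bd unfolding converges_weakly_in_euclidean_iff by blast
    moreover have "(\<integral>z. g z \<partial>distr (polar_law u) borel (\<lambda>z. mask T (snd z))) = (\<integral>z. g (mask T (snd z)) \<partial>polar_law u)" for u
      by (rule integral_distr) measurable
    ultimately have g': "((\<lambda>u. \<integral>z. g (mask T (snd z)) \<partial>polar_law u) \<longlongrightarrow> (\<integral>x. g x \<partial>Q)) at_top"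
      by simp
    have "filterlim (\<lambda>u. c * u) at_top at_top"
      using c by (intro filterlim_tendsto_pos_mult_at_top[OF tendsto_const]) (auto simp: filterlim_ident)
    from filterlim_compose[OF g' this]
    have 1: "((\<lambda>u. \<integral>z. g (mask T (snd z)) \<partial>polar_law (c * u)) \<longlongrightarrow> (\<integral>x. g x \<partial>Q)) at_top" .
    have 2: "((\<lambda>u. tail (c * u) / tail u) \<longlongrightarrow> c powr (- \<alpha>)) at_top"
      using rv c by (simp add: regularly_varying_def)
    have "(\<integral>z. indicator {c<..} (fst z) * g (snd z) \<partial>\<mu> u) =
        tail (c * u) / tail u * (\<integral>z. g (mask T (snd z)) \<partial>polar_law (c * u))" if "u > 0" for u
      unfolding \<mu>_def
      using integral_polar_law_exceed[OF that c, of "\<lambda>x. g (mask T x)"]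
      by (subst integral_distr[OF e]) auto
    then have "\<forall>\<^sub>F u in at_top. tail (c * u) / tail u * (\<integral>z. g (mask T (snd z)) \<partial>polar_law (c * u)) =
        (\<integral>z. indicator {c<..} (fst z) * g (snd z) \<partial>\<mu> u)"
      by (intro eventually_mono[OF eventually_gt_at_top[of "0::real"]]) simp
    from Lim_transform_eventually[OF tendsto_mult[OF 2 1] this] show ?thesis
      using integral_pareto_pair[OF Q index_pos c \<open>g \<in> borel_measurable borel\<close> g(2)] by simp
  qed
  fix h :: "real \<times> (int \<Rightarrow> 's) \<Rightarrow> real" and L C
  assume h: "L-lipschitz_on UNIV h" "\<And>x. 0 \<le> h x" "\<And>x. h x \<le> C"
  have C0: "0 \<le> C" using h(2)[of undefined] h(3)[of undefined] by linarith
  have hC: "\<bar>h x\<bar> \<le> C" for x using h(2,3)[of x] by simp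
  have L0: "0 \<le> L" using h(1) by (rule lipschitz_on_nonneg)
  have hc: "continuous_on UNIV h" using h(1) by (rule lipschitz_on_continuous_on)
  have hk: "continuous_on UNIV (\<lambda>x. h (a, x))" for a
    by (rule continuous_on_compose2[OF hc]) (auto intro: continuous_intros)
  have [measurable]: "(\<lambda>x. h (a, x)) \<in> borel_measurable borel" for a
    using hk by (rule borel_measurable_continuous_onI)
  have ss: "((\<lambda>u. \<integral>z. step_approx \<eta> n h z \<partial>\<mu> u) \<longlongrightarrow> (\<integral>z. step_approx \<eta> n h z \<partial>?N)) at_top" if "\<eta> > 0" for \<eta> n
  proof -
    have k1: "1 + real k * \<eta> \<ge> 1" for k using that by simp
    have int: "integrable m (\<lambda>z. indicator {1 + real j * \<eta><..} (fst z) * h (1 + real k * \<eta>, snd z))"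
      if "finite_measure m" "sets m = sets borel" for m j k
      using that C0 hC by (intro finite_measure_integrable_bounded[where C=C]) (auto simp: indicator_def)
    have eq: "(\<integral>z. step_approx \<eta> n h z \<partial>m) = (\<Sum>k<n. (\<integral>z. indicator {1 + real k * \<eta><..} (fst z) * h (1 + real k * \<eta>, snd z) \<partial>m) -
       (\<integral>z. indicator {1 + real (Suc k) * \<eta><..} (fst z) * h (1 + real k * \<eta>, snd z) \<partial>m))"
      if "finite_measure m" "sets m = sets borel" for m
      unfolding step_approx_def left_diff_distrib using int[OF that]
      by (simp del: of_nat_Suc)
    show ?thesis
      unfolding eq[OF fin s\<mu>] eq[OF \<open>finite_measure ?N\<close> sN]
      by (intro tendsto_sum tendsto_diff exceed[OF k1 hk hC])
  qed
  have "((\<lambda>u. \<integral>z. h z \<partial>\<mu> u) \<longlongrightarrow> (\<integral>z. h z \<partial>?N)) at_top"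
  proof (rule tendsto_uniform_approx)
    fix e :: real assume "e > 0"
    \<comment> \<open>The summand 1 keeps the mesh positive for \<open>L = 0\<close>; the
      discretisation error is then at most \<open>e / 3\<close>.\<close>
    define \<eta> where "\<eta> = e / (3 * (L + 1))"
    have \<eta>: "\<eta> > 0" "L * \<eta> \<le> e / 3" using \<open>e > 0\<close> L0 by (auto simp: \<eta>_def field_simps)
    have "((\<lambda>n. C * (1 + real n * \<eta>) powr (- \<alpha>)) \<longlongrightarrow> C * 0) sequentially"
      using \<eta> index_pos
      by (intro tendsto_mult tendsto_const tendsto_neg_powr filterlim_tendsto_add_at_top[OF tendsto_const]
          filterlim_at_top_mult_tendsto_pos[OF tendsto_const] filterlim_real_sequentially) auto
    then have "\<forall>\<^sub>F n in sequentially. C * (1 + real n * \<eta>) powr (- \<alpha>) < e / 3"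
      using \<open>e > 0\<close> by (intro order_tendstoD(2)) auto
    then obtain n where n: "C * (1 + real n * \<eta>) powr (- \<alpha>) < e / 3"
      by (auto simp: eventually_sequentially)
    let ?c = "1 + real n * \<eta>"
    have c1: "?c \<ge> 1" using \<eta> by simp
    have i1: "((\<lambda>u. \<integral>z. indicat_real {?c<..} (fst z) \<partial>\<mu> u) \<longlongrightarrow> (\<integral>z. indicat_real {?c<..} (fst z) \<partial>?N)) at_top"
      using exceed[OF c1, of "\<lambda>_. 1" 1] by simp
    have i2: "(\<integral>z. indicat_real {?c<..} (fst z) \<partial>?N) = ?c powr (- \<alpha>)"
      using integral_pareto_pair[OF Q index_pos c1, of "\<lambda>_. 1" 1] Q.prob_space by simp
    have "((\<lambda>u. C * (\<integral>z. indicat_real {?c<..} (fst z) \<partial>\<mu> u)) \<longlongrightarrow> C * ?c powr (- \<alpha>)) at_top"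
      using i1 unfolding i2 by (intro tendsto_intros)
    \<comment> \<open>The radial tail is small in the limit and hence eventually small before it:
      tightness of the radial part is a consequence of regular variation.\<close>
    then have ev: "\<forall>\<^sub>F u in at_top. C * (\<integral>z. indicat_real {?c<..} (fst z) \<partial>\<mu> u) < e / 3"
      using n by (rule order_tendstoD(2))
    have A: "\<bar>(\<integral>z. h z \<partial>\<mu> u) - (\<integral>z. step_approx \<eta> n h z \<partial>\<mu> u)\<bar> \<le> e"
      if u: "u > 0" "C * (\<integral>z. indicat_real {?c<..} (fst z) \<partial>\<mu> u) < e / 3" for u
    proof -
      have "measure (\<mu> u) UNIV \<le> 1"
        unfolding \<mu>_def using measure_polar_law_le_1[of u] sets_eq_imp_space_eq[OF sets_polar_law[of u]]
        by (subst measure_distr[OF e]) auto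
      moreover have "AE z in \<mu> u. 1 < fst z"
        unfolding \<mu>_def using AE_polar_law[OF u(1)] by (subst AE_distr_iff[OF e]) auto
      ultimately have "\<bar>(\<integral>z. h z \<partial>\<mu> u) - (\<integral>z. step_approx \<eta> n h z \<partial>\<mu> u)\<bar> \<le>
          L * \<eta> + C * (\<integral>z. indicat_real {?c<..} (fst z) \<partial>\<mu> u)"
        by (intro integral_step_approx_bound[OF fin s\<mu> _ _ h(1) hC \<eta>(1)])
      then show ?thesis using u \<eta> \<open>e > 0\<close> by linarith
    qed
    have "AE z in ?N. 1 < fst z"
    proof (rule PQ.AE_pair_measure)
      have "{z::real \<times> (int \<Rightarrow> 's). 1 < fst z} \<in> sets borel"
        by (intro borel_open open_Collect_less continuous_intros)
      then show "{z \<in> space ?N. 1 < fst z} \<in> sets ?N" by (simp only: sN spN) simp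
      show "AE y in pareto \<alpha>. AE x in Q. 1 < fst (y, x)"
        using AE_pareto[OF index_pos] by simp
    qed
    moreover have "measure ?N UNIV \<le> 1" using PQ.P.prob_space spN by simp
    ultimately have "\<bar>(\<integral>z. h z \<partial>?N) - (\<integral>z. step_approx \<eta> n h z \<partial>?N)\<bar> \<le>
        L * \<eta> + C * (\<integral>z. indicat_real {?c<..} (fst z) \<partial>?N)"
      by (intro integral_step_approx_bound[OF \<open>finite_measure ?N\<close> sN _ _ h(1) hC \<eta>(1)])
    then have B: "\<bar>(\<integral>z. h z \<partial>?N) - (\<integral>z. step_approx \<eta> n h z \<partial>?N)\<bar> \<le> e"
      unfolding i2 using n \<eta> \<open>e > 0\<close> by linarith
    have "\<forall>\<^sub>F u in at_top. \<bar>(\<integral>z. h z \<partial>\<mu> u) - (\<integral>z. step_approx \<eta> n h z \<partial>\<mu> u)\<bar> \<le> e"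
      using ev eventually_gt_at_top[of 0] by eventually_elim (rule A)
    then show "\<exists>g l. (g \<longlongrightarrow> l) at_top \<and> (\<forall>\<^sub>F u in at_top. \<bar>(\<integral>z. h z \<partial>\<mu> u) - g u\<bar> \<le> e) \<and> \<bar>l - (\<integral>z. h z \<partial>?N)\<bar> \<le> e"
      using B ss[OF \<eta>(1), of n]
      by (intro exI[of _ "\<lambda>u. \<integral>z. step_approx \<eta> n h z \<partial>\<mu> u"] exI[of _ "\<integral>z. step_approx \<eta> n h z \<partial>?N"])
        (auto simp: abs_minus_commute)
  qed
  then show "((\<lambda>u. \<integral>z. h z \<partial>distr (polar_law u) borel (\<lambda>z. (fst z, mask T (snd z)))) \<longlongrightarrow> (\<integral>z. h z \<partial>?N)) at_top"
    by (simp add: \<mu>_def)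
qed simp

text \<open>For \<open>c > 1\<close> tail ratios are probabilities of \<open>fst z > c\<close> under
  the polar laws; ramps on both sides of \<open>c\<close> bracket this indicator by continuous
  functions, and the Pareto tail is continuous in \<open>c\<close>. For \<open>c < 1\<close> the
  ratios are reciprocals of those for \<open>1 / c\<close>.\<close>

lemma regularly_varying_of_radial_conv:
  assumes conv: "\<And>\<psi> :: real \<Rightarrow> real. continuous_on UNIV \<psi> \<Longrightarrow> bounded (range \<psi>) \<Longrightarrow>
      ((\<lambda>u. \<integral>z. \<psi> (fst z) \<partial>polar_law u) \<longlongrightarrow> (\<integral>y. \<psi> y \<partial>L)) at_top"
    and L: "prob_space L" "sets L = sets borel" "\<And>y. y \<ge> 1 \<Longrightarrow> measure L {y<..} = y powr (- \<alpha>)"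
  shows "regularly_varying (- \<alpha>) tail"
proof -
  interpret L: prob_space L by fact
  note [measurable_cong] = L(2)
  \<comment> \<open>The polar law is null wherever the tail vanishes, so convergence of the masses
    to 1 makes the tail eventually positive.\<close>
  have "((\<lambda>u. \<integral>z. (1::real) \<partial>polar_law u) \<longlongrightarrow> 1) at_top"
  proof -
    have "(\<integral>y. 1 \<partial>L) = (1::real)" by (simp add: L.prob_space)
    then show ?thesis using conv[of "\<lambda>_. 1"] by (simp del: lebesgue_integral_const)
  qed
  then have "\<forall>\<^sub>F u in at_top. 0 < (\<integral>z. (1::real) \<partial>polar_law u)"
    by (rule order_tendstoD) simp
  moreover have "(\<integral>z. (1::real) \<partial>polar_law u) = tail u / tail u" for u
    by (subst integral_polar_law) (auto simp: tail_def sets.Int_space_eq1)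
  ultimately have pos: "\<forall>\<^sub>F u in at_top. 0 < tail u"
    using tail_nonneg by (auto elim!: eventually_mono simp: less_le)
  have gt1: "((\<lambda>u. tail (c * u) / tail u) \<longlongrightarrow> c powr (- \<alpha>)) at_top" if "c > 1" for c
  proof (rule tendsto_sandwich_approx)
    fix e :: real assume "e > 0"
    have t1: "((\<lambda>\<eta>. (c + \<eta>) powr (- \<alpha>)) \<longlongrightarrow> c powr (- \<alpha>)) (at_right 0)"
      and t2: "((\<lambda>\<eta>. (c - \<eta>) powr (- \<alpha>)) \<longlongrightarrow> c powr (- \<alpha>)) (at_right 0)"
      using that by (auto intro!: tendsto_eq_intros)
    \<comment> \<open>The bound \<open>\<eta> < c - 1\<close> keeps \<open>c - \<eta>\<close> in the
      range where the tail of \<open>L\<close> is prescribed.\<close>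
    have "\<forall>\<^sub>F \<eta> in at_right 0. c powr (- \<alpha>) - e < (c + \<eta>) powr (- \<alpha>)"
      "\<forall>\<^sub>F \<eta> in at_right 0. (c - \<eta>) powr (- \<alpha>) < c powr (- \<alpha>) + e"
      "\<forall>\<^sub>F \<eta> in at_right 0. \<eta> < c - 1" "\<forall>\<^sub>F \<eta>::real in at_right 0. 0 < \<eta>"
      using order_tendstoD(1)[OF t1] order_tendstoD(2)[OF t2] \<open>e > 0\<close> that
      by (auto simp: eventually_at_right_less intro: eventually_at_right_real eventually_at_rightI)
    then have "\<forall>\<^sub>F \<eta> in at_right 0. c powr (- \<alpha>) - e < (c + \<eta>) powr (- \<alpha>) \<and>
        (c - \<eta>) powr (- \<alpha>) < c powr (- \<alpha>) + e \<and> \<eta> < c - 1 \<and> 0 < \<eta>"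
      by (intro eventually_conj)
    then obtain \<eta> where \<eta>: "c powr (- \<alpha>) - e < (c + \<eta>) powr (- \<alpha>)"
        "(c - \<eta>) powr (- \<alpha>) < c powr (- \<alpha>) + e" "\<eta> < c - 1" "0 < \<eta>"
      using eventually_happens[of _ "at_right (0::real)"] by (auto simp: trivial_limit_at_right_real)
    have bd: "continuous_on UNIV (ramp a b)" "bounded (range (ramp a b))" if "a < b" for a b
      using that continuous_on_ramp[OF that continuous_on_id, of UNIV] ramp_range[of a b]
      by (auto simp: bounded_iff intro!: exI[of _ 1])
    have [measurable]: "ramp a b \<in> borel_measurable borel" for a b
      unfolding ramp_def by measurable
    have ri: "integrable m (\<lambda>z. ramp a b (f z))" if "finite_measure m" "f \<in> borel_measurable m"
      for a b and m :: "'c measure" and f :: "'c \<Rightarrow> real"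
    proof -
      interpret finite_measure m by fact
      note that(2)[measurable]
      show ?thesis using ramp_range by (intro integrable_const_bound[of _ 1]) auto
    qed
    have ii: "integrable m (\<lambda>z. indicator {a<..} (f z) :: real)" if "finite_measure m" "f \<in> borel_measurable m"
      for a and m :: "'c measure" and f :: "'c \<Rightarrow> real"
    proof -
      interpret finite_measure m by fact
      note that(2)[measurable]
      show ?thesis by (intro integrable_const_bound[of _ 1]) auto
    qed
    have cmp: "ramp c (c + \<eta>) y \<le> indicator {c<..} y" "indicator {c<..} y \<le> ramp (c - \<eta>) c y"
      "indicator {c + \<eta><..} y \<le> ramp c (c + \<eta>) y" "ramp (c - \<eta>) c y \<le> indicator {c - \<eta><..} y" for y
      using ramp_range[of c "c + \<eta>" y] ramp_range[of "c - \<eta>" c y] \<open>0 < \<eta>\<close>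
        ramp_eq_0[of c "c + \<eta>" y] ramp_eq_1[of "c - \<eta>" c y] ramp_eq_1[of c "c + \<eta>" y] ramp_eq_0[of "c - \<eta>" c y]
      by (auto simp: indicator_def)
    have eqI: "tail (c * u) / tail u = (\<integral>z. indicator {c<..} (fst z) \<partial>polar_law u)"
      if u: "u > 0" "0 < tail (c * u)" for u
    proof -
      have "(\<integral>z. (1::real) \<partial>polar_law (c * u)) = 1"
        using u by (subst integral_polar_law) (auto simp: tail_def sets.Int_space_eq1)
      then show ?thesis
        using integral_polar_law_exceed[of u c "\<lambda>_. 1"] u \<open>c > 1\<close> by simp
    qed
    have "filterlim (\<lambda>u. c * u) at_top at_top"
      using \<open>c > 1\<close> by (intro filterlim_tendsto_pos_mult_at_top[OF tendsto_const]) (auto simp: filterlim_ident)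
    then have pos': "\<forall>\<^sub>F u in at_top. 0 < tail (c * u)"
      using pos by (auto simp: filterlim_iff)
    have f: "fst \<in> borel_measurable (polar_law u)" for u by measurable
    have "\<forall>\<^sub>F u in at_top. (\<integral>z. ramp c (c + \<eta>) (fst z) \<partial>polar_law u) \<le> tail (c * u) / tail u \<and>
        tail (c * u) / tail u \<le> (\<integral>z. ramp (c - \<eta>) c (fst z) \<partial>polar_law u)"
      using pos' eventually_gt_at_top[of 0]
      by eventually_elim (auto simp: eqI intro!: integral_mono ri ii finite_measure_polar_law cmp)
    moreover have "c powr (- \<alpha>) - e \<le> (\<integral>y. ramp c (c + \<eta>) y \<partial>L)"
    proof -
      have "(\<integral>y. indicator {c + \<eta><..} y \<partial>L) \<le> (\<integral>y. ramp c (c + \<eta>) y \<partial>L)"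
        by (intro integral_mono ri ii cmp L.finite_measure_axioms) (auto intro: cmp)
      then show ?thesis using L(3)[of "c + \<eta>"] \<eta> \<open>c > 1\<close> L(2) by simp
    qed
    moreover have "(\<integral>y. ramp (c - \<eta>) c y \<partial>L) \<le> c powr (- \<alpha>) + e"
    proof -
      have "(\<integral>y. ramp (c - \<eta>) c y \<partial>L) \<le> (\<integral>y. indicator {c - \<eta><..} y \<partial>L)"
        by (intro integral_mono ri ii cmp L.finite_measure_axioms) (auto intro: cmp)
      then show ?thesis using L(3)[of "c - \<eta>"] \<eta> \<open>c > 1\<close> L(2) by simp
    qed
    ultimately show "\<exists>lo hi a b. (lo \<longlongrightarrow> a) at_top \<and> (hi \<longlongrightarrow> b) at_top \<and>
        (\<forall>\<^sub>F u in at_top. lo u \<le> tail (c * u) / tail u \<and> tail (c * u) / tail u \<le> hi u) \<and>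
        c powr (- \<alpha>) - e \<le> a \<and> b \<le> c powr (- \<alpha>) + e"
      using conv[OF bd, of c "c + \<eta>"] conv[OF bd, of "c - \<eta>" c] \<eta>(4) by fastforce
  qed
  have "((\<lambda>u. tail (c * u) / tail u) \<longlongrightarrow> c powr (- \<alpha>)) at_top" if "c > 0" for c
  proof -
    consider "c > 1" | "c = 1" | "c < 1" by linarith
    then show ?thesis
    proof cases
      case 2
      then show ?thesis using pos by (intro tendsto_eventually) (auto elim!: eventually_mono)
    next
      case 3
      have "filterlim (\<lambda>u. c * u) at_top at_top"
        using that by (intro filterlim_tendsto_pos_mult_at_top[OF tendsto_const]) (auto simp: filterlim_ident)
      from filterlim_compose[OF gt1[of "1 / c"] this]
      have "((\<lambda>u. tail u / tail (c * u)) \<longlongrightarrow> (1 / c) powr (- \<alpha>)) at_top"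
        using 3 that by simp
      from tendsto_inverse[OF this] show ?thesis using that
        by (simp add: powr_divide powr_minus divide_simps)
    qed (rule gt1)
  qed
  moreover obtain u0 where "\<And>u. u > u0 \<Longrightarrow> 0 < tail u"
    using pos by (auto simp: eventually_at_top_dense)
  moreover have "tail \<in> borel_measurable borel"
  proof -
    have "(\<lambda>u. - tail u) \<in> borel_measurable borel"
      by (rule borel_measurable_mono) (auto intro!: monoI tail_antimono)
    then show ?thesis by simp
  qed
  ultimately show ?thesis
    unfolding regularly_varying_def by (auto intro!: exI[of _ u0] measurable_restrict_space1)
qed

end

subsection \<open>The time change limit\<close>

context star_space
begin

text \<open>A time shift by \<open>s\<close> followed by normalising the new coordinate 0 to modulus
  1; the old coordinate 0 moves to time \<open>- s\<close>. As \<open>1 / 0 = 0\<close>, a path that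
  is the origin at \<open>s\<close> is sent to the constant path at the origin.\<close>

definition rebase :: "int \<Rightarrow> (int \<Rightarrow> 's) \<Rightarrow> int \<Rightarrow> 's" where
  "rebase s x = (\<lambda>t. smul (1 / \<rho> (x s)) (x (t + s)))"

lemma rebase_measurable [measurable]: "rebase s \<in> borel_measurable borel"
  unfolding rebase_def
  by (intro measurable_coordinatewise_then_product smul_measurable) (auto simp: modulus_nonneg)

lemma modulus_rebase: "\<rho> (rebase s x t) = \<rho> (x (t + s)) / \<rho> (x s)"
  by (simp add: rebase_def modulus_smul modulus_nonneg)

text \<open>From time \<open>- s\<close> on, the rebased path reads only coordinates of
  \<open>x\<close> from 0 on, and the normalising coordinate \<open>s\<close> is among them. This is
  why a forward limit determines part of the past.\<close>

lemma mask_rebase: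
  "0 \<le> s \<Longrightarrow> mask {- s..} (rebase s (mask {0..} x)) = mask {- s..} (rebase s x)"
  by (auto simp: mask_def rebase_def fun_eq_iff)

text \<open>\<open>rebase s\<close> is discontinuous where the coordinate \<open>s\<close> is the
  origin, but there the ramp vanishes on a whole neighbourhood. Continuity is checked separately on
  two open sets that cover the space.\<close>

lemma continuous_on_ramp_rebase:
  assumes k: "continuous_on UNIV k" and "0 < a" "a < b"
  shows "continuous_on UNIV (\<lambda>z::real \<times> (int \<Rightarrow> 's). ramp a b (\<delta> * fst z * \<rho> (snd z s)) * k (rebase s (snd z)))"
    (is "continuous_on UNIV ?K")
proof -
  let ?A = "{z::real \<times> (int \<Rightarrow> 's). 0 < \<rho> (snd z s)}"
  let ?B = "{z::real \<times> (int \<Rightarrow> 's). \<delta> * fst z * \<rho> (snd z s) < a}"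
  have c: "continuous_on S (\<lambda>z::real \<times> (int \<Rightarrow> 's). snd z t)" for S t
    by (rule continuous_on_product_then_coordinatewise) (intro continuous_intros)
  have oA: "open ?A" by (intro open_Collect_less continuous_intros c)
  have oB: "open ?B" by (intro open_Collect_less continuous_intros c)
  have "continuous_on ?A (\<lambda>z. rebase s (snd z))"
    unfolding rebase_def
    by (intro continuous_on_coordinatewise_then_product continuous_on_smul continuous_intros c)
      (auto simp: modulus_nonneg)
  then have "continuous_on ?A (\<lambda>z. k (rebase s (snd z)))"
    by (rule continuous_on_compose2[OF k]) simp
  moreover have "continuous_on ?A (\<lambda>z. \<delta> * fst z * \<rho> (snd z s))"
    by (intro continuous_intros c)
  then have "continuous_on ?A (\<lambda>z. ramp a b (\<delta> * fst z * \<rho> (snd z s)))"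
    by (rule continuous_on_ramp[OF \<open>a < b\<close>])
  ultimately have "continuous_on ?A ?K"
    by (intro continuous_on_mult)
  moreover have "continuous_on ?B ?K"
  proof (subst continuous_on_cong[OF refl])
    show "?K z = 0" if "z \<in> ?B" for z using that ramp_eq_0[OF \<open>a < b\<close>] by auto
  qed auto
  moreover have "?A \<union> ?B = UNIV"
    using \<open>0 < a\<close> modulus_nonneg by (auto simp: less_le)
  ultimately show ?thesis
    using continuous_on_open_Un[OF oA oB, of ?K] by (simp only:)
qed

end

context stationary_series
begin

text \<open>The right-hand side of the time change formula as a measure: a weight by the modulus at
  \<open>s\<close>, then the law of the rebased path. For a forward limit it turns out to be a
  subprobability measure; the missing mass belongs to paths that are the origin at time
  \<open>- s\<close>.\<close>

definition tilt :: "int \<Rightarrow> (int \<Rightarrow> 's) measure \<Rightarrow> (int \<Rightarrow> 's) measure" where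
  "tilt s Q = distr (density Q (\<lambda>x. ennreal (\<rho> (x s) powr \<alpha>))) borel (rebase s)"

definition spectral_law :: "int set \<Rightarrow> (int \<Rightarrow> 's) measure \<Rightarrow> bool" where
  "spectral_law T Q \<longleftrightarrow> prob_space Q \<and> sets Q = sets borel \<and>
    converges_weakly_in euclidean (\<lambda>u. distr (polar_law u) borel (\<lambda>z. mask T (snd z))) Q at_top"

definition forward_limit :: "(int \<Rightarrow> 's) measure \<Rightarrow> bool" where
  "forward_limit Q \<longleftrightarrow> regularly_varying (- \<alpha>) tail \<and> spectral_law {0..} Q"

section \<open>Integration against tilted laws\<close>

lemma sets_tilt [simp, measurable_cong]: "sets (tilt s Q) = sets borel"
  by (simp add: tilt_def)

lemma space_tilt [simp]: "space (tilt s Q) = UNIV"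
  by (simp add: tilt_def)

lemma integral_tilt:
  assumes [measurable_cong]: "sets Q = sets borel" and [measurable]: "f \<in> borel_measurable borel"
  shows "(\<integral>x. f x \<partial>tilt s Q) = (\<integral>x. \<rho> (x s) powr \<alpha> * f (rebase s x) \<partial>Q)"
  unfolding tilt_def
  by (subst integral_distr) (auto simp: integral_density)

lemma integrable_tilt_iff:
  fixes f :: "(int \<Rightarrow> 's) \<Rightarrow> real"
  assumes [measurable_cong]: "sets Q = sets borel" and [measurable]: "f \<in> borel_measurable borel"
  shows "integrable (tilt s Q) f \<longleftrightarrow> integrable Q (\<lambda>x. \<rho> (x s) powr \<alpha> * f (rebase s x))"
  unfolding tilt_def
  by (subst integrable_distr_eq) (auto simp: integrable_density)

text \<open>The bounded continuous function \<open>h\<close>, a truncated distance of the modulus at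
  time 0 from 1, integrates to 0 under every polar law at a positive level. Hence it does so under
  the limit, where a nonnegative function with integral 0 vanishes almost everywhere.\<close>

lemma AE_forward_limit:
  assumes "forward_limit Q" shows "AE x in Q. \<rho> (x 0) = 1"
proof -
  have [measurable_cong]: "sets Q = sets borel" and "prob_space Q" using assms by (auto simp: forward_limit_def spectral_law_def)
  interpret Q: prob_space Q by fact
  define h where "h x = min 1 \<bar>\<rho> (x 0) - 1\<bar>" for x :: "int \<Rightarrow> 's"
  have hc: "continuous_on UNIV h" unfolding h_def by (intro continuous_intros continuous_on_coordinate)
  have [measurable]: "h \<in> borel_measurable borel" by (rule borel_measurable_continuous_onI[OF hc])
  have h: "0 \<le> h x" "h x \<le> 1" for x by (auto simp: h_def)
  have "bounded (range h)" using h by (auto simp: bounded_iff intro!: exI[of _ 1])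
  then have "((\<lambda>u. \<integral>x. h x \<partial>distr (polar_law u) borel (\<lambda>z. mask {0..} (snd z))) \<longlongrightarrow> (\<integral>x. h x \<partial>Q)) at_top"
    using assms hc by (auto simp: forward_limit_def spectral_law_def converges_weakly_in_euclidean_iff)
  moreover have "(\<integral>x. h x \<partial>distr (polar_law u) borel (\<lambda>z. mask {0..} (snd z))) = 0" if "u > 0" for u
  proof -
    have "(\<integral>x. h x \<partial>distr (polar_law u) borel (\<lambda>z. mask {0..} (snd z))) = (\<integral>z. h (mask {0..} (snd z)) \<partial>polar_law u)"
      by (rule integral_distr) measurable
    also have "\<dots> = 0"
      using AE_polar_law[OF that] by (intro integral_eq_zero_AE) (auto simp: h_def mask_def)
    finally show ?thesis .
  qed
  then have "((\<lambda>u. \<integral>x. h x \<partial>distr (polar_law u) borel (\<lambda>z. mask {0..} (snd z))) \<longlongrightarrow> 0) at_top"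
    by (intro tendsto_eventually eventually_mono[OF eventually_gt_at_top[of "0::real"]]) auto
  ultimately have "(\<integral>x. h x \<partial>Q) = 0" using tendsto_unique trivial_limit_at_top_linorder by blast
  moreover have "integrable Q h" using h by (intro Q.integrable_const_bound[of _ 1]) auto
  ultimately have "AE x in Q. h x = 0"
    using h by (subst (asm) integral_nonneg_eq_0_iff_AE) auto
  then show ?thesis by eventually_elim (auto simp: h_def min_def split: if_splits)
qed

lemma angular_rebase:
  assumes "0 < \<rho> (X 0 \<omega>)" "0 < \<rho> (X s \<omega>)"
  shows "rebase s (angular \<omega>) = (\<lambda>t. smul (1 / \<rho> (X s \<omega>)) (X (t + s) \<omega>))"
  using assms by (simp add: rebase_def angular_def modulus_smul smul_smul)

text \<open>Stationarity moves the index \<open>0\<close> to \<open>s\<close>; as \<open>k\<close> vanishes where the modulus at \<open>- s\<close> is small,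
  an exceedance at \<open>s\<close> forces an exceedance of the smaller level \<open>\<delta> * u\<close> at \<open>0\<close>.\<close>

lemma integral_polar_law_shift:
  assumes "u > 0" "\<delta> > 0" and [measurable]: "k \<in> borel_measurable borel"
    and k0: "\<And>x. \<rho> (x (- s)) \<le> \<delta> \<Longrightarrow> k x = 0"
  shows "(\<integral>z. k (snd z) \<partial>polar_law u) = tail (\<delta> * u) / tail u *
    (\<integral>z. indicator {1<..} (\<delta> * fst z * \<rho> (snd z s)) * k (rebase s (snd z)) \<partial>polar_law (\<delta> * u))"
proof -
  define K where "K z = indicator {1<..} (\<delta> * fst z * \<rho> (snd z s)) * k (rebase s (snd z))"
    for z :: "real \<times> (int \<Rightarrow> 's)"
  have [measurable]: "(\<lambda>z::real \<times> (int \<Rightarrow> 's). \<rho> (snd z s)) \<in> borel_measurable borel"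
    by (rule measurable_compose[OF snd_borel_measurable]) measurable
  have [measurable]: "K \<in> borel_measurable borel" unfolding K_def by measurable
  \<comment> \<open>The conditional integrand as a function of the whole path:
    \<open>rebase 0\<close> reproduces the angular process, and stationarity then allows
    \<open>\<Phi>\<close> to be read along the shifted path.\<close>
  define \<Phi> where "\<Phi> x = indicator {u<..} (\<rho> (x 0)) * k (rebase 0 x)" for x :: "int \<Rightarrow> 's"
  have [measurable]: "\<Phi> \<in> borel_measurable borel" unfolding \<Phi>_def by measurable
  have m: "(\<lambda>\<omega> t. X t \<omega>) \<in> borel_measurable M" using series_measurable[of 0] by simp
  have 1: "(\<integral>z. k (snd z) \<partial>polar_law u) = (\<integral>\<omega>. \<Phi> (\<lambda>t. X t \<omega>) \<partial>M) / tail u"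
  proof (subst integral_polar_law)
    show "(\<integral>\<omega>. indicator (exceedance u) \<omega> * k (snd (\<rho> (X 0 \<omega>) / u, angular \<omega>)) \<partial>M) / tail u =
        (\<integral>\<omega>. \<Phi> (\<lambda>t. X t \<omega>) \<partial>M) / tail u"
      by (intro arg_cong2[where f="(/)"] Bochner_Integration.integral_cong)
        (auto simp: \<Phi>_def rebase_def angular_def exceedance_def indicator_def)
  qed measurable
  have "(\<integral>\<omega>. \<Phi> (\<lambda>t. X t \<omega>) \<partial>M) = (\<integral>x. \<Phi> x \<partial>distr M borel (\<lambda>\<omega> t. X t \<omega>))"
    by (rule integral_distr[symmetric]) (auto intro: m)
  also have "\<dots> = (\<integral>x. \<Phi> x \<partial>distr M borel (\<lambda>\<omega> t. X (t + s) \<omega>))"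
    by (simp add: stationary_law)
  also have "\<dots> = (\<integral>\<omega>. \<Phi> (\<lambda>t. X (t + s) \<omega>) \<partial>M)"
    by (rule integral_distr) measurable
  also have "\<dots> = (\<integral>\<omega>. indicator (exceedance (\<delta> * u)) \<omega> * K (\<rho> (X 0 \<omega>) / (\<delta> * u), angular \<omega>) \<partial>M)"
  proof (intro Bochner_Integration.integral_cong refl)
    fix \<omega> assume \<omega>: "\<omega> \<in> space M"
    have \<Phi>: "\<Phi> (\<lambda>t. X (t + s) \<omega>) = indicator {u<..} (\<rho> (X s \<omega>)) * k (\<lambda>t. smul (1 / \<rho> (X s \<omega>)) (X (t + s) \<omega>))"
      by (simp add: \<Phi>_def rebase_def)
    show "\<Phi> (\<lambda>t. X (t + s) \<omega>) = indicator (exceedance (\<delta> * u)) \<omega> * K (\<rho> (X 0 \<omega>) / (\<delta> * u), angular \<omega>)"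
    proof (cases "\<omega> \<in> exceedance (\<delta> * u)")
      case True
      then have pos: "0 < \<rho> (X 0 \<omega>)"
        using less_trans[OF mult_pos_pos[OF \<open>\<delta> > 0\<close> \<open>u > 0\<close>]] by (auto simp: exceedance_def)
      have "\<delta> * (\<rho> (X 0 \<omega>) / (\<delta> * u)) * \<rho> (angular \<omega> s) = \<rho> (X s \<omega>) / u"
        using pos assms by (simp add: angular_def modulus_smul)
      moreover have "1 < \<rho> (X s \<omega>) / u \<longleftrightarrow> u < \<rho> (X s \<omega>)" using assms by (simp add: field_simps)
      ultimately show ?thesis
        using True pos \<open>u > 0\<close> unfolding \<Phi> K_def
        by (cases "u < \<rho> (X s \<omega>)") (simp_all add: angular_rebase indicator_def)
    next
      case False
      have "k (\<lambda>t. smul (1 / \<rho> (X s \<omega>)) (X (t + s) \<omega>)) = 0" if "u < \<rho> (X s \<omega>)"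
      proof (rule k0)
        have "\<delta> * u \<le> \<delta> * \<rho> (X s \<omega>)" using that assms by simp
        then have "\<rho> (X 0 \<omega>) \<le> \<delta> * \<rho> (X s \<omega>)" using False \<omega> by (auto simp: exceedance_def)
        then show "\<rho> (smul (1 / \<rho> (X s \<omega>)) (X (- s + s) \<omega>)) \<le> \<delta>"
          using that assms by (simp add: modulus_smul pos_divide_le_eq)
      qed
      then show ?thesis using False unfolding \<Phi> by (simp add: indicator_def)
    qed
  qed
  finally have 2: "(\<integral>\<omega>. \<Phi> (\<lambda>t. X t \<omega>) \<partial>M) =
    (\<integral>\<omega>. indicator (exceedance (\<delta> * u)) \<omega> * K (\<rho> (X 0 \<omega>) / (\<delta> * u), angular \<omega>) \<partial>M)" (is "_ = ?I") .
  have 3: "(\<integral>z. K z \<partial>polar_law (\<delta> * u)) = ?I / tail (\<delta> * u)"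
    by (rule integral_polar_law) measurable
  have "?I = 0" if "tail (\<delta> * u) = 0"
  proof -
    have "exceedance (\<delta> * u) \<in> null_sets M" using that by (auto simp: tail_def emeasure_eq_measure)
    then show ?thesis by (intro integral_eq_zero_AE) (auto dest!: AE_not_in)
  qed
  then have "(\<integral>z. k (snd z) \<partial>polar_law u) = tail (\<delta> * u) / tail u * (\<integral>z. K z \<partial>polar_law (\<delta> * u))"
    using 1 2 3 by (cases "tail (\<delta> * u) = 0") auto
  then show ?thesis by (simp add: K_def)
qed

text \<open>Under a forward limit the coordinate 0 has modulus 1, so the rebased path has modulus
  \<open>1 / \<rho> (x s)\<close> at time \<open>- s\<close>. Where \<open>k\<close> of the rebased
  path is nonzero this exceeds \<delta>, which bounds the weight by
  \<open>(1 / \<delta>) powr \<alpha>\<close>.\<close>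

lemma time_change_bounded:
  assumes Q: "forward_limit Q" and "\<delta> > 0"
    and k: "\<And>x. 0 \<le> k x" "\<And>x. k x \<le> C"
    and k0: "\<And>x. \<rho> (x (- s)) \<le> \<delta> \<Longrightarrow> k x = 0"
  shows "AE x in Q. (k (rebase s x) \<noteq> 0 \<longrightarrow> \<delta> * \<rho> (x s) \<le> 1) \<and>
    \<bar>\<rho> (x s) powr \<alpha> * k (rebase s x)\<bar> \<le> (1 / \<delta>) powr \<alpha> * C"
  using AE_forward_limit[OF Q]
proof eventually_elim
  case (elim x)
  have le: "\<delta> * \<rho> (x s) \<le> 1" if "k (rebase s x) \<noteq> 0"
  proof (cases "\<rho> (x s) = 0")
    case False
    then have pos: "\<rho> (x s) > 0" using modulus_nonneg[of "x s"] by linarith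
    have "\<not> \<rho> (rebase s x (- s)) \<le> \<delta>" using k0[of "rebase s x"] that by blast
    then show ?thesis using pos elim by (simp add: modulus_rebase field_simps)
  qed simp
  have "\<rho> (x s) powr \<alpha> * k (rebase s x) \<le> (1 / \<delta>) powr \<alpha> * C" if "k (rebase s x) \<noteq> 0"
    using le[OF that] index_pos \<open>\<delta> > 0\<close> modulus_nonneg[of "x s"] k
    by (intro mult_mono powr_mono2) (auto simp: field_simps)
  moreover have "0 \<le> C" using k(1)[of x] k(2)[of x] by linarith
  ultimately show ?case using le k by (cases "k (rebase s x) = 0") auto
qed

text \<open>After the shift identity the level is \<open>\<delta> * u\<close> and the integrand
  contains the event \<open>\<delta> * y * \<rho> (x s) > 1\<close> for the radial variable
  \<open>y\<close>. In the limit \<open>y\<close> is Pareto and independent of the angular path, so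
  the event has conditional probability \<open>(\<delta> * \<rho> (x s)) powr \<alpha>\<close>,
  because \<open>\<delta> * \<rho> (x s) \<le> 1\<close> where the integrand is nonzero. The tail
  ratio contributes \<open>\<delta> powr (- \<alpha>)\<close>, and the auxiliary constant
  cancels.\<close>

lemma time_change_limit:
  fixes k :: "(int \<Rightarrow> 's) \<Rightarrow> real"
  assumes Q: "forward_limit Q" and "s \<ge> 0" "\<delta> > 0"
    and kc: "continuous_on UNIV k" and k: "\<And>x. 0 \<le> k x" "\<And>x. k x \<le> C"
    and k0: "\<And>x. \<rho> (x (- s)) \<le> \<delta> \<Longrightarrow> k x = 0"
    and km: "\<And>x. k (mask {- s..} x) = k x"
  shows "integrable (tilt s Q) k"
    and "((\<lambda>u. \<integral>z. k (snd z) \<partial>polar_law u) \<longlongrightarrow> (\<integral>x. k x \<partial>tilt s Q)) at_top"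
proof -
  have rv: "regularly_varying (- \<alpha>) tail" and pQ: "prob_space Q" and sQ[measurable_cong]: "sets Q = sets borel"
    and conv: "converges_weakly_in euclidean (\<lambda>u. distr (polar_law u) borel (\<lambda>z. mask {0..} (snd z))) Q at_top"
    using Q by (auto simp: forward_limit_def spectral_law_def)
  interpret R: prob_space "pareto \<alpha>" by (rule prob_space_pareto) (rule index_pos)
  interpret Q: prob_space Q by fact
  interpret PQ: pair_prob_space "pareto \<alpha>" Q ..
  let ?N = "pareto \<alpha> \<Otimes>\<^sub>M Q"
  have sN: "sets ?N = sets borel" by (rule sets_pareto_pair) fact
  have [measurable]: "k \<in> borel_measurable borel" by (rule borel_measurable_continuous_onI[OF kc])
  have AEb: "AE x in Q. (k (rebase s x) \<noteq> 0 \<longrightarrow> \<delta> * \<rho> (x s) \<le> 1) \<and>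
      \<bar>\<rho> (x s) powr \<alpha> * k (rebase s x)\<bar> \<le> (1 / \<delta>) powr \<alpha> * C"
    by (rule time_change_bounded[OF Q \<open>\<delta> > 0\<close> k]) (rule k0)
  have int: "integrable Q (\<lambda>x. \<rho> (x s) powr \<alpha> * k (rebase s x))"
    using AEb by (intro Q.integrable_const_bound[of _ "(1 / \<delta>) powr \<alpha> * C"]) auto
  then show "integrable (tilt s Q) k"
    by (simp add: integrable_tilt_iff[OF sQ])
  define I where "I = (\<integral>x. \<rho> (x s) powr \<alpha> * k (rebase s x) \<partial>Q)"
  have I: "I = (\<integral>x. k x \<partial>tilt s Q)" by (simp add: I_def integral_tilt[OF sQ])
  have I0: "0 \<le> I" unfolding I_def by (intro Bochner_Integration.integral_nonneg mult_nonneg_nonneg k) simp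
  have C0: "0 \<le> C" using k(1)[of undefined] k(2)[of undefined] by linarith
  \<comment> \<open>With \<open>f = indicator {1<..}\<close> this is the integrand of the shift
    identity. It is discontinuous, and ramps in place of \<open>f\<close> bracket it by continuous
    functions.\<close>
  define K where "K f z = f (\<delta> * fst z * \<rho> (snd z s)) * k (rebase s (snd z))"
    for z :: "real \<times> (int \<Rightarrow> 's)" and f :: "real \<Rightarrow> real"
  have rm[measurable]: "(\<lambda>z::real \<times> (int \<Rightarrow> 's). \<rho> (snd z s)) \<in> borel_measurable borel"
    by (rule measurable_compose[OF snd_borel_measurable]) measurable
  have Km: "K f \<in> borel_measurable borel" if [measurable]: "f \<in> borel_measurable borel" for f
    unfolding K_def by measurable
  have Kb: "0 \<le> K f z" "K f z \<le> C" if "\<And>r. 0 \<le> f r" "\<And>r. f r \<le> 1" for f z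
    using that k C0 mult_mono[of "f (\<delta> * fst z * \<rho> (snd z s))" 1 "k (rebase s (snd z))" C]
    by (auto simp: K_def)
  have [measurable]: "ramp a b \<in> borel_measurable borel" for a b
    unfolding ramp_def by measurable
  have inner: "(\<integral>z. K f z \<partial>?N) = (\<integral>x. (\<integral>y. f (\<delta> * y * \<rho> (x s)) \<partial>pareto \<alpha>) * k (rebase s x) \<partial>Q)"
    if [measurable]: "f \<in> borel_measurable borel" and f: "\<And>r. 0 \<le> f r" "\<And>r. f r \<le> 1" for f
  proof -
    have "integrable ?N (K f)"
      using Kb[OF f] by (intro finite_measure_integrable_bounded[OF PQ.P.finite_measure_axioms sN, of _ C] Km) auto
    then have "integrable ?N (case_prod (\<lambda>y x. K f (y, x)))" by simp
    from PQ.integral_snd[OF this]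
    have "(\<integral>x. (\<integral>y. K f (y, x) \<partial>pareto \<alpha>) \<partial>Q) = (\<integral>z. K f z \<partial>?N)" by simp
    moreover have "K f (y, x) = f (\<delta> * y * \<rho> (x s)) * k (rebase s x)" for x y by (simp add: K_def)
    ultimately show ?thesis by simp
  qed
  have f1: "integrable (pareto \<alpha>) (\<lambda>y. f (\<delta> * y * r))"
    if [measurable]: "f \<in> borel_measurable borel" and "\<And>r. 0 \<le> f r" "\<And>r. f r \<le> 1" for f :: "real \<Rightarrow> real" and r
    using that by (intro R.integrable_const_bound[of _ 1]) auto
  have scale: "indicator {a<..} (\<delta> * y * r) = indicat_real {a / (\<delta> * r)<..} y" if "r > 0" for a y r
    using that \<open>\<delta> > 0\<close> by (auto simp: indicator_def field_simps)
  have pw: "(a / (\<delta> * r)) powr (- \<alpha>) = a powr (- \<alpha>) * \<delta> powr \<alpha> * r powr \<alpha>" if "a > 0" "r > 0" for a r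
    using that \<open>\<delta> > 0\<close> by (simp add: powr_divide powr_mult powr_minus field_simps)
  have up: "(\<integral>y. ramp a b (\<delta> * y * r) \<partial>pareto \<alpha>) \<le> a powr (- \<alpha>) * \<delta> powr \<alpha> * r powr \<alpha>"
    if ab: "0 < a" "a < b" and r: "0 \<le> r" for a b r
  proof (cases "r = 0")
    case False
    then have r: "r > 0" using r by simp
    have "(\<integral>y. ramp a b (\<delta> * y * r) \<partial>pareto \<alpha>) \<le> (\<integral>y. indicator {a<..} (\<delta> * y * r) \<partial>pareto \<alpha>)"
      using ab ramp_range ramp_eq_0 by (intro integral_mono f1) (auto simp: indicator_def)
    also have "\<dots> = measure (pareto \<alpha>) {a / (\<delta> * r)<..}"
      by (simp add: scale[OF r])
    also have "\<dots> \<le> (a / (\<delta> * r)) powr (- \<alpha>)"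
      using r ab \<open>\<delta> > 0\<close> by (intro measure_pareto_greaterThan_le index_pos) auto
    finally show ?thesis using pw ab r by simp
  qed (use ab ramp_eq_0[of a b 0] in simp)
  \<comment> \<open>The Pareto tail is exact at thresholds
    \<open>b / (\<delta> * r) \<ge> 1\<close>, which is where \<open>1 \<le> b\<close> and
    \<open>\<delta> * r \<le> 1\<close> enter; for the upper bound an inequality valid at every
    positive threshold was enough.\<close>
  have low: "b powr (- \<alpha>) * \<delta> powr \<alpha> * r powr \<alpha> \<le> (\<integral>y. ramp a b (\<delta> * y * r) \<partial>pareto \<alpha>)"
    if ab: "0 < a" "a < b" "1 \<le> b" and r: "0 \<le> r" "\<delta> * r \<le> 1" for a b r
  proof (cases "r = 0")
    case False
    then have r0: "r > 0" using r by simp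
    have "b powr (- \<alpha>) * \<delta> powr \<alpha> * r powr \<alpha> = (b / (\<delta> * r)) powr (- \<alpha>)"
      using pw ab r0 by simp
    also have "\<dots> = measure (pareto \<alpha>) {b / (\<delta> * r)<..}"
      using r0 r ab \<open>\<delta> > 0\<close> by (intro measure_pareto_greaterThan[symmetric] index_pos) (auto simp: pos_le_divide_eq)
    also have "\<dots> = (\<integral>y. indicator {b<..} (\<delta> * y * r) \<partial>pareto \<alpha>)"
      by (simp add: scale[OF r0])
    also have "\<dots> \<le> (\<integral>y. ramp a b (\<delta> * y * r) \<partial>pareto \<alpha>)"
      using ab ramp_range ramp_eq_1 by (intro integral_mono f1) (auto simp: indicator_def)
    finally show ?thesis .
  qed (use index_pos in \<open>auto intro!: Bochner_Integration.integral_nonneg simp: ramp_range\<close>)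
  have bint: "integrable Q (\<lambda>x. (\<integral>y. ramp a b (\<delta> * y * \<rho> (x s)) \<partial>pareto \<alpha>) * k (rebase s x))" for a b
  proof -
    have "integrable ?N (K (ramp a b))"
      using Kb[of "ramp a b"] ramp_range
      by (intro finite_measure_integrable_bounded[OF PQ.P.finite_measure_axioms sN, of _ C] Km) auto
    then have "integrable ?N (case_prod (\<lambda>y x. K (ramp a b) (y, x)))" by simp
    from PQ.integrable_snd[OF this] show ?thesis by (simp add: K_def)
  qed
  have upI: "(\<integral>z. K (ramp a b) z \<partial>?N) \<le> a powr (- \<alpha>) * (\<delta> powr \<alpha> * I)" if ab: "0 < a" "a < b" for a b
  proof -
    have "(\<integral>z. K (ramp a b) z \<partial>?N) \<le> (\<integral>x. (a powr (- \<alpha>) * \<delta> powr \<alpha>) * (\<rho> (x s) powr \<alpha> * k (rebase s x)) \<partial>Q)"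
    proof (subst inner)
      show "(\<integral>x. (\<integral>y. ramp a b (\<delta> * y * \<rho> (x s)) \<partial>pareto \<alpha>) * k (rebase s x) \<partial>Q) \<le>
        (\<integral>x. (a powr (- \<alpha>) * \<delta> powr \<alpha>) * (\<rho> (x s) powr \<alpha> * k (rebase s x)) \<partial>Q)"
      proof (rule integral_mono)
        show "(\<integral>y. ramp a b (\<delta> * y * \<rho> (x s)) \<partial>pareto \<alpha>) * k (rebase s x) \<le>
            (a powr (- \<alpha>) * \<delta> powr \<alpha>) * (\<rho> (x s) powr \<alpha> * k (rebase s x))" for x
          using mult_right_mono[OF up[OF ab modulus_nonneg, of "x s"] k(1), of "rebase s x"]
          by (simp only: mult.assoc)
      qed (use bint int in auto)
    qed (auto simp: ramp_range)
    then show ?thesis by (simp add: I_def mult.assoc)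
  qed
  have lowI: "b powr (- \<alpha>) * (\<delta> powr \<alpha> * I) \<le> (\<integral>z. K (ramp a b) z \<partial>?N)" if ab: "0 < a" "a < b" "1 \<le> b" for a b
  proof -
    have "(\<integral>x. (b powr (- \<alpha>) * \<delta> powr \<alpha>) * (\<rho> (x s) powr \<alpha> * k (rebase s x)) \<partial>Q) \<le> (\<integral>z. K (ramp a b) z \<partial>?N)"
    proof (subst inner)
      show "(\<integral>x. (b powr (- \<alpha>) * \<delta> powr \<alpha>) * (\<rho> (x s) powr \<alpha> * k (rebase s x)) \<partial>Q) \<le>
        (\<integral>x. (\<integral>y. ramp a b (\<delta> * y * \<rho> (x s)) \<partial>pareto \<alpha>) * k (rebase s x) \<partial>Q)"
      proof (rule integral_mono_AE)
        show "AE x in Q. (b powr (- \<alpha>) * \<delta> powr \<alpha>) * (\<rho> (x s) powr \<alpha> * k (rebase s x)) \<le>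
          (\<integral>y. ramp a b (\<delta> * y * \<rho> (x s)) \<partial>pareto \<alpha>) * k (rebase s x)"
          using AEb
        proof eventually_elim
          case (elim x)
          \<comment> \<open>Where \<open>k\<close> of the rebased path vanishes both sides are 0;
            elsewhere \<open>\<delta> * \<rho> (x s) \<le> 1\<close> makes \<open>low\<close>
            applicable.\<close>
          then show ?case
            using mult_right_mono[OF low[OF ab modulus_nonneg, of "x s"] k(1), of "rebase s x"]
            by (cases "k (rebase s x) = 0") (simp_all only: mult.assoc, simp_all)
        qed
      qed (use bint int in auto)
    qed (auto simp: ramp_range)
    then show ?thesis by (simp add: I_def mult.assoc)
  qed
  have Kconv: "((\<lambda>v. \<integral>z. K (ramp a b) z \<partial>polar_law v) \<longlongrightarrow> (\<integral>z. K (ramp a b) z \<partial>?N)) at_top"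
    if ab: "0 < a" "a < b" for a b
  proof -
    have Kc: "continuous_on UNIV (K (ramp a b))"
      unfolding K_def by (rule continuous_on_ramp_rebase[OF kc ab])
    have "bounded (range (K (ramp a b)))"
      using Kb[of "ramp a b", OF ramp_range] by (auto simp: bounded_iff intro!: exI[of _ C])
    with Kc have "((\<lambda>v. \<integral>z. K (ramp a b) z \<partial>distr (polar_law v) borel (\<lambda>z. (fst z, mask {0..} (snd z)))) \<longlongrightarrow>
        (\<integral>z. K (ramp a b) z \<partial>?N)) at_top"
      using polar_conv_of_spectral_conv[OF rv pQ sQ conv] unfolding converges_weakly_in_euclidean_iff by blast
    moreover have "(\<lambda>z. (fst z, mask {0..} (snd z))) \<in> borel \<rightarrow>\<^sub>M (borel :: (real \<times> (int \<Rightarrow> 's)) measure)"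
      by (intro borel_measurable_Pair) measurable
    then have "(\<integral>z. K (ramp a b) z \<partial>distr (polar_law v) borel (\<lambda>z. (fst z, mask {0..} (snd z)))) =
        (\<integral>z. K (ramp a b) (fst z, mask {0..} (snd z)) \<partial>polar_law v)" for v
      by (intro integral_distr Km) auto
    \<comment> \<open>Only forward coordinates are read: \<open>k\<close> depends on times from
      \<open>- s\<close> on, which rebasing takes from times from 0 on, and the ramp depends on the
      coordinate \<open>s \<ge> 0\<close>.\<close>
    moreover have "K f (fst z, mask {0..} (snd z)) = K f z" for f z
      using mask_rebase[OF \<open>s \<ge> 0\<close>, of "snd z"] km[of "rebase s (mask {0..} (snd z))"] km[of "rebase s (snd z)"] \<open>s \<ge> 0\<close>
      by (simp add: K_def mask_apply)
    ultimately show ?thesis by simp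
  qed
  have lim: "((\<lambda>v. \<integral>z. K (indicator {1<..}) z \<partial>polar_law v) \<longlongrightarrow> \<delta> powr \<alpha> * I) at_top"
  proof (rule tendsto_sandwich_approx)
    fix e :: real assume "e > 0"
    define J where "J = \<delta> powr \<alpha> * I"
    have t1: "((\<lambda>\<eta>. (1 + \<eta>) powr (- \<alpha>) * J) \<longlongrightarrow> J) (at_right 0)"
      and t2: "((\<lambda>\<eta>. (1 - \<eta>) powr (- \<alpha>) * J) \<longlongrightarrow> J) (at_right 0)"
      by (auto intro!: tendsto_eq_intros)
    have "\<forall>\<^sub>F \<eta> in at_right 0. J - e < (1 + \<eta>) powr (- \<alpha>) * J"
      "\<forall>\<^sub>F \<eta> in at_right 0. (1 - \<eta>) powr (- \<alpha>) * J < J + e"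
      "\<forall>\<^sub>F \<eta> in at_right 0. \<eta> < (1::real)" "\<forall>\<^sub>F \<eta>::real in at_right 0. 0 < \<eta>"
      using order_tendstoD(1)[OF t1] order_tendstoD(2)[OF t2] \<open>e > 0\<close>
      by (auto simp: eventually_at_right_less intro: eventually_at_right_real eventually_at_rightI)
    then have "\<forall>\<^sub>F \<eta> in at_right 0. J - e < (1 + \<eta>) powr (- \<alpha>) * J \<and>
        (1 - \<eta>) powr (- \<alpha>) * J < J + e \<and> \<eta> < 1 \<and> 0 < \<eta>"
      by (intro eventually_conj)
    then obtain \<eta> where \<eta>: "J - e < (1 + \<eta>) powr (- \<alpha>) * J" "(1 - \<eta>) powr (- \<alpha>) * J < J + e" "\<eta> < 1" "0 < \<eta>"
      using eventually_happens[of _ "at_right (0::real)"] by (auto simp: trivial_limit_at_right_real)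
    have Ki: "integrable (polar_law v) (K f)"
      if "f \<in> borel_measurable borel" "\<And>r. 0 \<le> f r" "\<And>r. f r \<le> 1" for v f
      using Kb[of f] that
      by (intro finite_measure_integrable_bounded[OF finite_measure_polar_law sets_polar_law, of _ C] Km) auto
    have mono: "(\<integral>z. K f z \<partial>polar_law v) \<le> (\<integral>z. K g z \<partial>polar_law v)"
      if "\<And>r. 0 \<le> f r" "\<And>r. f r \<le> g r" "\<And>r. g r \<le> 1" "f \<in> borel_measurable borel" "g \<in> borel_measurable borel" for f g v
      using that order_trans[OF that(1,2)] order_trans[OF that(2,3)] k(1)
      by (intro integral_mono Ki) (auto simp: K_def intro: mult_right_mono)
    have "ramp 1 (1 + \<eta>) r \<le> indicator {1<..} r" "indicator {1<..} r \<le> ramp (1 - \<eta>) 1 r" for r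
      using ramp_range ramp_eq_0[of 1 "1 + \<eta>" r] ramp_eq_1[of "1 - \<eta>" 1 r] \<eta> by (auto simp: indicator_def)
    then have "\<forall>\<^sub>F v in at_top. (\<integral>z. K (ramp 1 (1 + \<eta>)) z \<partial>polar_law v) \<le> (\<integral>z. K (indicator {1<..}) z \<partial>polar_law v) \<and>
        (\<integral>z. K (indicator {1<..}) z \<partial>polar_law v) \<le> (\<integral>z. K (ramp (1 - \<eta>) 1) z \<partial>polar_law v)"
      by (intro always_eventually allI conjI mono) (auto simp: ramp_range)
    moreover have "J - e \<le> (\<integral>z. K (ramp 1 (1 + \<eta>)) z \<partial>?N)"
      using lowI[of 1 "1 + \<eta>"] \<eta> by (simp add: J_def)
    moreover have "(\<integral>z. K (ramp (1 - \<eta>) 1) z \<partial>?N) \<le> J + e"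
      using upI[of "1 - \<eta>" 1] \<eta> by (simp add: J_def)
    ultimately show "\<exists>lo hi a b. (lo \<longlongrightarrow> a) at_top \<and> (hi \<longlongrightarrow> b) at_top \<and>
        (\<forall>\<^sub>F v in at_top. lo v \<le> (\<integral>z. K (indicator {1<..}) z \<partial>polar_law v) \<and> (\<integral>z. K (indicator {1<..}) z \<partial>polar_law v) \<le> hi v) \<and>
        \<delta> powr \<alpha> * I - e \<le> a \<and> b \<le> \<delta> powr \<alpha> * I + e"
      using Kconv[of 1 "1 + \<eta>"] Kconv[of "1 - \<eta>" 1] \<eta> unfolding J_def by fastforce
  qed
  have "filterlim (\<lambda>u. \<delta> * u) at_top at_top"
    using \<open>\<delta> > 0\<close> by (intro filterlim_tendsto_pos_mult_at_top[OF tendsto_const]) (auto simp: filterlim_ident)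
  from filterlim_compose[OF lim this]
  have 1: "((\<lambda>u. \<integral>z. K (indicator {1<..}) z \<partial>polar_law (\<delta> * u)) \<longlongrightarrow> \<delta> powr \<alpha> * I) at_top" .
  have 2: "((\<lambda>u. tail (\<delta> * u) / tail u) \<longlongrightarrow> \<delta> powr (- \<alpha>)) at_top"
    using rv \<open>\<delta> > 0\<close> by (simp add: regularly_varying_def)
  have 3: "\<forall>\<^sub>F u in at_top. tail (\<delta> * u) / tail u * (\<integral>z. K (indicator {1<..}) z \<partial>polar_law (\<delta> * u)) =
      (\<integral>z. k (snd z) \<partial>polar_law u)"
    using integral_polar_law_shift[OF _ \<open>\<delta> > 0\<close> \<open>k \<in> borel_measurable borel\<close> k0]
    by (intro eventually_mono[OF eventually_gt_at_top[of "0::real"]]) (simp add: K_def)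
  have "\<delta> powr (- \<alpha>) * (\<delta> powr \<alpha> * I) = I"
    using \<open>\<delta> > 0\<close> by (simp add: powr_minus field_simps)
  with Lim_transform_eventually[OF tendsto_mult[OF 2 1] 3]
  have "((\<lambda>u. \<integral>z. k (snd z) \<partial>polar_law u) \<longlongrightarrow> I) at_top" by (simp only:)
  then show "((\<lambda>u. \<integral>z. k (snd z) \<partial>polar_law u) \<longlongrightarrow> (\<integral>x. k x \<partial>tilt s Q)) at_top"
    by (simp add: I)
qed

text \<open>A continuous approximation, as \<delta> decreases to 0, of the indicator that the
  coordinate at \<open>- s\<close> is not the origin. It vanishes for moduli up to \<delta>, the
  condition under which the time change limit is available.\<close>

definition cutoff :: "int \<Rightarrow> real \<Rightarrow> (int \<Rightarrow> 's) \<Rightarrow> real" where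
  "cutoff s \<delta> x = ramp \<delta> (2 * \<delta>) (\<rho> (x (- s)))"

lemma continuous_on_cutoff [continuous_intros]: "\<delta> > 0 \<Longrightarrow> continuous_on S (cutoff s \<delta>)"
  unfolding cutoff_def by (intro continuous_intros continuous_on_coordinate) auto

lemma cutoff_measurable [measurable]: "cutoff s \<delta> \<in> borel_measurable borel"
  unfolding cutoff_def ramp_def by measurable

lemma cutoff_range: "0 \<le> cutoff s \<delta> x" "cutoff s \<delta> x \<le> 1"
  by (simp_all add: cutoff_def ramp_range)

lemma cutoff_eq_0: "\<delta> > 0 \<Longrightarrow> \<rho> (x (- s)) \<le> \<delta> \<Longrightarrow> cutoff s \<delta> x = 0"
  by (simp add: cutoff_def ramp_eq_0)

lemma cutoff_eq_1: "\<delta> > 0 \<Longrightarrow> 2 * \<delta> \<le> \<rho> (x (- s)) \<Longrightarrow> cutoff s \<delta> x = 1"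
  by (simp add: cutoff_def ramp_eq_1)

lemma cutoff_mask: "cutoff s \<delta> (mask {- s..} x) = cutoff s \<delta> x"
  by (simp add: cutoff_def mask_apply)

lemma cutoff_tendsto:
  assumes "0 < \<rho> (x (- s))"
  shows "(\<lambda>n. cutoff s (1 / real (Suc n)) x) \<longlonglongrightarrow> 1"
proof -
  have "(\<lambda>n. 2 * (1 / real (Suc n))) \<longlonglongrightarrow> 2 * 0"
    by (intro tendsto_mult tendsto_const LIMSEQ_Suc lim_const_over_n)
  then have "\<forall>\<^sub>F n in sequentially. 2 * (1 / real (Suc n)) < \<rho> (x (- s))"
    using assms by (intro order_tendstoD(2)) auto
  then show ?thesis
    by (intro tendsto_eventually) (auto elim!: eventually_mono intro: cutoff_eq_1)
qed

lemma time_change_cutoff: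
  fixes h :: "(int \<Rightarrow> 's) \<Rightarrow> real"
  assumes Q: "forward_limit Q" and "s \<ge> 0" "\<delta> > 0"
    and h: "continuous_on UNIV h" "\<And>x. 0 \<le> h x" "\<And>x. h x \<le> C" "\<And>x. h (mask {- s..} x) = h x"
  shows "integrable (tilt s Q) (\<lambda>x. cutoff s \<delta> x * h x)"
    and "((\<lambda>u. \<integral>z. cutoff s \<delta> (snd z) * h (snd z) \<partial>polar_law u) \<longlongrightarrow> (\<integral>x. cutoff s \<delta> x * h x \<partial>tilt s Q)) at_top"
proof -
  have "cutoff s \<delta> x * h x \<le> 1 * C" for x
    using cutoff_range h by (intro mult_mono) auto
  then have *: "cutoff s \<delta> x * h x \<le> C" for x by simp
  have **: "continuous_on UNIV (\<lambda>x. cutoff s \<delta> x * h x)" by (intro continuous_intros h \<open>\<delta> > 0\<close>)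
  have 3: "0 \<le> cutoff s \<delta> x * h x" for x using cutoff_range h by auto
  have 4: "cutoff s \<delta> x * h x = 0" if "\<rho> (x (- s)) \<le> \<delta>" for x using cutoff_eq_0[where s = s and x = x, OF \<open>\<delta> > 0\<close> that] by simp
  have 5: "cutoff s \<delta> (mask {- s..} x) * h (mask {- s..} x) = cutoff s \<delta> x * h x" for x
    by (simp add: cutoff_mask h)
  note tc = time_change_limit[where k = "\<lambda>x. cutoff s \<delta> x * h x", OF Q \<open>s \<ge> 0\<close> \<open>\<delta> > 0\<close> ** 3 * 4 5]
  show "integrable (tilt s Q) (\<lambda>x. cutoff s \<delta> x * h x)"
    and "((\<lambda>u. \<integral>z. cutoff s \<delta> (snd z) * h (snd z) \<partial>polar_law u) \<longlongrightarrow> (\<integral>x. cutoff s \<delta> x * h x \<partial>tilt s Q)) at_top"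
    using tc by simp_all
qed

text \<open>The weight removes paths that are the origin at time \<open>s\<close>; for the others
  the rebased coordinate at \<open>- s\<close> has modulus \<open>1 / \<rho> (x s)\<close>, as the
  coordinate 0 has modulus 1.\<close>

lemma AE_tilt:
  assumes Q: "forward_limit Q" shows "AE x in tilt s Q. 0 < \<rho> (x (- s))"
proof -
  have [measurable_cong]: "sets Q = sets borel" using Q by (auto simp: forward_limit_def spectral_law_def)
  have "AE x in Q. 0 < ennreal (\<rho> (x s) powr \<alpha>) \<longrightarrow> 0 < \<rho> (rebase s x (- s))"
    using AE_forward_limit[OF Q]
  proof eventually_elim
    case (elim x)
    show ?case
    proof
      assume "0 < ennreal (\<rho> (x s) powr \<alpha>)"
      then have "\<rho> (x s) \<noteq> 0" by auto
      then show "0 < \<rho> (rebase s x (- s))"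
        using elim modulus_nonneg[of "x s"] by (simp add: modulus_rebase)
    qed
  qed
  then show ?thesis
    unfolding tilt_def by (subst AE_distr_iff) (auto simp: AE_density)
qed

text \<open>Weak convergence alone does not bound the mean of an unbounded weight. Integrals of
  cutoffs are limits of integrals under polar laws, whose mass is at most 1, and by Fatou's lemma
  the bound survives the removal of the cutoff.\<close>

lemma emeasure_tilt_le_1:
  assumes Q: "forward_limit Q" and "s \<ge> 0"
  shows "emeasure (tilt s Q) UNIV \<le> 1"
proof -
  define \<delta> where "\<delta> n = 1 / real (Suc n)" for n
  have \<delta>: "\<delta> n > 0" for n by (simp add: \<delta>_def)
  have "(\<integral>\<^sup>+x. ennreal (cutoff s (\<delta> n) x) \<partial>tilt s Q) \<le> 1" for n
  proof -
    note tc = time_change_cutoff[OF Q \<open>s \<ge> 0\<close> \<delta>[of n], of "\<lambda>_. 1" 1, simplified]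
    have "(\<integral>z. cutoff s (\<delta> n) (snd z) \<partial>polar_law u) \<le> 1" for u
    proof -
      have "(\<integral>z. cutoff s (\<delta> n) (snd z) \<partial>polar_law u) \<le> (\<integral>z. 1 \<partial>polar_law u)"
        using cutoff_range
        by (intro integral_mono finite_measure_integrable_bounded[OF finite_measure_polar_law sets_polar_law, of _ 1])
          (auto simp: abs_le_iff intro: order_trans[of _ 0])
      then show ?thesis
        using measure_polar_law_le_1[of u] sets_eq_imp_space_eq[OF sets_polar_law[of u]] by simp
    qed
    then have "(\<integral>x. cutoff s (\<delta> n) x \<partial>tilt s Q) \<le> 1"
      by (intro tendsto_upperbound[OF tc(2)]) auto
    moreover have "(\<integral>\<^sup>+x. ennreal (cutoff s (\<delta> n) x) \<partial>tilt s Q) = ennreal (\<integral>x. cutoff s (\<delta> n) x \<partial>tilt s Q)"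
      by (rule nn_integral_eq_integral[OF tc(1)]) (simp add: cutoff_range)
    ultimately show ?thesis by (simp add: ennreal_le_1)
  qed
  note le = this
  have "emeasure (tilt s Q) UNIV = (\<integral>\<^sup>+x. 1 \<partial>tilt s Q)" by simp
  also have "\<dots> = (\<integral>\<^sup>+x. liminf (\<lambda>n. ennreal (cutoff s (\<delta> n) x)) \<partial>tilt s Q)"
  proof (rule nn_integral_cong_AE)
    show "AE x in tilt s Q. 1 = liminf (\<lambda>n. ennreal (cutoff s (\<delta> n) x))"
      using AE_tilt[OF Q, of s]
    proof eventually_elim
      case (elim x)
      have "(\<lambda>n. ennreal (cutoff s (\<delta> n) x)) \<longlonglongrightarrow> ennreal 1"
        unfolding \<delta>_def by (intro tendsto_ennrealI cutoff_tendsto elim)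
      then show ?case by (auto dest: lim_imp_Liminf[rotated])
    qed
  qed
  also have "\<dots> \<le> liminf (\<lambda>n. \<integral>\<^sup>+x. ennreal (cutoff s (\<delta> n) x) \<partial>tilt s Q)"
    by (rule nn_integral_liminf) measurable
  also have "\<dots> \<le> liminf (\<lambda>n. 1)"
    by (intro Liminf_mono always_eventually allI le)
  finally show ?thesis by (simp add: Liminf_const)
qed

lemma finite_measure_tilt: "forward_limit Q \<Longrightarrow> s \<ge> 0 \<Longrightarrow> finite_measure (tilt s Q)"
  using emeasure_tilt_le_1[of Q s] by (intro finite_measureI) (auto simp: top_unique)

lemma integral_cutoff_tendsto:
  assumes \<mu>: "finite_measure \<mu>" "sets \<mu> = sets borel"
    and h: "h \<in> borel_measurable borel" "\<And>x. \<bar>h x\<bar> \<le> C"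
  shows "(\<lambda>n. \<integral>x. cutoff s (1 / real (Suc n)) x * h x \<partial>\<mu>) \<longlonglongrightarrow>
    (\<integral>x. indicator {x. 0 < \<rho> (x (- s))} x * h x \<partial>\<mu>)"
proof (rule integral_dominated_convergence[where w="\<lambda>_. C"])
  interpret finite_measure \<mu> by fact
  note [measurable_cong] = \<mu>(2)
  note [measurable] = h(1)
  show "integrable \<mu> (\<lambda>_. C)" by simp
  have [measurable]: "{x. 0 < \<rho> (x (- s))} \<in> sets borel"
    by (intro borel_open open_Collect_less continuous_intros continuous_on_coordinate)
  show "(\<lambda>x. indicator {x. 0 < \<rho> (x (- s))} x * h x) \<in> borel_measurable \<mu>" by measurable
  show "(\<lambda>x. cutoff s (1 / real (Suc n)) x * h x) \<in> borel_measurable \<mu>" for n by measurable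
  show "AE x in \<mu>. (\<lambda>n. cutoff s (1 / real (Suc n)) x * h x) \<longlonglongrightarrow> indicator {x. 0 < \<rho> (x (- s))} x * h x"
  proof (intro AE_I2 tendsto_mult tendsto_const)
    fix x :: "int \<Rightarrow> 's"
    show "(\<lambda>n. cutoff s (1 / real (Suc n)) x) \<longlonglongrightarrow> indicator {x. 0 < \<rho> (x (- s))} x"
    proof (cases "0 < \<rho> (x (- s))")
      case False
      then have "cutoff s (1 / real (Suc n)) x = 0" for n
        by (intro cutoff_eq_0) (auto simp: intro: order_trans[of _ 0])
      then show ?thesis using False by simp
    qed (use cutoff_tendsto in simp)
  qed
  show "AE x in \<mu>. norm (cutoff s (1 / real (Suc n)) x * h x) \<le> C" for n
  proof (intro AE_I2)
    fix x
    have "\<bar>cutoff s (1 / real (Suc n)) x\<bar> * \<bar>h x\<bar> \<le> 1 * C"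
      using cutoff_range h(2) by (intro mult_mono) auto
    then show "norm (cutoff s (1 / real (Suc n)) x * h x) \<le> C" by (simp add: abs_mult)
  qed
qed

text \<open>A tilted law gives no mass to paths that are the origin at \<open>- s\<close>, so here
  the cutoffs recover the full integral, whereas for a general finite measure that part is
  lost.\<close>

lemma integral_cutoff_tilt_tendsto:
  assumes Q: "forward_limit Q" and "s \<ge> 0"
    and h: "h \<in> borel_measurable borel" "\<And>x. \<bar>h x\<bar> \<le> C"
  shows "(\<lambda>n. \<integral>x. cutoff s (1 / real (Suc n)) x * h x \<partial>tilt s Q) \<longlonglongrightarrow> (\<integral>x. h x \<partial>tilt s Q)"
proof -
  have [measurable]: "{x. 0 < \<rho> (x (- s))} \<in> sets borel"
    by (intro borel_open open_Collect_less continuous_intros continuous_on_coordinate)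
  note [measurable] = h(1)
  have "(\<integral>x. indicator {x. 0 < \<rho> (x (- s))} x * h x \<partial>tilt s Q) = (\<integral>x. h x \<partial>tilt s Q)"
    using AE_tilt[OF Q, of s] by (intro integral_cong_AE) auto
  then show ?thesis
    using integral_cutoff_tendsto[OF finite_measure_tilt[OF Q \<open>s \<ge> 0\<close>] sets_tilt h, of s] by simp
qed

end

subsection \<open>Extension to the past\<close>

lemma integral_diff_le:
  fixes f g :: "'a::topological_space \<Rightarrow> real"
  assumes \<mu>: "finite_measure \<mu>" "sets \<mu> = sets borel" "measure \<mu> UNIV \<le> 1"
    and m: "f \<in> borel_measurable borel" "g \<in> borel_measurable borel"
    and b: "\<And>x. \<bar>f x\<bar> \<le> C" "\<And>x. \<bar>g x\<bar> \<le> D" and le: "\<And>x. \<bar>f x - g x\<bar> \<le> e"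
  shows "\<bar>(\<integral>x. f x \<partial>\<mu>) - (\<integral>x. g x \<partial>\<mu>)\<bar> \<le> e"
proof -
  interpret finite_measure \<mu> by fact
  have e: "0 \<le> e" using le[of undefined] by linarith
  have i: "integrable \<mu> f" "integrable \<mu> g"
    using finite_measure_integrable_bounded[OF \<mu>(1,2) m(1) b(1)]
      finite_measure_integrable_bounded[OF \<mu>(1,2) m(2) b(2)] .
  then have "\<bar>(\<integral>x. f x \<partial>\<mu>) - (\<integral>x. g x \<partial>\<mu>)\<bar> = \<bar>\<integral>x. f x - g x \<partial>\<mu>\<bar>" by simp
  also have "\<dots> \<le> (\<integral>x. \<bar>f x - g x\<bar> \<partial>\<mu>)" by (rule integral_abs_bound)
  also have "\<dots> \<le> (\<integral>x. e \<partial>\<mu>)" using i le by (intro integral_mono) auto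
  also have "\<dots> \<le> e"
    using mult_right_mono[OF \<mu>(3) e] sets_eq_imp_space_eq[OF \<mu>(2)] by simp
  finally show ?thesis .
qed

context star_space
begin

text \<open>The product metric is at most twice the maximal distance over the first coordinates of
  an enumeration plus \<open>(1/2)^N\<close>; this is the origin of the factor 2, and the remainder
  tends to 0.\<close>

lemma dist_mask_insert:
  assumes "S = insert t T" "t \<notin> T"
  shows "dist (mask S x) (mask T x) \<le> 2 * dist (x t) orig"
proof -
  have "dist (mask S x) (mask T x) - 2 * dist (x t) orig \<le> (1/2)^N" for N
  proof -
    have "Max {dist (mask S x (from_nat n)) (mask T x (from_nat n)) |n. n \<le> N} \<le> dist (x t) orig"
      using assms by (intro Max.boundedI) (auto simp: mask_def)
    then show ?thesis using dist_fun_le_dist_first_terms[of "mask S x" "mask T x" N] by linarith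
  qed
  moreover have "(\<lambda>N. (1/2)^N :: real) \<longlonglongrightarrow> 0" by (intro LIMSEQ_power_zero) auto
  ultimately have "dist (mask S x) (mask T x) - 2 * dist (x t) orig \<le> 0"
    by (intro LIMSEQ_le_const) auto
  then show ?thesis by simp
qed

text \<open>The product metric discounts coordinates in the order of an enumeration of the integers.
  A window that contains the first indices of this enumeration leaves a distance of at most
  \<open>(1/2)^N\<close>, uniformly in the path.\<close>

lemma dist_mask_past:
  obtains n :: nat where "\<And>x. dist x (mask {- int n..} x) \<le> (1/2)^N"
proof -
  define n where "n = nat (Max ((\<lambda>j. - from_nat j) ` {..N}))"
  have n: "(from_nat j :: int) \<in> {- int n..}" if "j \<le> N" for j
  proof -
    have "- from_nat j \<le> Max ((\<lambda>j. - from_nat j :: int) ` {..N})" using that by (intro Max_ge) auto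
    moreover have "Max ((\<lambda>j. - from_nat j :: int) ` {..N}) \<le> int n"
      unfolding n_def by linarith
    ultimately have "- from_nat j \<le> int n" by (rule order_trans)
    then show ?thesis by simp
  qed
  have "dist x (mask {- int n..} x) \<le> (1/2)^N" for x
  proof -
    have "Max {dist (x (from_nat j)) (mask {- int n..} x (from_nat j)) |j. j \<le> N} \<le> 0"
      using n by (intro Max.boundedI) (auto simp: mask_apply)
    then show ?thesis using dist_fun_le_dist_first_terms[of x "mask {- int n..} x" N] by linarith
  qed
  then show thesis by (rule that)
qed

end

section \<open>Limit laws on the windows and their projective limit\<close>

context stationary_series
begin

lemma spectral_lawD:
  fixes h :: "(int \<Rightarrow> 's) \<Rightarrow> real"
  assumes "spectral_law T Q" and h: "continuous_on UNIV h" "\<And>x. \<bar>h x\<bar> \<le> C"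
  shows "((\<lambda>u. \<integral>z. h (mask T (snd z)) \<partial>polar_law u) \<longlongrightarrow> (\<integral>x. h x \<partial>Q)) at_top"
proof -
  have "bounded (range h)" using h(2) by (auto simp: bounded_iff intro!: exI[of _ C])
  moreover have [measurable]: "h \<in> borel_measurable borel" by (rule borel_measurable_continuous_onI[OF h(1)])
  have "(\<integral>z. h z \<partial>distr (polar_law u) borel (\<lambda>z. mask T (snd z))) =
      (\<integral>z. h (mask T (snd z)) \<partial>polar_law u)" for u
    by (rule integral_distr) measurable
  ultimately show ?thesis
    using assms(1) h(1) unfolding spectral_law_def converges_weakly_in_euclidean_iff by auto
qed

lemma past_limit_0: "forward_limit Q \<Longrightarrow> spectral_law {- int 0..} Q"
  by (simp add: forward_limit_def)

text \<open>Both measures are limits of the same polar laws under the smaller mask, and weak limits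
  are unique.\<close>

lemma past_limit_consistent:
  assumes "spectral_law {- int n..} Q" "spectral_law {- int m..} Q'" "n \<le> m"
  shows "distr Q' borel (mask {- int n..}) = Q"
proof (rule measure_eq_of_integral_eq)
  have s[measurable_cong]: "sets Q' = sets borel" and "sets Q = sets borel" and p: "prob_space Q'" "prob_space Q"
    using assms by (auto simp: spectral_law_def)
  then show "finite_measure (distr Q' borel (mask {- int n..}))" "finite_measure Q" "sets Q = sets borel"
    by (auto intro!: prob_space.finite_measure prob_space.prob_space_distr)
  fix h :: "(int \<Rightarrow> 's) \<Rightarrow> real" assume h: "continuous_on UNIV h" "\<And>x. 0 \<le> h x" "\<And>x. h x \<le> 1"
  then have b: "\<bar>h x\<bar> \<le> 1" for x by simp
  have [measurable]: "h \<in> borel_measurable borel" by (rule borel_measurable_continuous_onI[OF h(1)])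
  have "continuous_on UNIV (\<lambda>x. h (mask {- int n..} x))"
    by (rule continuous_on_compose2[OF h(1) continuous_on_mask]) auto
  from spectral_lawD[OF assms(2) this b]
  have "((\<lambda>u. \<integral>z. h (mask {- int n..} (snd z)) \<partial>polar_law u) \<longlongrightarrow> (\<integral>x. h (mask {- int n..} x) \<partial>Q')) at_top"
    using \<open>n \<le> m\<close> by (simp add: mask_mask Int_absorb2)
  with spectral_lawD[OF assms(1) h(1) b] have "(\<integral>x. h (mask {- int n..} x) \<partial>Q') = (\<integral>x. h x \<partial>Q)"
    using tendsto_unique trivial_limit_at_top_linorder by blast
  then show "(\<integral>x. h x \<partial>distr Q' borel (mask {- int n..})) = (\<integral>x. h x \<partial>Q)"
    by (subst integral_distr) auto
qed simp

text \<open>One more past coordinate: where it is not the origin, the limit is dictated by the time change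
  formula; where it is the origin, the limit is what remains of the previous one. That this remainder
  is a positive measure follows from the positivity of the prelimit.\<close>

lemma past_limit_Suc:
  assumes Q: "forward_limit Q" and Q': "spectral_law {- int n..} Q'"
  obtains Q'' where "spectral_law {- int (Suc n)..} Q''"
proof -
  define s where "s = int (Suc n)"
  have s: "s \<ge> 0" "{- s..} = insert (- s) {- int n..}" "- s \<notin> {- int n..}" by (auto simp: s_def)
  let ?\<pi> = "mask {- s..}" and ?\<pi>' = "mask {- int n..}" and ?\<kappa> = "tilt s Q"
  interpret \<kappa>: finite_measure ?\<kappa> by (rule finite_measure_tilt[OF Q s(1)])
  have sQ': "sets Q' = sets borel" and pQ': "prob_space Q'" using Q' by (auto simp: spectral_law_def)
  interpret Q': prob_space Q' by fact
  have fin: "finite_measure (distr ?\<kappa> borel f)" if "f \<in> borel \<rightarrow>\<^sub>M borel" for f :: "(int \<Rightarrow> 's) \<Rightarrow> int \<Rightarrow> 's"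
    using that by (intro \<kappa>.finite_measure_distr) auto
  have c\<pi>: "continuous_on UNIV (\<lambda>x. h (?\<pi> x))" "continuous_on UNIV (\<lambda>x. h (?\<pi>' x))"
    if "continuous_on UNIV h" for h :: "(int \<Rightarrow> 's) \<Rightarrow> real"
    by (rule continuous_on_compose2[OF that continuous_on_mask]; simp)+
  have mm: "?\<pi> (?\<pi> x) = ?\<pi> x" "?\<pi>' (?\<pi> x) = ?\<pi>' x" for x
    by (simp_all add: mask_mask s(2) Int_absorb2 subset_insertI)
  \<comment> \<open>Before the limit, multiplying \<open>h\<close> by a cutoff can only decrease its
    integral. The inequality persists as \<open>u\<close> tends to infinity and then as the cutoff
    is removed.\<close>
  have le: "emeasure (distr ?\<kappa> borel ?\<pi>') A \<le> emeasure Q' A" if "A \<in> sets borel" for A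
  proof (rule emeasure_le_of_integral_le[OF fin _ _ sQ' _ that])
    fix h :: "(int \<Rightarrow> 's) \<Rightarrow> real" assume h: "continuous_on UNIV h" "\<And>x. 0 \<le> h x" "\<And>x. h x \<le> 1"
    then have b: "\<bar>h x\<bar> \<le> 1" for x by simp
    have [measurable]: "h \<in> borel_measurable borel" by (rule borel_measurable_continuous_onI[OF h(1)])
    have "(\<integral>x. cutoff s (1 / real (Suc j)) x * h (?\<pi>' x) \<partial>?\<kappa>) \<le> (\<integral>x. h x \<partial>Q')" for j
    proof (rule tendsto_le[OF _ spectral_lawD[OF Q' h(1) b]])
      show "((\<lambda>u. \<integral>z. cutoff s (1 / real (Suc j)) (snd z) * h (?\<pi>' (snd z)) \<partial>polar_law u) \<longlongrightarrow>
          (\<integral>x. cutoff s (1 / real (Suc j)) x * h (?\<pi>' x) \<partial>?\<kappa>)) at_top"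
        by (rule time_change_cutoff(2)[OF Q s(1) _ c\<pi>(2)[OF h(1)] h(2,3)]) (simp_all add: mm)
      have i: "0 \<le> cutoff s (1 / real (Suc j)) x * h y" "cutoff s (1 / real (Suc j)) x * h y \<le> h y" for x y
        using cutoff_range h(2) by (auto intro: mult_left_le_one_le)
      have i': "cutoff s (1 / real (Suc j)) x * h y \<le> 1" for x y using i(2)[of x y] h(3)[of y] by linarith
      show "\<forall>\<^sub>F u in at_top. (\<integral>z. cutoff s (1 / real (Suc j)) (snd z) * h (?\<pi>' (snd z)) \<partial>polar_law u) \<le>
          (\<integral>z. h (?\<pi>' (snd z)) \<partial>polar_law u)"
        using i i' b
        by (intro always_eventually allI integral_mono
            finite_measure_integrable_bounded[OF finite_measure_polar_law sets_polar_law, of _ 1]) auto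
    qed simp
    then have "(\<integral>x. h (?\<pi>' x) \<partial>?\<kappa>) \<le> (\<integral>x. h x \<partial>Q')"
      using integral_cutoff_tilt_tendsto[OF Q s(1), of "\<lambda>x. h (?\<pi>' x)" 1] b
      by (intro LIMSEQ_le_const2) auto
    then show "(\<integral>x. h x \<partial>distr ?\<kappa> borel ?\<pi>') \<le> (\<integral>x. h x \<partial>Q')"
      by (subst integral_distr) auto
  qed (auto intro: Q'.finite_measure_axioms)
  obtain m where m: "sets m = sets borel"
    "\<And>A. A \<in> sets borel \<Longrightarrow> emeasure m A = emeasure (distr ?\<kappa> borel ?\<pi>) A + (emeasure Q' A - emeasure (distr ?\<kappa> borel ?\<pi>') A)"
    using measure_splice_exists[of "distr ?\<kappa> borel ?\<pi>'" Q' "distr ?\<kappa> borel ?\<pi>"] sQ' le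
      Q'.finite_measure_axioms fin by auto
  have spm: "space m = UNIV" using sets_eq_imp_space_eq[OF m(1)] by simp
  have spQ': "space Q' = UNIV" using sets_eq_imp_space_eq[OF sQ'] by simp
  \<comment> \<open>Both images of the tilted law have the same total mass, so what is subtracted
    equals what is added.\<close>
  have "emeasure m UNIV = emeasure ?\<kappa> UNIV + (1 - emeasure ?\<kappa> UNIV)"
    using m(2)[of UNIV] Q'.emeasure_space_1 spQ' by (simp add: emeasure_distr)
  also have "\<dots> = 1" by (rule add_diff_inverse_ennreal[OF emeasure_tilt_le_1[OF Q s(1)]])
  finally have pm: "prob_space m" by (intro prob_spaceI) (simp add: spm)
  then interpret m: prob_space m .
  have add: "emeasure m A + emeasure (distr ?\<kappa> borel ?\<pi>') A = emeasure (distr ?\<kappa> borel ?\<pi>) A + emeasure Q' A"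
    if "A \<in> sets borel" for A
    using m(2)[OF that] le[OF that] by (metis add.assoc add.commute add_diff_inverse_ennreal)
  have int_m: "(\<integral>x. h x \<partial>m) + (\<integral>x. h x \<partial>distr ?\<kappa> borel ?\<pi>') =
      (\<integral>x. h x \<partial>distr ?\<kappa> borel ?\<pi>) + (\<integral>x. h x \<partial>Q')"
    if "h \<in> borel_measurable borel" "\<And>x. 0 \<le> h x" "\<And>x. h x \<le> C" for h :: "(int \<Rightarrow> 's) \<Rightarrow> real" and C
    by (rule integral_add_measures[OF m(1) _ _ sQ' m.finite_measure_axioms fin fin Q'.finite_measure_axioms add that]) auto
  have \<kappa>1: "measure ?\<kappa> UNIV \<le> 1"
    using emeasure_tilt_le_1[OF Q s(1)] by (simp add: \<kappa>.emeasure_eq_measure)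
  have "converges_weakly_in euclidean (\<lambda>u. distr (polar_law u) borel (\<lambda>z. ?\<pi> (snd z))) m at_top"
  proof (rule converges_weakly_lipschitzI[OF _ _ m.finite_measure_axioms m(1)])
    show "finite_measure (distr (polar_law u) borel (\<lambda>z. ?\<pi> (snd z)))" for u
      by (intro finite_measure.finite_measure_distr finite_measure_polar_law) measurable
    fix h :: "(int \<Rightarrow> 's) \<Rightarrow> real" and L C
    assume h: "L-lipschitz_on UNIV h" "\<And>x. 0 \<le> h x" "\<And>x. h x \<le> C"
    then have hc: "continuous_on UNIV h" by (intro lipschitz_on_continuous_on)
    have hb: "\<bar>h x\<bar> \<le> C" for x using h(2,3)[of x] by simp
    have L0: "0 \<le> L" using h(1) by (rule lipschitz_on_nonneg)
    have [measurable]: "h \<in> borel_measurable borel" by (rule borel_measurable_continuous_onI[OF hc])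
    have hm: "(\<integral>x. h x \<partial>m) = (\<integral>x. h (?\<pi> x) \<partial>?\<kappa>) + (\<integral>x. h x \<partial>Q') - (\<integral>x. h (?\<pi>' x) \<partial>?\<kappa>)"
    proof -
      have "(\<integral>x. h x \<partial>distr ?\<kappa> borel ?\<pi>) = (\<integral>x. h (?\<pi> x) \<partial>?\<kappa>)"
        "(\<integral>x. h x \<partial>distr ?\<kappa> borel ?\<pi>') = (\<integral>x. h (?\<pi>' x) \<partial>?\<kappa>)"
        by (auto intro!: integral_distr)
      then show ?thesis using int_m[of h C] h by simp
    qed
    have "((\<lambda>u. \<integral>z. h (?\<pi> (snd z)) \<partial>polar_law u) \<longlongrightarrow> (\<integral>x. h x \<partial>m)) at_top"
    proof (rule tendsto_uniform_approx)
      fix e :: real assume "e > 0"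
      \<comment> \<open>The error below is \<open>L\<close> times twice the distance of the new
        coordinate to the origin; the summand 1 covers \<open>L = 0\<close>.\<close>
      have "e / (2 * L + 1) > 0" using \<open>e > 0\<close> L0 by simp
      from modulus_bounded_below[OF this] obtain \<delta>' where \<delta>': "\<delta>' > 0" "\<And>x. \<rho> x \<le> \<delta>' \<Longrightarrow> dist x orig \<le> e / (2 * L + 1)"
        by blast
      \<comment> \<open>The cutoff is known to equal 1 only from modulus \<open>2 * \<delta>\<close>
        on, so halving puts every remaining coordinate below \<open>\<delta>'\<close>.\<close>
      define \<delta> where "\<delta> = \<delta>' / 2"
      have \<delta>: "\<delta> > 0" using \<delta>' by (simp add: \<delta>_def)
      let ?c = "cutoff s \<delta>"
      \<comment> \<open>\<open>h (?\<pi> x)\<close> is replaced by a mixture, with weight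
        \<open>?c x\<close>, of its value with and without the new coordinate. The two values differ
        by at most \<open>e\<close> wherever the weight is below 1, since the new coordinate is then
        close to the origin.\<close>
      have small: "\<bar>h (?\<pi> x) - (?c x * h (?\<pi> x) + h (?\<pi>' x) - ?c x * h (?\<pi>' x))\<bar> \<le> e" for x
      proof (cases "2 * \<delta> \<le> \<rho> (x (- s))")
        case True
        then show ?thesis using cutoff_eq_1[where s = s and x = x, OF \<delta> True] \<open>e > 0\<close> by simp
      next
        case False
        have "\<bar>h (?\<pi> x) - h (?\<pi>' x)\<bar> \<le> L * dist (?\<pi> x) (?\<pi>' x)"
          using lipschitz_onD[OF h(1), of "?\<pi> x" "?\<pi>' x"] by (simp add: dist_real_def)
        also have "\<dots> \<le> L * (2 * dist (x (- s)) orig)"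
          using dist_mask_insert[OF s(2,3)] L0 by (intro mult_left_mono) auto
        also have "\<dots> \<le> L * (2 * (e / (2 * L + 1)))"
          using False \<delta>'(2)[of "x (- s)"] L0 by (intro mult_left_mono) (auto simp: \<delta>_def)
        also have "\<dots> \<le> e" using L0 \<open>e > 0\<close> by (simp add: field_simps)
        finally have *: "\<bar>h (?\<pi> x) - h (?\<pi>' x)\<bar> \<le> e" .
        have "\<bar>h (?\<pi> x) - (?c x * h (?\<pi> x) + h (?\<pi>' x) - ?c x * h (?\<pi>' x))\<bar> = \<bar>1 - ?c x\<bar> * \<bar>h (?\<pi> x) - h (?\<pi>' x)\<bar>"
          by (simp add: abs_mult[symmetric] algebra_simps)
        also have "\<dots> \<le> 1 * e" using cutoff_range[of s \<delta> x] * by (intro mult_mono) auto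
        finally show ?thesis by simp
      qed
      have cb: "\<bar>?c x * h y\<bar> \<le> C" for x y
        using cutoff_range[of s \<delta> x] hb[of y] mult_mono[of "?c x" 1 "\<bar>h y\<bar>" C] by (simp add: abs_mult)
      have approx: "\<bar>(\<integral>x. h (?\<pi> x) \<partial>\<mu>) - ((\<integral>x. ?c x * h (?\<pi> x) \<partial>\<mu>) + (\<integral>x. h (?\<pi>' x) \<partial>\<mu>) - (\<integral>x. ?c x * h (?\<pi>' x) \<partial>\<mu>))\<bar> \<le> e"
        if \<mu>: "finite_measure \<mu>" "sets \<mu> = sets borel" "measure \<mu> UNIV \<le> 1" for \<mu>
      proof -
        note i = finite_measure_integrable_bounded[OF \<mu>(1,2), of _ C]
        have "(\<integral>x. ?c x * h (?\<pi> x) + h (?\<pi>' x) - ?c x * h (?\<pi>' x) \<partial>\<mu>) =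
            (\<integral>x. ?c x * h (?\<pi> x) \<partial>\<mu>) + (\<integral>x. h (?\<pi>' x) \<partial>\<mu>) - (\<integral>x. ?c x * h (?\<pi>' x) \<partial>\<mu>)"
          by (subst Bochner_Integration.integral_diff Bochner_Integration.integral_add;
              (intro Bochner_Integration.integrable_add i)?; (simp add: cb hb)?)+
        moreover have "\<bar>(\<integral>x. h (?\<pi> x) \<partial>\<mu>) - (\<integral>x. ?c x * h (?\<pi> x) + h (?\<pi>' x) - ?c x * h (?\<pi>' x) \<partial>\<mu>)\<bar> \<le> e"
        proof (rule integral_diff_le[OF \<mu> _ _ _ _ small])
          show "\<bar>?c x * h (?\<pi> x) + h (?\<pi>' x) - ?c x * h (?\<pi>' x)\<bar> \<le> 3 * C" for x
            using cb[of x "?\<pi> x"] cb[of x "?\<pi>' x"] hb[of "?\<pi>' x"] by linarith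
        qed (auto intro: hb)
        ultimately show ?thesis by simp
      qed
      define g where "g u = (\<integral>z. ?c (snd z) * h (?\<pi> (snd z)) \<partial>polar_law u) + (\<integral>z. h (?\<pi>' (snd z)) \<partial>polar_law u) -
        (\<integral>z. ?c (snd z) * h (?\<pi>' (snd z)) \<partial>polar_law u)" for u
      define l where "l = (\<integral>x. ?c x * h (?\<pi> x) \<partial>?\<kappa>) + (\<integral>x. h x \<partial>Q') - (\<integral>x. ?c x * h (?\<pi>' x) \<partial>?\<kappa>)"
      \<comment> \<open>The terms with a cutoff converge by the time change limit, the one without
        by the limit on the shorter window.\<close>
      have "(g \<longlongrightarrow> l) at_top"
        unfolding g_def l_def
        by (intro tendsto_add tendsto_diff spectral_lawD[OF Q' hc hb]
            time_change_cutoff(2)[OF Q s(1) \<delta> c\<pi>(1)[OF hc] h(2,3)]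
            time_change_cutoff(2)[OF Q s(1) \<delta> c\<pi>(2)[OF hc] h(2,3)]) (simp_all add: mm)
      moreover have "\<bar>(\<integral>z. h (?\<pi> (snd z)) \<partial>polar_law u) - g u\<bar> \<le> e" for u
      proof -
        let ?\<mu> = "distr (polar_law u) borel snd"
        have e: "(\<integral>x. f x \<partial>?\<mu>) = (\<integral>z. f (snd z) \<partial>polar_law u)" if "f \<in> borel_measurable borel" for f :: "(int \<Rightarrow> 's) \<Rightarrow> real"
          using that by (intro integral_distr) auto
        have "measure ?\<mu> UNIV \<le> 1"
          using measure_polar_law_le_1[of u] sets_eq_imp_space_eq[OF sets_polar_law[of u]]
          by (subst measure_distr) auto
        moreover have "finite_measure ?\<mu>"
          by (intro finite_measure.finite_measure_distr finite_measure_polar_law) measurable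
        ultimately show ?thesis using approx[of ?\<mu>] by (simp add: e g_def)
      qed
      moreover have "\<bar>l - (\<integral>x. h x \<partial>m)\<bar> \<le> e"
        using approx[OF \<kappa>.finite_measure_axioms sets_tilt \<kappa>1] unfolding l_def hm by linarith
      ultimately show "\<exists>g l. (g \<longlongrightarrow> l) at_top \<and>
          (\<forall>\<^sub>F u in at_top. \<bar>(\<integral>z. h (?\<pi> (snd z)) \<partial>polar_law u) - g u\<bar> \<le> e) \<and> \<bar>l - (\<integral>x. h x \<partial>m)\<bar> \<le> e"
        by (auto intro!: exI[of _ g] exI[of _ l])
    qed
    moreover have "(\<integral>x. h x \<partial>distr (polar_law u) borel (\<lambda>z. ?\<pi> (snd z))) = (\<integral>z. h (?\<pi> (snd z)) \<partial>polar_law u)" for u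
      by (rule integral_distr) measurable
    ultimately show "((\<lambda>u. \<integral>x. h x \<partial>distr (polar_law u) borel (\<lambda>z. ?\<pi> (snd z))) \<longlongrightarrow> (\<integral>x. h x \<partial>m)) at_top"
      by simp
  qed simp
  then have "spectral_law {- int (Suc n)..} m" using pm m(1) by (simp add: spectral_law_def s_def)
  then show thesis by (rule that)
qed

text \<open>The marginal over a finite \<open>J\<close> may be read off from any window that
  contains \<open>J\<close>, so the window laws induce a consistent family on finite index sets. The
  windows of the projective limit are identified through their own finite marginals.\<close>

lemma past_limits_extend:
  assumes Qs: "\<And>n. spectral_law {- int n..} (Qs n)"
  obtains Q where "prob_space Q" "sets Q = sets borel" "\<And>n. distr Q borel (mask {- int n..}) = Qs n"
proof -
  let ?PiM = "\<lambda>J. PiM J (\<lambda>_. borel :: 's measure)"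
  have sQ[measurable_cong]: "sets (Qs n) = sets borel" and pQ: "prob_space (Qs n)" for n
    using Qs[of n] by (auto simp: spectral_law_def)
  have rm: "(\<lambda>x. restrict x J) \<in> borel \<rightarrow>\<^sub>M ?PiM J" for J :: "int set"
    by (intro measurable_restrict) measurable
  have rm': "(\<lambda>x. restrict x J) \<in> Qs n \<rightarrow>\<^sub>M ?PiM J" for J n
    using rm by (simp add: measurable_cong_sets[OF sQ refl])
  have mono: "distr (Qs n) (?PiM J) (\<lambda>x. restrict x J) = distr (Qs m) (?PiM J) (\<lambda>x. restrict x J)"
    if "J \<subseteq> {- int n..}" "n \<le> m" for J n m
  proof -
    have "distr (Qs n) (?PiM J) (\<lambda>x. restrict x J) =
        distr (distr (Qs m) borel (mask {- int n..})) (?PiM J) (\<lambda>x. restrict x J)"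
      by (simp add: past_limit_consistent[OF Qs Qs \<open>n \<le> m\<close>])
    also have "\<dots> = distr (Qs m) (?PiM J) ((\<lambda>x. restrict x J) \<circ> mask {- int n..})"
      by (rule distr_distr[OF rm]) measurable
    also have "(\<lambda>x. restrict x J) \<circ> mask {- int n..} = (\<lambda>x. restrict x J)"
      using that(1) by (auto simp: mask_def restrict_def fun_eq_iff)
    finally show ?thesis .
  qed
  \<comment> \<open>A window length that covers \<open>J\<close>; inserting 0 makes the maximum
    meaningful for empty \<open>J\<close>.\<close>
  define N where "N J = nat (Max (insert 0 (uminus ` J)))" for J :: "int set"
  have N: "J \<subseteq> {- int (N J)..}" if "finite J" for J
  proof
    fix j assume "j \<in> J"
    then have "- j \<le> Max (insert 0 (uminus ` J))" using that by (intro Max_ge) auto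
    then show "j \<in> {- int (N J)..}" by (auto simp: N_def)
  qed
  define P where "P J = distr (Qs (N J)) (?PiM J) (\<lambda>x. restrict x J)" for J
  have P_eq: "P J = distr (Qs n) (?PiM J) (\<lambda>x. restrict x J)" if "finite J" "J \<subseteq> {- int n..}" for J n
    unfolding P_def using mono[OF N[OF that(1)], of "max n (N J)"] mono[OF that(2), of "max n (N J)"] by simp
  interpret polish_projective UNIV P
  proof (intro polish_projective.intro projective_family.intro)
    fix J H :: "int set" assume JH: "J \<subseteq> H" "finite H"
    have "distr (P H) (?PiM J) (\<lambda>f. restrict f J) = distr (Qs (N H)) (?PiM J) ((\<lambda>f. restrict f J) \<circ> (\<lambda>x. restrict x H))"
      unfolding P_def by (rule distr_distr[OF measurable_restrict_subset[OF JH(1)] rm'])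
    also have "(\<lambda>f. restrict f J) \<circ> (\<lambda>x. restrict x H) = (\<lambda>x::int \<Rightarrow> 's. restrict x J)"
      using JH(1) by (auto simp: restrict_def fun_eq_iff)
    also have "distr (Qs (N H)) (?PiM J) (\<lambda>x. restrict x J) = P J"
      using JH N[OF JH(2)] by (intro P_eq[symmetric]) (auto intro: finite_subset)
    finally show "P J = distr (P H) (?PiM J) (\<lambda>f. restrict f J)" ..
  next
    fix J :: "int set" assume "finite J"
    then show "prob_space (P J)"
      unfolding P_def by (intro prob_space.prob_space_distr pQ rm')
  qed
  have sl: "sets lim = sets borel" by (simp add: sets_PiM_equal_borel)
  have lrm: "(\<lambda>x. restrict x T) \<in> lim \<rightarrow>\<^sub>M ?PiM T" for T
    using rm by (simp add: measurable_cong_sets[OF sl refl])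
  have "distr lim borel (mask {- int n..}) = Qs n" for n
  proof -
    let ?T = "{- int n..}"
    have eq: "distr lim (?PiM ?T) (\<lambda>x. restrict x ?T) = distr (Qs n) (?PiM ?T) (\<lambda>x. restrict x ?T)"
    proof (rule measure_eqI_PiM_infinite[where I = ?T and M = "\<lambda>_. borel"])
      show "finite_measure (distr lim (?PiM ?T) (\<lambda>x. restrict x ?T))"
        by (intro prob_space.finite_measure P.prob_space_distr lrm)
      fix A :: "int \<Rightarrow> 's set" and J assume J: "finite J" "J \<subseteq> ?T" "\<And>i. i \<in> J \<Longrightarrow> A i \<in> sets borel"
      let ?E = "prod_emb ?T (\<lambda>_. borel) J (Pi\<^sub>E J A)"
      have E: "?E \<in> sets (?PiM ?T)" using J by (intro sets_PiM_I) auto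
      have B: "Pi\<^sub>E J A \<in> sets (?PiM J)" using J by (intro sets_PiM_I_finite) auto
      have pre: "(\<lambda>x. restrict x ?T) -` ?E = (\<lambda>x. restrict x J) -` (Pi\<^sub>E J A)"
        using J(2) by (auto simp: prod_emb_def Int_absorb1)
      have "emeasure (distr lim (?PiM ?T) (\<lambda>x. restrict x ?T)) ?E = emeasure lim (emb UNIV J (Pi\<^sub>E J A))"
        unfolding emeasure_distr[OF lrm E] pre by (simp add: prod_emb_def space_PiM)
      also have "\<dots> = emeasure (P J) (Pi\<^sub>E J A)"
        using J B by (intro emeasure_lim_emb) auto
      also have "\<dots> = emeasure (Qs n) ((\<lambda>x. restrict x J) -` (Pi\<^sub>E J A) \<inter> space (Qs n))"
        unfolding P_eq[OF J(1,2)] by (rule emeasure_distr[OF rm' B])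
      also have "\<dots> = emeasure (distr (Qs n) (?PiM ?T) (\<lambda>x. restrict x ?T)) ?E"
        unfolding emeasure_distr[OF rm' E] pre ..
      finally show "emeasure (distr lim (?PiM ?T) (\<lambda>x. restrict x ?T)) ?E =
          emeasure (distr (Qs n) (?PiM ?T) (\<lambda>x. restrict x ?T)) ?E" .
    qed simp_all
    have *: "distr (distr m (?PiM ?T) (\<lambda>x. restrict x ?T)) borel (mask ?T) = distr m borel (mask ?T)"
      if "(\<lambda>x. restrict x ?T) \<in> m \<rightarrow>\<^sub>M ?PiM ?T" for m :: "(int \<Rightarrow> 's) measure"
      by (subst distr_distr[OF mask_measurable_PiM that]) (simp add: comp_def mask_restrict)
    show ?thesis
      using arg_cong[OF eq, of "\<lambda>m. distr m borel (mask ?T)"] past_limit_consistent[OF Qs Qs order_refl, of n]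
      unfolding *[OF lrm] *[OF rm'] by simp
  qed
  then show thesis using P.prob_space_axioms sl by (rule that[rotated 2])
qed

text \<open>Truncating a Lipschitz test function to a suitable window costs at most
  \<open>L * (1/2)^N\<close>, uniformly over the prelimit and the limit, so convergence on every
  window gives convergence on the full index set.\<close>

lemma backward_extension:
  assumes Q: "forward_limit Q"
  obtains Q' where "spectral_law UNIV Q'"
proof -
  have "\<exists>Q'. spectral_law {- int n..} Q'" for n
  proof (induction n)
    case 0
    then show ?case using past_limit_0[OF Q] by blast
  next
    case (Suc n)
    then show ?case using past_limit_Suc[OF Q] by blast
  qed
  then obtain Qs where Qs: "\<And>n. spectral_law {- int n..} (Qs n)" by metis
  obtain Q' where Q': "prob_space Q'" "sets Q' = sets borel" "\<And>n. distr Q' borel (mask {- int n..}) = Qs n"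
    using past_limits_extend[OF Qs] by blast
  interpret Q': prob_space Q' by fact
  note [measurable_cong] = Q'(2)
  have "converges_weakly_in euclidean (\<lambda>u. distr (polar_law u) borel (\<lambda>z. mask UNIV (snd z))) Q' at_top"
  proof (rule converges_weakly_lipschitzI[OF _ _ Q'.finite_measure_axioms Q'(2)])
    show "finite_measure (distr (polar_law u) borel (\<lambda>z. mask UNIV (snd z)))" for u
      by (intro finite_measure.finite_measure_distr finite_measure_polar_law) measurable
    fix h :: "(int \<Rightarrow> 's) \<Rightarrow> real" and L C
    assume h: "L-lipschitz_on UNIV h" "\<And>x. 0 \<le> h x" "\<And>x. h x \<le> C"
    then have hc: "continuous_on UNIV h" by (intro lipschitz_on_continuous_on)
    have hb: "\<bar>h x\<bar> \<le> C" for x using h(2,3)[of x] by simp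
    have L0: "0 \<le> L" using h(1) by (rule lipschitz_on_nonneg)
    have [measurable]: "h \<in> borel_measurable borel" by (rule borel_measurable_continuous_onI[OF hc])
    let ?\<mu> = "\<lambda>u. distr (polar_law u) borel (\<lambda>z. mask UNIV (snd z))"
    show "((\<lambda>u. \<integral>x. h x \<partial>?\<mu> u) \<longlongrightarrow> (\<integral>x. h x \<partial>Q')) at_top"
    proof (rule tendsto_uniform_approx)
      fix e :: real assume "e > 0"
      have "(\<lambda>N. L * (1/2)^N) \<longlonglongrightarrow> L * 0"
        by (intro tendsto_mult tendsto_const LIMSEQ_power_zero) auto
      then have "\<forall>\<^sub>F N in sequentially. L * (1/2)^N < e"
        using \<open>e > 0\<close> by (intro order_tendstoD(2)) auto
      then obtain N where N: "L * (1/2)^N < e" by (auto simp: eventually_sequentially)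
      obtain n where n: "\<And>x::int \<Rightarrow> 's. dist x (mask {- int n..} x) \<le> (1/2)^N"
        using dist_mask_past[of N] by blast
      let ?\<pi> = "mask {- int n..}"
      have small: "\<bar>h x - h (?\<pi> x)\<bar> \<le> e" for x
      proof -
        have "\<bar>h x - h (?\<pi> x)\<bar> \<le> L * dist x (?\<pi> x)"
          using lipschitz_onD[OF h(1), of x "?\<pi> x"] by (simp add: dist_real_def)
        also have "\<dots> \<le> L * (1/2)^N" using n L0 by (intro mult_left_mono) auto
        finally show ?thesis using N by linarith
      qed
      have "\<bar>(\<integral>x. h x \<partial>?\<mu> u) - (\<integral>x. h (?\<pi> x) \<partial>?\<mu> u)\<bar> \<le> e" for u
      proof (rule integral_diff_le[OF _ _ _ _ _ hb hb small])
        show "finite_measure (?\<mu> u)"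
          by (intro finite_measure.finite_measure_distr finite_measure_polar_law) measurable
        show "measure (?\<mu> u) UNIV \<le> 1"
          using measure_polar_law_le_1[of u] sets_eq_imp_space_eq[OF sets_polar_law[of u]]
          by (subst measure_distr) auto
      qed measurable
      moreover have "(\<integral>x. h (?\<pi> x) \<partial>?\<mu> u) = (\<integral>z. h (?\<pi> (snd z)) \<partial>polar_law u)" for u
        by (subst integral_distr) (auto simp: mask_UNIV)
      moreover have "\<bar>(\<integral>x. h (?\<pi> x) \<partial>Q') - (\<integral>x. h x \<partial>Q')\<bar> \<le> e"
        using integral_diff_le[OF Q'.finite_measure_axioms Q'(2) _ _ _ hb hb small] Q'.prob_le_1
        by (simp add: abs_minus_commute)
      moreover have "(\<integral>x. h x \<partial>Qs n) = (\<integral>x. h (?\<pi> x) \<partial>Q')"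
        unfolding Q'(3)[symmetric] by (rule integral_distr) measurable
      ultimately show "\<exists>g l. (g \<longlongrightarrow> l) at_top \<and>
          (\<forall>\<^sub>F u in at_top. \<bar>(\<integral>x. h x \<partial>?\<mu> u) - g u\<bar> \<le> e) \<and> \<bar>l - (\<integral>x. h x \<partial>Q')\<bar> \<le> e"
        using spectral_lawD[OF Qs hc hb, of n]
        by (intro exI[of _ "\<lambda>u. \<integral>z. h (?\<pi> (snd z)) \<partial>polar_law u"] exI[of _ "\<integral>x. h x \<partial>Qs n"]) auto
    qed
  qed simp
  then show thesis using Q' by (intro that) (simp add: spectral_law_def)
qed

end

subsection \<open>Equivalence of the limits and the time change formula\<close>

lemma converges_weakly_continuous_map:
  fixes r :: "'a::topological_space \<Rightarrow> 'b::topological_space"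
  assumes conv: "converges_weakly_in euclidean \<mu> \<nu> F" and r: "continuous_on UNIV r"
    and s: "\<And>i. sets (\<mu> i) = sets borel" "sets \<nu> = sets borel"
  shows "converges_weakly_in euclidean (\<lambda>i. distr (\<mu> i) borel r) (distr \<nu> borel r) F"
  unfolding converges_weakly_in_euclidean_iff
proof (intro allI impI, elim conjE)
  fix f :: "'b \<Rightarrow> real" assume f: "continuous_on UNIV f" "bounded (range f)"
  have "r \<in> borel_measurable borel" by (rule borel_measurable_continuous_onI[OF r])
  then have *: "(\<integral>x. f x \<partial>distr m borel r) = (\<integral>x. f (r x) \<partial>m)" if "sets m = sets borel" for m
    using that by (intro integral_distr borel_measurable_continuous_onI[OF f(1)]) (simp cong: measurable_cong_sets)
  have "continuous_on UNIV (\<lambda>x. f (r x))" by (rule continuous_on_compose2[OF f(1) r]) simp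
  moreover have "bounded (range (\<lambda>x. f (r x)))" by (rule bounded_subset[OF f(2)]) auto
  ultimately show "((\<lambda>i. \<integral>x. f x \<partial>distr (\<mu> i) borel r) \<longlongrightarrow> (\<integral>x. f x \<partial>distr \<nu> borel r)) F"
    using conv s unfolding converges_weakly_in_euclidean_iff by (simp add: *)
qed

lemma continuous_on_reindex: "continuous_on UNIV (\<lambda>(x::'i \<Rightarrow> 's::topological_space) t. x (g t))"
proof (rule continuous_on_coordinatewise_then_product)
  fix i show "continuous_on UNIV (\<lambda>x::'i \<Rightarrow> 's. x (g i))"
    using continuous_on_product_then_coordinatewise[OF continuous_on_id] by simp
qed

lemma measure_pair_Times:
  assumes "sigma_finite_measure N" "A \<in> sets M" "B \<in> sets N"
  shows "measure (M \<Otimes>\<^sub>M N) (A \<times> B) = measure M A * measure N B"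
  using sigma_finite_measure.emeasure_pair_measure_Times[OF assms]
  by (simp add: measure_def enn2real_mult)

text \<open>The marginal of the reversed series over \<open>J\<close> is the reflected marginal of
  \<open>X\<close> over \<open>uminus\<close> applied to \<open>J\<close>, and a shift by
  \<open>h\<close> becomes a shift by \<open>- h\<close>.\<close>

lemma strictly_stationary_reverse:
  fixes X :: "int \<Rightarrow> 'w \<Rightarrow> 's::topological_space"
  assumes st: "strictly_stationary M X" and [measurable]: "\<And>t. X t \<in> borel_measurable M"
  shows "strictly_stationary M (\<lambda>t. X (- t))"
  unfolding strictly_stationary_def
proof (intro allI impI)
  fix J :: "int set" and h :: int assume J: "finite J"
  let ?J = "uminus ` J" and ?P = "\<lambda>J. PiM J (\<lambda>_. borel :: 's measure)"
  have r: "(\<lambda>x. \<lambda>t\<in>J. x (- t)) \<in> ?P ?J \<rightarrow>\<^sub>M ?P J"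
    by (intro measurable_restrict measurable_component_singleton) auto
  have eq: "distr M (?P J) (\<lambda>\<omega>. \<lambda>t\<in>J. X (- t + k) \<omega>) =
      distr (distr M (?P ?J) (\<lambda>\<omega>. \<lambda>t\<in>?J. X (t + k) \<omega>)) (?P J) (\<lambda>x. \<lambda>t\<in>J. x (- t))" for k
  proof -
    have "(\<lambda>\<omega>. \<lambda>t\<in>?J. X (t + k) \<omega>) \<in> M \<rightarrow>\<^sub>M ?P ?J" by (intro measurable_restrict) measurable
    from distr_distr[OF r this] show ?thesis by (simp add: comp_def restrict_def cong: if_cong)
  qed
  have *: "distr M (?P ?J) (\<lambda>\<omega>. \<lambda>t\<in>?J. X (t + - h) \<omega>) = distr M (?P ?J) (\<lambda>\<omega>. \<lambda>t\<in>?J. X (t + 0) \<omega>)"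
    using st[unfolded strictly_stationary_def, rule_format, of ?J] J by (simp only: finite_imageI)
  have "distr M (?P J) (\<lambda>\<omega>. \<lambda>t\<in>J. X (- t + - h) \<omega>) = distr M (?P J) (\<lambda>\<omega>. \<lambda>t\<in>J. X (- t + 0) \<omega>)"
    unfolding eq * ..
  then show "distr M (?P J) (\<lambda>\<omega>. \<lambda>t\<in>J. X (- (t + h)) \<omega>) = distr M (?P J) (\<lambda>\<omega>. \<lambda>t\<in>J. X (- t) \<omega>)"
    by simp
qed

context stationary_series
begin

section \<open>From the limit statements to laws on the path space\<close>

lemma sets_spectral_law: "spectral_law T Q \<Longrightarrow> sets Q = sets borel"
  by (simp add: spectral_law_def)

lemma spectral_law_subset:
  assumes Q: "spectral_law T Q" and "S \<subseteq> T"
  shows "spectral_law S (distr Q borel (mask S))"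
proof -
  have sQ[measurable_cong]: "sets Q = sets borel" using Q by (rule sets_spectral_law)
  have "converges_weakly_in euclidean (\<lambda>u. distr (distr (polar_law u) borel (\<lambda>z. mask T (snd z))) borel (mask S))
      (distr Q borel (mask S)) at_top"
    using Q by (intro converges_weakly_continuous_map continuous_on_mask) (auto simp: spectral_law_def)
  moreover have "distr (distr (polar_law u) borel (\<lambda>z. mask T (snd z))) borel (mask S) =
      distr (polar_law u) borel (\<lambda>z. mask S (snd z))" for u
    using \<open>S \<subseteq> T\<close> by (subst distr_distr) (auto simp: comp_def mask_mask Int_absorb2)
  ultimately show ?thesis
    using Q by (auto simp: spectral_law_def intro!: prob_space.prob_space_distr)
qed

lemma tail_eq: "tail = (\<lambda>u. measure M {\<omega> \<in> space M. \<rho> (X 0 \<omega>) > u})"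
  by (simp add: tail_def exceedance_def fun_eq_iff)

lemma mask_process_measurable:
  assumes "\<forall>t\<in>T. \<Theta> t \<in> borel_measurable N"
  shows "(\<lambda>\<omega>. mask T (\<lambda>t. \<Theta> t \<omega>)) \<in> borel_measurable N"
  unfolding mask_def
proof (rule measurable_coordinatewise_then_product)
  fix i show "(\<lambda>\<omega>. if i \<in> T then \<Theta> i \<omega> else orig) \<in> borel_measurable N"
    using assms by (cases "i \<in> T") auto
qed

lemma spectral_law_of_spectral_limit:
  assumes "spectral_limit M X smul \<rho> T N \<Theta>"
  shows "spectral_law T (distr N borel (\<lambda>\<omega>. mask T (\<lambda>t. \<Theta> t \<omega>)))"
  using assms mask_process_measurable[of T \<Theta> N]
  unfolding spectral_limit_iff spectral_law_def by (auto intro!: prob_space.prob_space_distr)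

lemma has_spectral_limit_iff:
  "has_spectral_limit M X smul \<rho> \<alpha> T \<longleftrightarrow> regularly_varying (- \<alpha>) tail \<and> (\<exists>Q. spectral_law T Q)"
proof
  assume "has_spectral_limit M X smul \<rho> \<alpha> T"
  then show "regularly_varying (- \<alpha>) tail \<and> (\<exists>Q. spectral_law T Q)"
    unfolding has_spectral_limit_def tail_eq using spectral_law_of_spectral_limit by blast
next
  assume *: "regularly_varying (- \<alpha>) tail \<and> (\<exists>Q. spectral_law T Q)"
  then obtain Q where Q: "spectral_law T Q" by blast
  note [measurable_cong] = sets_spectral_law[OF Q]
  \<comment> \<open>The sample space is \<open>Q\<close> with its coordinate process. Restricting
    from \<open>T\<close> to itself supplies the limit as \<open>distr Q borel (mask T)\<close>, the
    law of the masked coordinates.\<close>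
  have "spectral_limit M X smul \<rho> T Q (\<lambda>t x. x t)"
    using Q spectral_law_subset[OF Q order_refl] unfolding spectral_limit_iff
    by (auto simp: spectral_law_def)
  then show "has_spectral_limit M X smul \<rho> \<alpha> T"
    using * unfolding has_spectral_limit_def tail_eq by blast
qed

text \<open>The sample space is the product of the Pareto law and the angular law, which turns
  independence into a product formula on rectangles.\<close>

lemma has_polar_limit_of_spectral:
  assumes "has_spectral_limit M X smul \<rho> \<alpha> T" shows "has_polar_limit M X smul \<rho> \<alpha> T"
proof -
  obtain Q where rv: "regularly_varying (- \<alpha>) tail" and Q: "spectral_law T Q"
    using assms by (auto simp: has_spectral_limit_iff)
  have sQ[measurable_cong]: "sets Q = sets borel" and pQ: "prob_space Q"
    and conv: "converges_weakly_in euclidean (\<lambda>u. distr (polar_law u) borel (\<lambda>z. mask T (snd z))) Q at_top"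
    using Q by (auto simp: spectral_law_def)
  interpret R: prob_space "pareto \<alpha>" by (rule prob_space_pareto) (rule index_pos)
  interpret Q: prob_space Q by fact
  interpret PQ: pair_prob_space "pareto \<alpha>" Q ..
  let ?N = "pareto \<alpha> \<Otimes>\<^sub>M Q" and ?r = "\<lambda>z::real \<times> (int \<Rightarrow> 's). (fst z, mask T (snd z))"
  have sN: "sets ?N = sets borel" by (rule sets_pareto_pair) fact
  have spN: "space ?N = UNIV" using sets_eq_imp_space_eq[OF sN] by simp
  have spQ: "space Q = UNIV" using sets_eq_imp_space_eq[OF sQ] by simp
  have rc: "continuous_on UNIV ?r"
    by (intro continuous_on_Pair continuous_on_fst continuous_on_id
        continuous_on_compose2[OF continuous_on_mask[of UNIV] continuous_on_snd]) auto
  have rm[measurable]: "?r \<in> borel \<rightarrow>\<^sub>M borel" by (rule borel_measurable_continuous_onI[OF rc])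
  \<comment> \<open>\<open>?r\<close> is idempotent: applying it once more leaves the prelimit
    unchanged and brings the limit into the masked form asked for by
    \<open>polar_limit_iff\<close>.\<close>
  have "converges_weakly_in euclidean (\<lambda>u. distr (distr (polar_law u) borel ?r) borel ?r) (distr ?N borel ?r) at_top"
    using polar_conv_of_spectral_conv[OF rv pQ sQ conv] sN rc by (intro converges_weakly_continuous_map) auto
  moreover have "distr (distr (polar_law u) borel ?r) borel ?r = distr (polar_law u) borel ?r" for u
    by (subst distr_distr) (auto simp: comp_def mask_mask)
  ultimately have c: "converges_weakly_in euclidean (\<lambda>u. distr (polar_law u) borel ?r) (distr ?N borel ?r) at_top"
    by simp
  have "polar_limit M X smul \<rho> T ?N fst (\<lambda>t z. snd z t)"
    unfolding polar_limit_iff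
  proof (intro conjI ballI)
    show "(\<lambda>z. snd z t) \<in> borel_measurable ?N" for t
      using measurable_compose[OF snd_borel_measurable coordinate_measurable] by (simp add: measurable_cong_sets[OF sN refl])
    show "fst \<in> borel_measurable ?N" by (simp add: measurable_cong_sets[OF sN refl])
  qed (use c PQ.P.prob_space_axioms in auto)
  moreover have "pareto_distributed ?N \<alpha> fst"
    unfolding pareto_distributed_def
  proof (intro conjI allI impI)
    show "fst \<in> borel_measurable ?N" by (simp add: measurable_cong_sets[OF sN refl])
    fix y :: real assume "y \<ge> 1"
    have "{z \<in> space ?N. y < fst z} = {y<..} \<times> UNIV" by (auto simp: spN)
    then show "measure ?N {z \<in> space ?N. y < fst z} = y powr (- \<alpha>)"
      using measure_pair_Times[OF Q.sigma_finite_measure_axioms, of "{y<..}" "pareto \<alpha>" UNIV] sQ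
        Q.prob_space measure_pareto_greaterThan[OF index_pos \<open>y \<ge> 1\<close>] by (simp add: spQ)
  qed
  moreover have "independent_elements ?N borel fst (PiM T (\<lambda>_. borel)) (\<lambda>z. \<lambda>t\<in>T. snd z t)"
    unfolding independent_elements_def
  proof (rule PQ.P.indep_setI)
    let ?K = "PiM T (\<lambda>_. borel :: 's measure)" and ?g = "\<lambda>x::int \<Rightarrow> 's. \<lambda>t\<in>T. x t"
    have g: "?g \<in> borel \<rightarrow>\<^sub>M ?K" by (intro measurable_restrict) measurable
    have A: "fst -` A \<inter> space ?N = A \<times> UNIV" "A \<in> sets (pareto \<alpha>)" if "A \<in> sets borel" for A
      using that by (auto simp: spN)
    have B: "(\<lambda>z. ?g (snd z)) -` B \<inter> space ?N = UNIV \<times> (?g -` B)" "?g -` B \<in> sets Q" if "B \<in> sets ?K" for B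
      using measurable_sets[OF g that] sQ by (auto simp: spN)
    have U: "UNIV \<in> sets (pareto \<alpha>)" "UNIV \<in> sets Q" using sQ by auto
    show "{fst -` A \<inter> space ?N |A. A \<in> sets borel} \<subseteq> PQ.P.events"
      "{(\<lambda>z. ?g (snd z)) -` B \<inter> space ?N |B. B \<in> sets ?K} \<subseteq> PQ.P.events"
      using U by (auto simp only: A B intro!: pair_measureI)
    fix a b
    assume "a \<in> {fst -` A \<inter> space ?N |A. A \<in> sets borel}" "b \<in> {(\<lambda>z. ?g (snd z)) -` B \<inter> space ?N |B. B \<in> sets ?K}"
    then obtain A' B' where "a = fst -` A' \<inter> space ?N" "A' \<in> sets borel"
      "b = (\<lambda>z. ?g (snd z)) -` B' \<inter> space ?N" "B' \<in> sets ?K" by auto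
    then have ab: "a = A' \<times> UNIV" "b = UNIV \<times> (?g -` B')" "A' \<in> sets (pareto \<alpha>)" "?g -` B' \<in> sets Q"
      using A[of A'] B[of B'] by simp_all
    have "a \<inter> b = A' \<times> (?g -` B')" using ab by auto
    then show "PQ.prob (a \<inter> b) = PQ.prob a * PQ.prob b"
      using ab U R.prob_space Q.prob_space
      by (simp add: measure_pair_Times[OF Q.sigma_finite_measure_axioms] spQ)
  qed
  ultimately show ?thesis unfolding has_polar_limit_def by blast
qed

text \<open>Projecting the joint limit to its components gives the angular limit directly and,
  through the Pareto tail of the radial component, regular variation.\<close>

lemma has_spectral_limit_of_polar:
  assumes "has_polar_limit M X smul \<rho> \<alpha> T" shows "has_spectral_limit M X smul \<rho> \<alpha> T"
proof -
  obtain N :: "(real \<times> (int \<Rightarrow> 's)) measure" and Y \<Theta>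
    where pl: "polar_limit M X smul \<rho> T N Y \<Theta>" and pd: "pareto_distributed N \<alpha> Y"
    using assms by (auto simp: has_polar_limit_def)
  have N: "prob_space N" and [measurable]: "Y \<in> borel_measurable N" and \<Theta>: "\<forall>t\<in>T. \<Theta> t \<in> borel_measurable N"
    and conv: "converges_weakly_in euclidean (\<lambda>u. distr (polar_law u) borel (\<lambda>z. (fst z, mask T (snd z))))
       (distr N borel (\<lambda>\<omega>. (Y \<omega>, mask T (\<lambda>t. \<Theta> t \<omega>)))) at_top"
    using pl by (auto simp: polar_limit_iff)
  note [measurable] = mask_process_measurable[OF \<Theta>]
  have [measurable]: "(\<lambda>z::real \<times> (int \<Rightarrow> 's). (fst z, mask T (snd z))) \<in> borel \<rightarrow>\<^sub>M borel"
    by (intro borel_measurable_Pair) measurable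
  have [measurable]: "(\<lambda>\<omega>. (Y \<omega>, mask T (\<lambda>t. \<Theta> t \<omega>))) \<in> N \<rightarrow>\<^sub>M borel"
    by (intro borel_measurable_Pair) measurable
  have c1: "converges_weakly_in euclidean (\<lambda>u. distr (polar_law u) borel fst) (distr N borel Y) at_top"
    using converges_weakly_continuous_map[OF conv continuous_on_fst[OF continuous_on_id]]
    by (simp add: distr_distr comp_def)
  have c2: "converges_weakly_in euclidean (\<lambda>u. distr (polar_law u) borel (\<lambda>z. mask T (snd z)))
      (distr N borel (\<lambda>\<omega>. mask T (\<lambda>t. \<Theta> t \<omega>))) at_top"
    using converges_weakly_continuous_map[OF conv continuous_on_snd[OF continuous_on_id]]
    by (simp add: distr_distr comp_def)
  have "regularly_varying (- \<alpha>) tail"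
  proof (rule regularly_varying_of_radial_conv)
    fix \<psi> :: "real \<Rightarrow> real" assume \<psi>: "continuous_on UNIV \<psi>" "bounded (range \<psi>)"
    have "(\<integral>y. \<psi> y \<partial>distr (polar_law u) borel fst) = (\<integral>z. \<psi> (fst z) \<partial>polar_law u)" for u
      by (intro integral_distr borel_measurable_continuous_onI[OF \<psi>(1)]) simp
    then show "((\<lambda>u. \<integral>z. \<psi> (fst z) \<partial>polar_law u) \<longlongrightarrow> (\<integral>y. \<psi> y \<partial>distr N borel Y)) at_top"
      using c1 \<psi> unfolding converges_weakly_in_euclidean_iff by auto
  next
    show "measure (distr N borel Y) {y<..} = y powr (- \<alpha>)" if "y \<ge> 1" for y
    proof -
      have "measure (distr N borel Y) {y<..} = measure N {\<omega> \<in> space N. Y \<omega> > y}"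
        by (subst measure_distr) (auto intro!: arg_cong2[where f=measure])
      then show ?thesis using pd that by (simp add: pareto_distributed_def)
    qed
  qed (auto intro!: prob_space.prob_space_distr N)
  moreover have "spectral_law T (distr N borel (\<lambda>\<omega>. mask T (\<lambda>t. \<Theta> t \<omega>)))"
    unfolding spectral_law_def using c2 N by (auto intro!: prob_space.prob_space_distr)
  ultimately show ?thesis unfolding has_spectral_limit_iff by blast
qed

lemma has_polar_limit_iff: "has_polar_limit M X smul \<rho> \<alpha> T \<longleftrightarrow> has_spectral_limit M X smul \<rho> \<alpha> T"
proof
  assume "has_polar_limit M X smul \<rho> \<alpha> T"
  then show "has_spectral_limit M X smul \<rho> \<alpha> T" by (rule has_spectral_limit_of_polar)
next
  assume "has_spectral_limit M X smul \<rho> \<alpha> T"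
  then show "has_polar_limit M X smul \<rho> \<alpha> T" by (rule has_polar_limit_of_spectral)
qed

lemma has_spectral_limit_subset:
  assumes "has_spectral_limit M X smul \<rho> \<alpha> T" "S \<subseteq> T"
  shows "has_spectral_limit M X smul \<rho> \<alpha> S"
proof -
  obtain Q where "regularly_varying (- \<alpha>) tail" "spectral_law T Q"
    using assms(1) unfolding has_spectral_limit_iff by blast
  with spectral_law_subset[OF this(2) assms(2)] show ?thesis
    unfolding has_spectral_limit_iff by blast
qed

lemma has_spectral_limit_forward:
  assumes "has_spectral_limit M X smul \<rho> \<alpha> {0..}" shows "has_spectral_limit M X smul \<rho> \<alpha> UNIV"
proof -
  obtain Q where Q: "forward_limit Q"
    using assms unfolding has_spectral_limit_iff forward_limit_def by blast
  obtain Q' where "spectral_law UNIV Q'" by (rule backward_extension[OF Q])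
  then show ?thesis using Q unfolding has_spectral_limit_iff forward_limit_def by blast
qed

section \<open>Time reversal\<close>

lemma stationary_series_reverse: "stationary_series orig smul \<rho> M (\<lambda>t. X (- t)) \<alpha>"
  by unfold_locales (auto intro: strictly_stationary_reverse stationary index_pos)

text \<open>The conditioning event involves only time 0, which reversal fixes. Hence the tail is
  unchanged, and the polar laws of the reversed series are reflections of the original ones.\<close>

lemma has_spectral_limit_reverse:
  assumes "has_spectral_limit M X smul \<rho> \<alpha> T"
  shows "has_spectral_limit M (\<lambda>t. X (- t)) smul \<rho> \<alpha> (uminus ` T)"
proof -
  have pm: "(\<lambda>\<omega>. (\<rho> (X 0 \<omega>) / u, angular \<omega>)) \<in> uniform_measure M (exceedance u) \<rightarrow>\<^sub>M borel" for u
    by simp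
  interpret R: stationary_series orig smul \<rho> M "\<lambda>t. X (- t)" \<alpha>
    by (rule stationary_series_reverse)
  let ?r = "\<lambda>(x::int \<Rightarrow> 's) t. x (- t)"
  have rc: "continuous_on UNIV ?r" by (rule continuous_on_reindex)
  have [measurable]: "?r \<in> borel \<rightarrow>\<^sub>M borel" by (rule borel_measurable_continuous_onI[OF rc])
  have rm[measurable]: "(\<lambda>z. (fst z, ?r (snd z))) \<in> borel \<rightarrow>\<^sub>M (borel :: (real \<times> (int \<Rightarrow> 's)) measure)"
    by (intro borel_measurable_Pair) measurable
  have tail: "R.tail = tail" by (simp add: fun_eq_iff R.tail_eq tail_eq)
  have law: "R.polar_law u = distr (polar_law u) borel (\<lambda>z. (fst z, ?r (snd z)))" for u
  proof -
    have "R.exceedance u = exceedance u" by (simp add: R.exceedance_def exceedance_def)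
    moreover have "R.angular \<omega> = ?r (angular \<omega>)" for \<omega> by (simp add: R.angular_def angular_def)
    moreover from distr_distr[OF rm pm]
    have "distr (polar_law u) borel (\<lambda>z. (fst z, ?r (snd z))) =
        distr (uniform_measure M (exceedance u)) borel (\<lambda>\<omega>. (\<rho> (X 0 \<omega>) / u, ?r (angular \<omega>)))"
      by (simp add: polar_law_def cond_law_def comp_def)
    ultimately show ?thesis by (simp add: R.polar_law_def cond_law_def)
  qed
  obtain Q where rv: "regularly_varying (- \<alpha>) tail" and Q: "spectral_law T Q"
    using assms by (auto simp: has_spectral_limit_iff)
  have sQ[measurable_cong]: "sets Q = sets borel" and pQ: "prob_space Q"
    and conv: "converges_weakly_in euclidean (\<lambda>u. distr (polar_law u) borel (\<lambda>z. mask T (snd z))) Q at_top"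
    using Q by (auto simp: spectral_law_def)
  have mr: "mask (uminus ` T) (?r x) = ?r (mask T x)" for x
  proof -
    have "t \<in> uminus ` T \<longleftrightarrow> - t \<in> T" for t by (auto intro: image_eqI[of _ _ "- t"])
    then show ?thesis by (simp add: mask_def)
  qed
  have "R.spectral_law (uminus ` T) (distr Q borel ?r)"
    unfolding R.spectral_law_def
  proof (intro conjI)
    have "distr (R.polar_law u) borel (\<lambda>z. mask (uminus ` T) (snd z)) =
        distr (distr (polar_law u) borel (\<lambda>z. mask T (snd z))) borel ?r" for u
      unfolding law by (simp add: distr_distr comp_def mr)
    then show "converges_weakly_in euclidean (\<lambda>u. distr (R.polar_law u) borel (\<lambda>z. mask (uminus ` T) (snd z)))
        (distr Q borel ?r) at_top"
      using converges_weakly_continuous_map[OF conv rc] sQ by simp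
  qed (auto intro!: prob_space.prob_space_distr pQ)
  then show ?thesis unfolding R.has_spectral_limit_iff tail using rv by blast
qed

lemma has_spectral_limit_backward:
  assumes "has_spectral_limit M X smul \<rho> \<alpha> {..0}" shows "has_spectral_limit M X smul \<rho> \<alpha> UNIV"
proof -
  interpret R: stationary_series orig smul \<rho> M "\<lambda>t. X (- t)" \<alpha>
    by (rule stationary_series_reverse)
  have "has_spectral_limit M (\<lambda>t. X (- t)) smul \<rho> \<alpha> {0..}"
    using has_spectral_limit_reverse[OF assms] by (simp add: image_uminus_atMost)
  \<comment> \<open>Reversing twice restores \<open>X\<close>, and the full index set is invariant
    under reflection.\<close>
  from R.has_spectral_limit_reverse[OF R.has_spectral_limit_forward[OF this]]
  show ?thesis by (simp add: surj_uminus)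
qed

text \<open>Integrals of a cutoff times a function of the window are limits of the same polar
  integrals, once through the full limit \<open>Q\<close> and once through the time change limit of
  its forward part. Removing the cutoff gives an identity of measures, and thereby access to
  unbounded Borel functions.\<close>

lemma time_change_measures:
  assumes rv: "regularly_varying (- \<alpha>) tail" and Q: "spectral_law UNIV Q" and "s \<ge> 0"
  shows "distr (density Q (indicator {x. 0 < \<rho> (x (- s))})) borel (mask {- s..}) =
    distr (tilt s (distr Q borel (mask {0..}))) borel (mask {- s..})"
    (is "distr ?D borel ?\<pi> = distr ?K borel ?\<pi>")
proof (rule measure_eq_of_integral_eq)
  have sQ[measurable_cong]: "sets Q = sets borel" and pQ: "prob_space Q" using Q by (auto simp: spectral_law_def)
  interpret Q: prob_space Q by fact
  let ?A = "{x. 0 < \<rho> (x (- s))}"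
  have A[measurable]: "?A \<in> sets borel"
    by (intro borel_open open_Collect_less continuous_intros continuous_on_coordinate)
  have fwd: "forward_limit (distr Q borel (mask {0..}))"
    using rv spectral_law_subset[OF Q, of "{0..}"] by (simp add: forward_limit_def)
  have "emeasure ?D (space ?D) = emeasure Q ?A"
    using sets_eq_imp_space_eq[OF sQ] by (simp add: emeasure_density)
  then have fD: "finite_measure ?D" by (intro finite_measureI) simp
  show "finite_measure (distr ?D borel ?\<pi>)"
    by (rule finite_measure.finite_measure_distr[OF fD]) simp
  have fK: "finite_measure ?K" by (rule finite_measure_tilt[OF fwd \<open>s \<ge> 0\<close>])
  show "finite_measure (distr ?K borel ?\<pi>)"
    by (rule finite_measure.finite_measure_distr[OF fK]) simp
  fix h :: "(int \<Rightarrow> 's) \<Rightarrow> real" assume h: "continuous_on UNIV h" "\<And>x. 0 \<le> h x" "\<And>x. h x \<le> 1"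
  then have b: "\<bar>h x\<bar> \<le> 1" for x by simp
  have [measurable]: "h \<in> borel_measurable borel" by (rule borel_measurable_continuous_onI[OF h(1)])
  have hc: "continuous_on UNIV (\<lambda>x. h (?\<pi> x))" by (rule continuous_on_compose2[OF h(1) continuous_on_mask]) simp
  have "(\<integral>x. cutoff s (1 / real (Suc j)) x * h (?\<pi> x) \<partial>?K) = (\<integral>x. cutoff s (1 / real (Suc j)) x * h (?\<pi> x) \<partial>Q)" for j
  proof -
    let ?c = "cutoff s (1 / real (Suc j))"
    have "continuous_on UNIV (\<lambda>x. ?c x * h (?\<pi> x))" by (intro continuous_on_mult continuous_on_cutoff hc) simp
    moreover have "\<bar>?c x * h (?\<pi> x)\<bar> \<le> 1" for x
      using cutoff_range[of s _ x] mult_mono[of "?c x" 1 "\<bar>h (?\<pi> x)\<bar>" 1] b by (simp add: abs_mult)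
    ultimately have "((\<lambda>u. \<integral>z. ?c (snd z) * h (?\<pi> (snd z)) \<partial>polar_law u) \<longlongrightarrow> (\<integral>x. ?c x * h (?\<pi> x) \<partial>Q)) at_top"
      using spectral_lawD[OF Q, of "\<lambda>x. ?c x * h (?\<pi> x)" 1] by (simp add: mask_UNIV)
    moreover have "((\<lambda>u. \<integral>z. ?c (snd z) * h (?\<pi> (snd z)) \<partial>polar_law u) \<longlongrightarrow> (\<integral>x. ?c x * h (?\<pi> x) \<partial>?K)) at_top"
      by (rule time_change_cutoff(2)[OF fwd \<open>s \<ge> 0\<close> _ hc h(2,3)]) (simp_all add: mask_mask)
    ultimately show ?thesis using tendsto_unique trivial_limit_at_top_linorder by blast
  qed
  moreover have "(\<lambda>j. \<integral>x. cutoff s (1 / real (Suc j)) x * h (?\<pi> x) \<partial>?K) \<longlonglongrightarrow> (\<integral>x. h (?\<pi> x) \<partial>?K)"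
    by (rule integral_cutoff_tilt_tendsto[OF fwd \<open>s \<ge> 0\<close>]) (auto intro: b)
  moreover have "(\<lambda>j. \<integral>x. cutoff s (1 / real (Suc j)) x * h (?\<pi> x) \<partial>Q) \<longlonglongrightarrow> (\<integral>x. indicator ?A x * h (?\<pi> x) \<partial>Q)"
    by (rule integral_cutoff_tendsto[OF Q.finite_measure_axioms sQ]) (auto intro: b)
  ultimately have "(\<integral>x. h (?\<pi> x) \<partial>?K) = (\<integral>x. indicator ?A x * h (?\<pi> x) \<partial>Q)"
    using LIMSEQ_unique by simp
  moreover have "(\<integral>x. h (?\<pi> x) \<partial>?D) = (\<integral>x. indicator ?A x * h (?\<pi> x) \<partial>Q)"
    using integral_density[of "\<lambda>x. h (?\<pi> x)" Q "indicator ?A"] by (simp add: ennreal_indicator)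
  ultimately show "(\<integral>x. h x \<partial>distr ?D borel ?\<pi>) = (\<integral>x. h x \<partial>distr ?K borel ?\<pi>)"
    by (simp add: integral_distr)
qed simp_all

text \<open>As \<open>F\<close> vanishes with the coordinate at \<open>- s\<close>, restricting
  \<open>Q\<close> to paths where this coordinate is not the origin does not affect it, and neither
  does masking to the window. Since the restricted and the tilted law agree on the window,
  integrability and integral transfer together.\<close>

lemma time_change_formula:
  fixes F :: "(int \<Rightarrow> 's) \<Rightarrow> real"
  assumes rv: "regularly_varying (- \<alpha>) tail" and Q: "spectral_law UNIV Q" and "s \<ge> 0"
    and F[measurable]: "F \<in> borel_measurable borel"
    and F0: "\<And>x. x (- s) = orig \<Longrightarrow> F x = 0" and Fm: "\<And>x. F (mask {- s..} x) = F x"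
  shows "integrable Q F \<longleftrightarrow> integrable Q (\<lambda>x. \<rho> (x s) powr \<alpha> * F (rebase s x))" (is ?I)
    and "(\<integral>x. F x \<partial>Q) = (\<integral>x. \<rho> (x s) powr \<alpha> * F (rebase s x) \<partial>Q)" (is ?E)
proof -
  have sQ[measurable_cong]: "sets Q = sets borel" using Q by (rule sets_spectral_law)
  let ?A = "{x. 0 < \<rho> (x (- s))}" and ?\<pi> = "mask {- s..}" and ?Q0 = "distr Q borel (mask {0..})"
  let ?D = "density Q (indicator ?A)"
  have A[measurable]: "?A \<in> sets borel"
    by (intro borel_open open_Collect_less continuous_intros continuous_on_coordinate)
  have FA: "indicator ?A x * F x = F x" for x
  proof (cases "\<rho> (x (- s)) = 0")
    case True
    then show ?thesis using F0[of x] modulus_eq_0_iff by simp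
  next
    case False
    then show ?thesis using modulus_nonneg[of "x (- s)"] by (simp add: less_le)
  qed
  have D: "density Q (indicator ?A) = density Q (\<lambda>x. ennreal (indicator ?A x))" by (simp add: ennreal_indicator)
  \<comment> \<open>The tilt acts on the forward part \<open>?Q0\<close>; the rebased path on the
    window reads forward coordinates only, so \<open>Q\<close> itself may take its place.\<close>
  have fr: "F (rebase s (mask {0..} x)) = F (rebase s x)" for x
    using Fm[of "rebase s (mask {0..} x)"] Fm[of "rebase s x"] mask_rebase[OF \<open>s \<ge> 0\<close>, of x] by simp
  have ms: "mask {0..} x s = x s" for x using \<open>s \<ge> 0\<close> by (simp add: mask_apply)
  note eq = time_change_measures[OF rv Q \<open>s \<ge> 0\<close>]
  have "integrable Q F \<longleftrightarrow> integrable ?D F"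
    unfolding D by (subst integrable_density) (auto simp: FA)
  also have "\<dots> \<longleftrightarrow> integrable (distr ?D borel ?\<pi>) F"
    by (subst integrable_distr_eq) (auto simp: Fm)
  also have "\<dots> \<longleftrightarrow> integrable (tilt s ?Q0) F"
    unfolding eq by (subst integrable_distr_eq) (auto simp: Fm)
  also have "\<dots> \<longleftrightarrow> integrable Q (\<lambda>x. \<rho> (x s) powr \<alpha> * F (rebase s x))"
    by (subst integrable_tilt_iff) (auto simp: integrable_distr_eq ms fr)
  finally show ?I .
  have "(\<integral>x. F x \<partial>Q) = (\<integral>x. F x \<partial>?D)"
    unfolding D by (subst integral_density) (auto simp: FA)
  also have "\<dots> = (\<integral>x. F x \<partial>distr ?D borel ?\<pi>)"
    by (subst integral_distr) (auto simp: Fm)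
  also have "\<dots> = (\<integral>x. F x \<partial>tilt s ?Q0)"
    unfolding eq by (subst integral_distr) (auto simp: Fm)
  also have "\<dots> = (\<integral>x. \<rho> (x s) powr \<alpha> * F (rebase s x) \<partial>Q)"
    by (subst integral_tilt) (auto simp: integral_distr ms fr)
  finally show ?E .
qed

lemma spectral_time_change:
  fixes f :: "(nat \<Rightarrow> 's) \<Rightarrow> real" and s t :: nat
  assumes rv: "regularly_varying (- \<alpha>) tail" and \<Theta>: "spectral_limit M X smul \<rho> UNIV N \<Theta>"
    and f[measurable]: "f \<in> borel_measurable (PiM {..s + t} (\<lambda>_. borel))"
    and f0: "\<And>\<theta>. \<theta> \<in> space (PiM {..s + t} (\<lambda>_. borel :: 's measure)) \<Longrightarrow> \<theta> 0 = orig \<Longrightarrow> f \<theta> = 0"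
  defines "L \<equiv> \<lambda>\<omega>. f (\<lambda>i\<in>{..s + t}. \<Theta> (int i - int s) \<omega>)"
    and "R \<equiv> \<lambda>\<omega>. if \<rho> (\<Theta> (int s) \<omega>) = 0 then 0
      else f (\<lambda>i\<in>{..s + t}. smul (1 / \<rho> (\<Theta> (int s) \<omega>)) (\<Theta> (int i) \<omega>)) * \<rho> (\<Theta> (int s) \<omega>) powr \<alpha>"
  shows "integrable N L \<longleftrightarrow> integrable N R" and "(\<integral>\<omega>. L \<omega> \<partial>N) = (\<integral>\<omega>. R \<omega> \<partial>N)"
proof -
  \<comment> \<open>Argument \<open>i\<close> of \<open>f\<close> stands for time
    \<open>i - s\<close>: argument 0 is time \<open>- s\<close>, and after \<open>rebase s\<close>
    argument \<open>i\<close> reads time \<open>i\<close>.\<close>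
  define F where "F x = f (\<lambda>i\<in>{..s + t}. x (int i - int s))" for x :: "int \<Rightarrow> 's"
  have [measurable]: "(\<lambda>x::int \<Rightarrow> 's. \<lambda>i\<in>{..s + t}. x (int i - int s)) \<in> borel \<rightarrow>\<^sub>M PiM {..s + t} (\<lambda>_. borel)"
    by (intro measurable_restrict) measurable
  have Fmeas[measurable]: "F \<in> borel_measurable borel" unfolding F_def by measurable
  define Q where "Q = distr N borel (\<lambda>\<omega> t. \<Theta> t \<omega>)"
  have Q: "spectral_law UNIV Q"
    using spectral_law_of_spectral_limit[OF \<Theta>] by (simp add: Q_def mask_UNIV)
  have \<Theta>m[measurable]: "(\<lambda>\<omega> t. \<Theta> t \<omega>) \<in> borel_measurable N"
    using \<Theta> by (intro measurable_coordinatewise_then_product) (auto simp: spectral_limit_iff)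
  have F0: "F x = 0" if "x (- int s) = orig" for x
    unfolding F_def using that by (intro f0) (auto simp: space_PiM)
  have Fm: "F (mask {- int s..} x) = F x" for x
    unfolding F_def by (intro arg_cong[where f=f]) (auto simp: mask_def restrict_def)
  have L: "L \<omega> = F (\<lambda>t. \<Theta> t \<omega>)" for \<omega> by (simp add: L_def F_def)
  \<comment> \<open>The default 0 at modulus 0 agrees with the right-hand side because
    \<open>0 powr \<alpha>\<close> is 0.\<close>
  have R: "R \<omega> = \<rho> (\<Theta> (int s) \<omega>) powr \<alpha> * F (rebase (int s) (\<lambda>t. \<Theta> t \<omega>))" for \<omega>
    by (simp add: R_def F_def rebase_def mult.commute)
  note tc = time_change_formula[OF rv Q _ Fmeas, of "int s", OF _ F0 Fm]
  show "integrable N L \<longleftrightarrow> integrable N R"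
    using tc(1) unfolding L R Q_def by (simp add: integrable_distr_eq)
  show "(\<integral>\<omega>. L \<omega> \<partial>N) = (\<integral>\<omega>. R \<omega> \<partial>N)"
    using tc(2) unfolding L R Q_def by (simp add: integral_distr)
qed

end

theorem theorem6p1:
  fixes M :: "'w measure"
    and X :: "int \<Rightarrow> 'w \<Rightarrow> 's::polish_space"
    and orig :: 's
    and smul :: "real \<Rightarrow> 's \<Rightarrow> 's"
    and \<rho> :: "'s \<Rightarrow> real"
    and \<alpha> :: real
  assumes "prob_space M"
    and "\<And>t. X t \<in> borel_measurable M"
    and "strictly_stationary M X"
    and "scalar_multiplication orig smul"
    and "modulus orig smul \<rho>"
    and "\<alpha> > 0"
  shows "(has_spectral_limit M X smul \<rho> \<alpha> UNIV \<longleftrightarrow> has_spectral_limit M X smul \<rho> \<alpha> {0..}) \<and>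
    (has_spectral_limit M X smul \<rho> \<alpha> UNIV \<longleftrightarrow> has_spectral_limit M X smul \<rho> \<alpha> {..0}) \<and>
    (has_spectral_limit M X smul \<rho> \<alpha> UNIV \<longleftrightarrow> has_polar_limit M X smul \<rho> \<alpha> UNIV) \<and>
    (has_spectral_limit M X smul \<rho> \<alpha> UNIV \<longleftrightarrow> has_polar_limit M X smul \<rho> \<alpha> {0..}) \<and>
    (has_spectral_limit M X smul \<rho> \<alpha> UNIV \<longleftrightarrow> has_polar_limit M X smul \<rho> \<alpha> {..0}) \<and>
    (\<forall>(N :: 'b measure) \<Theta>.
      has_spectral_limit M X smul \<rho> \<alpha> UNIV \<and> spectral_limit M X smul \<rho> UNIV N \<Theta> \<longrightarrow>
      (\<forall>(s::nat) (t::nat) (f :: (nat \<Rightarrow> 's) \<Rightarrow> real).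
        f \<in> borel_measurable (PiM {..s + t} (\<lambda>_. borel)) \<and>
        (\<forall>\<theta> \<in> space (PiM {..s + t} (\<lambda>_. borel :: 's measure)). \<theta> 0 = orig \<longrightarrow> f \<theta> = 0) \<longrightarrow>
        (let L = (\<lambda>\<omega>. f (\<lambda>i\<in>{..s + t}. \<Theta> (int i - int s) \<omega>));
             R = (\<lambda>\<omega>. if \<rho> (\<Theta> (int s) \<omega>) = 0 then 0
                      else f (\<lambda>i\<in>{..s + t}. smul (1 / \<rho> (\<Theta> (int s) \<omega>)) (\<Theta> (int i) \<omega>))
                             * \<rho> (\<Theta> (int s) \<omega>) powr \<alpha>)
         in (integrable N L \<longleftrightarrow> integrable N R) \<and>
            (integrable N L \<longrightarrow> (\<integral>\<omega>. L \<omega> \<partial>N) = (\<integral>\<omega>. R \<omega> \<partial>N)))))"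
proof -
  interpret prob_space M by fact
  interpret stationary_series orig smul \<rho> M X \<alpha>
    using assms by unfold_locales auto
  have eq: "has_spectral_limit M X smul \<rho> \<alpha> UNIV \<longleftrightarrow> has_spectral_limit M X smul \<rho> \<alpha> {0..}"
    "has_spectral_limit M X smul \<rho> \<alpha> UNIV \<longleftrightarrow> has_spectral_limit M X smul \<rho> \<alpha> {..0}"
    using has_spectral_limit_subset[of UNIV] has_spectral_limit_forward has_spectral_limit_backward by blast+
  show ?thesis
    unfolding has_polar_limit_iff Let_def
    using eq spectral_time_change unfolding has_spectral_limit_iff by (intro conjI allI impI) blast+
qed

end
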